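(* Let $D$ be a classifying space of graded-polarized mixed Hodge structures with Hodge numbers satisfying $h^{p,q}=0$ unless $p=q$. Then the curvature of the mixed Hodge metric of $D$ is identically zero, and the mixed Hodge metric pulls back to a Kähler pseudo-metric along any period map $\varphi:S\to\Gamma\backslash D$.
   Context: Classifying space: fix a finite-dimensional real vector space $V_{\mathbb R}$, an increasing (weight) filtration $W$, non-degenerate $(-1)^k$-symmetric real bilinear forms $Q_k$ on $\operatorname{gr}^W_k$, and numbers $h^{p,q}$. $D$ is the set of decreasing filtrations $F$ of $V_{\mathbb C}$ such that $(F,W)$ is a mixed Hodge structure, graded-polarized by $\{Q_k\}$, with Hodge numbers $h^{p,q}$. For $F\in D$ the Deligne bigrading is the unique functorial $V_{\mathbb C}=\bigoplus I^{p,q}$ with $F^p=\bigoplus_{a\ge p}I^{a,b}$, $W_k=\bigoplus_{a+b\le k}I^{a,b}$, $\overline{I^{p,q}}\equiv I^{q,p}$ mod $\bigoplus_{a<q,b<p}I^{a,b}$. The mixed Hodge metric $h_F$ on $V_{\mathbb C}$ makes the bigrading orthogonal with $h_F(u,v)=\mathrm i^{p-q}Q_{p+q}([u],[\bar v])$ for $u,v\in I^{p,q}$; on $\operatorname{End}(V_{\mathbb C})$, $h_F(\alpha,\beta)=\operatorname{Tr}(\alpha\beta^* )$. $G_{\mathbb C}$ is the group of complex automorphisms of $V_{\mathbb C}$ preserving $W$ and inducing automorphisms of the $Q_k$; $G_{\mathbb R}=G_{\mathbb C}\cap GL(V_{\mathbb R})$; $\mathfrak g_{\mathbb C}$ is the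 Lie algebra of $G_{\mathbb C}$; $\mathfrak g^{r,s}$ is the set of elements of $\mathfrak g_{\mathbb C}$ mapping each $I^{p,q}$ to $I^{p+r,q+s}$; $\mathfrak q_F=\bigoplus_{r<0}\mathfrak g^{r,s}$. $D$ is a complex manifold, open in $G_{\mathbb C}\cdot F$; $u\mapsto\frac{d}{dt}|_0e^{tu}\cdot F$ identifies $\mathfrak q_F$ with $T_F^{1,0}D$, and the mixed Hodge metric on the holomorphic tangent bundle $T(D)$ is $h_F$ restricted to $\mathfrak q_F$. Its curvature is that of its Chern connection. $G_{\mathbb R}$ acts by holomorphic isometries. A tangent vector $u\in\mathfrak q_F$ is horizontal if $u\in\bigoplus_s\mathfrak g^{-1,s}$. A period map is the holomorphic, horizontal, locally liftable map $\varphi:S\to\Gamma\backslash D$ ($\Gamma\subset G_{\mathbb R}$ the monodromy group) attached to a graded-polarized variation of mixed Hodge structure over a complex manifold $S$. The pullback of the mixed Hodge metric along $\varphi$ is a pseudo-metric (a semi-positive hermitian form on each holomorphic tangent space); it is called Kähler if its associated $(1,1)$-form is closed. *)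

theory Defs
  imports "HOL-Analysis.Analysis"
begin

text \<open>
  The real vector space is \<open>real ^ 'n\<close>, its complexification is \<open>complex ^ 'n\<close>, and
  endomorphisms of the latter are matrices. Complex subspaces, spans and dimensions are
  \<open>vec.subspace\<close>, \<open>vec.span\<close>, \<open>vec.dim\<close>.
  An object living on a graded piece \<open>gr\<^sub>k = W\<^sub>k / W\<^sub>k\<^sub>-\<^sub>1\<close> is described by its preimage
  in (respectively its pullback to) \<open>W\<^sub>k\<close>.
\<close>

type_synonym 'n wfilt = "int \<Rightarrow> (real ^ 'n) set"
type_synonym 'n hfilt = "int \<Rightarrow> (complex ^ 'n) set"
type_synonym 'n gforms = "int \<Rightarrow> real ^ 'n \<Rightarrow> real ^ 'n \<Rightarrow> real"
type_synonym 'n cmat = "complex ^ 'n ^ 'n"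

section \<open>Complexification\<close>

definition vRe :: "complex ^ 'n \<Rightarrow> real ^ 'n" where
  "vRe v = (\<chi> i. Re (v $ i))"

definition vIm :: "complex ^ 'n \<Rightarrow> real ^ 'n" where
  "vIm v = (\<chi> i. Im (v $ i))"

definition vcnj :: "complex ^ 'n \<Rightarrow> complex ^ 'n" where
  "vcnj v = (\<chi> i. cnj (v $ i))"

definition WC :: "'n::finite wfilt \<Rightarrow> int \<Rightarrow> (complex ^ 'n) set" where
  "WC W k = {v. vRe v \<in> W k \<and> vIm v \<in> W k}"

definition QC :: "'n::finite gforms \<Rightarrow> int \<Rightarrow> complex ^ 'n \<Rightarrow> complex ^ 'n \<Rightarrow> complex" where
  "QC Q k u v = Complex (Q k (vRe u) (vRe v) - Q k (vIm u) (vIm v))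
                        (Q k (vRe u) (vIm v) + Q k (vIm u) (vRe v))"

abbreviation cscale :: "complex \<Rightarrow> 'n::finite cmat \<Rightarrow> 'n cmat" where
  "cscale c \<equiv> map_matrix ((*) c)"

section \<open>Weight filtration and graded forms\<close>

definition weight_filtration :: "'n::finite wfilt \<Rightarrow> bool" where
  "weight_filtration W \<longleftrightarrow>
     (\<forall>k. subspace (W k)) \<and> (\<forall>k l. k \<le> l \<longrightarrow> W k \<subseteq> W l) \<and>
     (\<exists>k. W k = {0}) \<and> (\<exists>k. W k = UNIV)"

text \<open>\<open>Q k\<close> is only relevant on \<open>W k\<close>. Vanishing as soon as one argument is in \<open>W (k - 1)\<close>
  means that it descends to the graded piece.\<close>

definition graded_forms :: "'n::finite wfilt \<Rightarrow> 'n gforms \<Rightarrow> bool" where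
  "graded_forms W Q \<longleftrightarrow> (\<forall>k.
     (\<forall>u\<in>W k. \<forall>v\<in>W k. \<forall>w\<in>W k. Q k (u + v) w = Q k u w + Q k v w \<and> Q k w (u + v) = Q k w u + Q k w v) \<and>
     (\<forall>u\<in>W k. \<forall>v\<in>W k. \<forall>c. Q k (c *\<^sub>R u) v = c * Q k u v \<and> Q k u (c *\<^sub>R v) = c * Q k u v) \<and>
     (\<forall>u\<in>W k. \<forall>v\<in>W (k - 1). Q k u v = 0 \<and> Q k v u = 0) \<and>
     (\<forall>u\<in>W k. \<forall>v\<in>W k. Q k u v = (-1) powi k * Q k v u) \<and>
     (\<forall>u\<in>W k. (\<forall>v\<in>W k. Q k u v = 0) \<longrightarrow> u \<in> W (k - 1)))"

section \<open>Graded-polarized mixed Hodge structures\<close>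

definition hodge_filtration :: "'n::finite hfilt \<Rightarrow> bool" where
  "hodge_filtration F \<longleftrightarrow>
     (\<forall>p. vec.subspace (F p)) \<and> (\<forall>p q. p \<le> q \<longrightarrow> F q \<subseteq> F p) \<and>
     (\<exists>p. F p = UNIV) \<and> (\<exists>p. F p = {0})"

text \<open>Preimages in \<open>W\<^sub>k\<close> of the induced filtration step \<open>F\<^sup>p gr\<^sub>k\<close> and of the Hodge summand
  \<open>H\<^sup>p\<^sup>,\<^sup>q = F\<^sup>p gr\<^sub>k \<inter> cnj (F\<^sup>q gr\<^sub>k)\<close> with \<open>k = p + q\<close>.\<close>

definition Fgr :: "'n::finite wfilt \<Rightarrow> 'n hfilt \<Rightarrow> int \<Rightarrow> int \<Rightarrow> (complex ^ 'n) set" where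
  "Fgr W F k p = {x + y | x y. x \<in> F p \<inter> WC W k \<and> y \<in> WC W (k - 1)}"

definition Hgr :: "'n::finite wfilt \<Rightarrow> 'n hfilt \<Rightarrow> int \<Rightarrow> int \<Rightarrow> (complex ^ 'n) set" where
  "Hgr W F p q = Fgr W F (p + q) p \<inter> vcnj ` Fgr W F (p + q) q"

text \<open>\<open>F\<close> induces on each \<open>gr\<^sub>k\<close> a Hodge structure of weight \<open>k\<close>:
  \<open>gr\<^sub>k = F\<^sup>p gr\<^sub>k \<oplus> cnj (F\<^sup>k\<^sup>-\<^sup>p\<^sup>+\<^sup>1 gr\<^sub>k)\<close> for all \<open>p\<close>.\<close>

definition mixed_hodge_structure :: "'n::finite wfilt \<Rightarrow> 'n hfilt \<Rightarrow> bool" where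
  "mixed_hodge_structure W F \<longleftrightarrow> hodge_filtration F \<and>
     (\<forall>k p. {x + y | x y. x \<in> Fgr W F k p \<and> y \<in> vcnj ` Fgr W F k (k - p + 1)} = WC W k \<and>
            Fgr W F k p \<inter> vcnj ` Fgr W F k (k - p + 1) = WC W (k - 1))"

definition graded_polarized :: "'n::finite wfilt \<Rightarrow> 'n gforms \<Rightarrow> 'n hfilt \<Rightarrow> bool" where
  "graded_polarized W Q F \<longleftrightarrow>
     (\<forall>k p. \<forall>u\<in>Fgr W F k p. \<forall>v\<in>Fgr W F k (k - p + 1). QC Q k u v = 0) \<and>
     (\<forall>p q. \<forall>u\<in>Hgr W F p q - WC W (p + q - 1).
        0 < Re (\<i> powi (p - q) * QC Q (p + q) u (vcnj u)))"

definition classifying_space ::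
  "'n::finite wfilt \<Rightarrow> 'n gforms \<Rightarrow> (int \<Rightarrow> int \<Rightarrow> nat) \<Rightarrow> 'n hfilt set" where
  "classifying_space W Q h = {F. mixed_hodge_structure W F \<and> graded_polarized W Q F \<and>
     (\<forall>p q. vec.dim (Hgr W F p q) = h p q + vec.dim (WC W (p + q - 1)))}"

section \<open>Deligne bigrading and mixed Hodge metric\<close>

definition decomposes ::
  "(int \<Rightarrow> int \<Rightarrow> (complex ^ 'n::finite) set) \<Rightarrow> complex ^ 'n \<Rightarrow> (int \<times> int \<Rightarrow> complex ^ 'n) \<Rightarrow> bool" where
  "decomposes I v x \<longleftrightarrow> (\<forall>p q. x (p, q) \<in> I p q) \<and> finite {a. x a \<noteq> 0} \<and>
     v = (\<Sum>a | x a \<noteq> 0. x a)"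

definition bigrading :: "(int \<Rightarrow> int \<Rightarrow> (complex ^ 'n::finite) set) \<Rightarrow> bool" where
  "bigrading I \<longleftrightarrow> (\<forall>p q. vec.subspace (I p q)) \<and> (\<forall>v. \<exists>!x. decomposes I v x)"

definition is_deligne_bigrading ::
  "'n::finite wfilt \<Rightarrow> 'n hfilt \<Rightarrow> (int \<Rightarrow> int \<Rightarrow> (complex ^ 'n) set) \<Rightarrow> bool" where
  "is_deligne_bigrading W F I \<longleftrightarrow> bigrading I \<and>
     (\<forall>p. F p = vec.span (\<Union>{I a b | a b. a \<ge> p})) \<and>
     (\<forall>k. WC W k = vec.span (\<Union>{I a b | a b. a + b \<le> k})) \<and>
     (\<forall>p q. vec.span (vcnj ` I p q \<union> \<Union>{I a b | a b. a < q \<and> b < p})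
          = vec.span (I q p \<union> \<Union>{I a b | a b. a < q \<and> b < p}))"

definition deligne ::
  "'n::finite wfilt \<Rightarrow> 'n hfilt \<Rightarrow> int \<Rightarrow> int \<Rightarrow> (complex ^ 'n) set" where
  "deligne W F = (THE I. is_deligne_bigrading W F I)"

definition deligne_comp ::
  "'n::finite wfilt \<Rightarrow> 'n hfilt \<Rightarrow> complex ^ 'n \<Rightarrow> int \<times> int \<Rightarrow> complex ^ 'n" where
  "deligne_comp W F v = (THE x. decomposes (deligne W F) v x)"

definition hodge_metric ::
  "'n::finite wfilt \<Rightarrow> 'n gforms \<Rightarrow> 'n hfilt \<Rightarrow> complex ^ 'n \<Rightarrow> complex ^ 'n \<Rightarrow> complex" where
  "hodge_metric W Q F u v =
     (\<Sum>(p, q) | deligne W F p q \<noteq> {0}.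
        \<i> powi (p - q) * QC Q (p + q) (deligne_comp W F u (p, q)) (vcnj (deligne_comp W F v (p, q))))"

definition hodge_adjoint ::
  "'n::finite wfilt \<Rightarrow> 'n gforms \<Rightarrow> 'n hfilt \<Rightarrow> 'n cmat \<Rightarrow> 'n cmat" where
  "hodge_adjoint W Q F B =
     (THE B'. \<forall>u v. hodge_metric W Q F (B *v u) v = hodge_metric W Q F u (B' *v v))"

definition hodge_metric_End ::
  "'n::finite wfilt \<Rightarrow> 'n gforms \<Rightarrow> 'n hfilt \<Rightarrow> 'n cmat \<Rightarrow> 'n cmat \<Rightarrow> complex" where
  "hodge_metric_End W Q F A B = trace (A ** hodge_adjoint W Q F B)"

section \<open>Groups and Lie algebras\<close>

primrec matpow :: "'n::finite cmat \<Rightarrow> nat \<Rightarrow> 'n cmat" where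
  "matpow A 0 = mat 1"
| "matpow A (Suc k) = A ** matpow A k"

definition mexp :: "'n::finite cmat \<Rightarrow> 'n cmat" where
  "mexp A = (\<Sum>k. (1 / fact k) *\<^sub>R matpow A k)"

definition act :: "'n::finite cmat \<Rightarrow> 'n hfilt \<Rightarrow> 'n hfilt" where
  "act g F = (\<lambda>p. (\<lambda>v. g *v v) ` F p)"

definition GC :: "'n::finite wfilt \<Rightarrow> 'n gforms \<Rightarrow> 'n cmat set" where
  "GC W Q = {g. invertible g \<and> (\<forall>k. (\<lambda>v. g *v v) ` WC W k = WC W k) \<and>
     (\<forall>k. \<forall>u\<in>WC W k. \<forall>v\<in>WC W k. QC Q k (g *v u) (g *v v) = QC Q k u v)}"

definition GR :: "'n::finite wfilt \<Rightarrow> 'n gforms \<Rightarrow> 'n cmat set" where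
  "GR W Q = GC W Q \<inter> range (map_matrix complex_of_real)"

definition lie_alg :: "'n::finite cmat set \<Rightarrow> 'n cmat set" where
  "lie_alg G = {X. \<forall>t::real. mexp (t *\<^sub>R X) \<in> G}"

definition gC :: "'n::finite wfilt \<Rightarrow> 'n gforms \<Rightarrow> 'n cmat set" where
  "gC W Q = lie_alg (GC W Q)"

definition g_rs :: "'n::finite wfilt \<Rightarrow> 'n gforms \<Rightarrow> 'n hfilt \<Rightarrow> int \<Rightarrow> int \<Rightarrow> 'n cmat set" where
  "g_rs W Q F r s =
     {X \<in> gC W Q. \<forall>p q. \<forall>v\<in>deligne W F p q. X *v v \<in> deligne W F (p + r) (q + s)}"

text \<open>The summands are complex subspaces, so their sum is also their real span.\<close>

definition qF :: "'n::finite wfilt \<Rightarrow> 'n gforms \<Rightarrow> 'n hfilt \<Rightarrow> 'n cmat set" where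
  "qF W Q F = span (\<Union>{g_rs W Q F r s | r s. r < 0})"

definition horizontal_space :: "'n::finite wfilt \<Rightarrow> 'n gforms \<Rightarrow> 'n hfilt \<Rightarrow> 'n cmat set" where
  "horizontal_space W Q F = span (\<Union>s. g_rs W Q F (-1) s)"

section \<open>Chern connection and its curvature\<close>

text \<open>\<open>H u\<close> is a hermitian metric, linear in the first argument, on the trivial holomorphic
  bundle with fibre \<open>E\<close> over an open part of the complex vector space \<open>E\<close>.
  In the holomorphic frame of constant sections the Chern connection is \<open>d + A\<close>,
  with \<open>A\<close> of type \<open>(1,0)\<close> and \<open>H (A(a) s) t = \<partial>\<^sub>a (H s t)\<close> for constant \<open>s, t\<close>.
  Its curvature is \<open>dA + A \<and> A\<close>, here evaluated on the real tangent vectors \<open>a, b\<close>.\<close>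

definition ddir :: "('n::finite cmat \<Rightarrow> 'b::real_normed_vector) \<Rightarrow> 'n cmat \<Rightarrow> 'n cmat \<Rightarrow> 'b" where
  "ddir f u a = vector_derivative (\<lambda>t::real. f (u + t *\<^sub>R a)) (at 0)"

definition del_dir :: "('n::finite cmat \<Rightarrow> complex) \<Rightarrow> 'n cmat \<Rightarrow> 'n cmat \<Rightarrow> complex" where
  "del_dir f u a = (ddir f u a - \<i> * ddir f u (cscale \<i> a)) / 2"

definition chern_form ::
  "'n::finite cmat set \<Rightarrow> ('n cmat \<Rightarrow> 'n cmat \<Rightarrow> 'n cmat \<Rightarrow> complex)
     \<Rightarrow> 'n cmat \<Rightarrow> 'n cmat \<Rightarrow> 'n cmat \<Rightarrow> 'n cmat" where
  "chern_form E H u a s =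
     (THE x. x \<in> E \<and> (\<forall>t\<in>E. H u x t = del_dir (\<lambda>u. H u s t) u a))"

definition chern_curvature ::
  "'n::finite cmat set \<Rightarrow> ('n cmat \<Rightarrow> 'n cmat \<Rightarrow> 'n cmat \<Rightarrow> complex)
     \<Rightarrow> 'n cmat \<Rightarrow> 'n cmat \<Rightarrow> 'n cmat \<Rightarrow> 'n cmat \<Rightarrow> 'n cmat" where
  "chern_curvature E H u a b s =
     (let A = chern_form E H in
        ddir (\<lambda>u. A u b s) u a - ddir (\<lambda>u. A u a s) u b + A u a (A u b s) - A u b (A u a s))"

section \<open>The complex manifold structure and the metric of the classifying space\<close>

text \<open>Holomorphic coordinates near \<open>F\<close> are given by \<open>u \<mapsto> e\<^sup>u F\<close> for small \<open>u \<in> qF W Q F\<close>.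
  A curve \<open>g(t) F\<close> with \<open>g(0) = 1\<close> has as velocity the component of \<open>g'(0)\<close> in \<open>qF W Q F\<close>
  modulo the Lie algebra of the stabilizer of \<open>F\<close>.\<close>

definition tangent_rep :: "'n::finite wfilt \<Rightarrow> 'n gforms \<Rightarrow> 'n hfilt \<Rightarrow> 'n cmat \<Rightarrow> 'n cmat" where
  "tangent_rep W Q F X = (THE w. w \<in> qF W Q F \<and>
     X - w \<in> lie_alg {g \<in> GC W Q. act g F = F})"

definition chart_push ::
  "'n::finite wfilt \<Rightarrow> 'n gforms \<Rightarrow> 'n hfilt \<Rightarrow> 'n cmat \<Rightarrow> 'n cmat \<Rightarrow> 'n cmat" where
  "chart_push W Q F u a =
     tangent_rep W Q (act (mexp u) F) (ddir mexp u a ** matrix_inv (mexp u))"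

definition chart_metric ::
  "'n::finite wfilt \<Rightarrow> 'n gforms \<Rightarrow> 'n hfilt \<Rightarrow> 'n cmat \<Rightarrow> 'n cmat \<Rightarrow> 'n cmat \<Rightarrow> complex" where
  "chart_metric W Q F u a b =
     hodge_metric_End W Q (act (mexp u) F) (chart_push W Q F u a) (chart_push W Q F u b)"

text \<open>The differential of the chart centred at \<open>F\<close> is the identity of \<open>qF W Q F\<close> at \<open>u = 0\<close>,
  so evaluating there gives the curvature tensor at \<open>F\<close> itself.\<close>

definition hodge_curvature ::
  "'n::finite wfilt \<Rightarrow> 'n gforms \<Rightarrow> 'n hfilt \<Rightarrow> 'n cmat \<Rightarrow> 'n cmat \<Rightarrow> 'n cmat \<Rightarrow> 'n cmat" where
  "hodge_curvature W Q F = chern_curvature (qF W Q F) (chart_metric W Q F) 0"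

section \<open>Complex manifolds\<close>

definition holo_on :: "(complex ^ 'm::finite) set \<Rightarrow> (complex ^ 'm \<Rightarrow> complex) \<Rightarrow> bool" where
  "holo_on A f \<longleftrightarrow> (\<forall>z\<in>A. \<exists>f'. (f has_derivative f') (at z) \<and> (\<forall>c v. f' (c *s v) = c * f' v))"

definition vholo_on :: "(complex ^ 'm::finite) set \<Rightarrow> (complex ^ 'm \<Rightarrow> complex ^ 'k::finite) \<Rightarrow> bool" where
  "vholo_on A f \<longleftrightarrow> (\<forall>i. holo_on A (\<lambda>z. f z $ i))"

definition mholo_on :: "(complex ^ 'm::finite) set \<Rightarrow> (complex ^ 'm \<Rightarrow> 'n::finite cmat) \<Rightarrow> bool" where
  "mholo_on A f \<longleftrightarrow> (\<forall>i j. holo_on A (\<lambda>z. f z $ i $ j))"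

type_synonym ('s, 'm) chart = "'s set \<times> ('s \<Rightarrow> complex ^ 'm)"

abbreviation chart_inv :: "('s, 'm::finite) chart \<Rightarrow> complex ^ 'm \<Rightarrow> 's" where
  "chart_inv c \<equiv> inv_into (fst c) (snd c)"

definition complex_manifold ::
  "('s::{t2_space, second_countable_topology}, 'm::finite) chart set \<Rightarrow> bool" where
  "complex_manifold \<A> \<longleftrightarrow> (\<Union>c\<in>\<A>. fst c) = UNIV \<and>
     (\<forall>c\<in>\<A>. open (fst c) \<and> open (snd c ` fst c) \<and>
        homeomorphism (fst c) (snd c ` fst c) (snd c) (chart_inv c)) \<and>
     (\<forall>c\<in>\<A>. \<forall>c'\<in>\<A>. vholo_on (snd c ` (fst c \<inter> fst c')) (snd c' \<circ> chart_inv c))"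

text \<open>A hermitian form on the holomorphic tangent spaces is given by its expression in each
  chart; \<open>g c s v w\<close> matters only for \<open>s \<in> fst c\<close>.\<close>

type_synonym ('s, 'm) chart_form =
  "('s, 'm) chart \<Rightarrow> 's \<Rightarrow> complex ^ 'm \<Rightarrow> complex ^ 'm \<Rightarrow> complex"

definition pseudo_metric ::
  "('s::{t2_space, second_countable_topology}, 'm::finite) chart set \<Rightarrow> ('s, 'm) chart_form \<Rightarrow> bool" where
  "pseudo_metric \<A> g \<longleftrightarrow>
     (\<forall>c\<in>\<A>. \<forall>s\<in>fst c. \<forall>u v w. \<forall>a.
        g c s (u + v) w = g c s u w + g c s v w \<and> g c s (a *s u) w = a * g c s u w \<and>
        g c s w u = cnj (g c s u w) \<and> 0 \<le> Re (g c s u u)) \<and>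
     (\<forall>c\<in>\<A>. \<forall>c'\<in>\<A>. \<forall>s\<in>fst c \<inter> fst c'. \<forall>v w.
        (let J = frechet_derivative (snd c' \<circ> chart_inv c) (at (snd c s))
         in g c' s (J v) (J w) = g c s v w))"

definition closed_2form_on ::
  "(complex ^ 'm::finite) set \<Rightarrow> (complex ^ 'm \<Rightarrow> complex ^ 'm \<Rightarrow> complex ^ 'm \<Rightarrow> real) \<Rightarrow> bool" where
  "closed_2form_on A \<omega> \<longleftrightarrow>
     (\<forall>z\<in>A. \<forall>v w. (\<lambda>z. \<omega> z v w) differentiable (at z)) \<and>
     (\<forall>z\<in>A. \<forall>u v w.
        frechet_derivative (\<lambda>z. \<omega> z v w) (at z) u - frechet_derivative (\<lambda>z. \<omega> z u w) (at z) v
          + frechet_derivative (\<lambda>z. \<omega> z u v) (at z) w = 0)"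

text \<open>The form \<open>(\<i> / 2) \<Sum> g\<^sub>j\<^sub>k dz\<^sub>j \<and> cnj dz\<^sub>k\<close> has the value \<open>- Im (g v w)\<close> on real tangent
  vectors \<open>v, w\<close>.\<close>

definition kaehler_pseudo_metric ::
  "('s::{t2_space, second_countable_topology}, 'm::finite) chart set \<Rightarrow> ('s, 'm) chart_form \<Rightarrow> bool" where
  "kaehler_pseudo_metric \<A> g \<longleftrightarrow> pseudo_metric \<A> g \<and>
     (\<forall>c\<in>\<A>. closed_2form_on (snd c ` fst c) (\<lambda>z v w. - Im (g c (chart_inv c z) v w)))"

section \<open>Holomorphic maps into the classifying space\<close>

text \<open>\<open>u\<close> expresses \<open>\<Phi>\<close> near \<open>z\<close> in the exponential chart centred at \<open>\<Phi> z\<close>.\<close>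

definition chart_rep ::
  "'n::finite wfilt \<Rightarrow> 'n gforms \<Rightarrow> (complex ^ 'm::finite \<Rightarrow> 'n hfilt) \<Rightarrow> complex ^ 'm
     \<Rightarrow> (complex ^ 'm) set \<Rightarrow> (complex ^ 'm \<Rightarrow> 'n cmat) \<Rightarrow> bool" where
  "chart_rep W Q \<Phi> z Z u \<longleftrightarrow> open Z \<and> z \<in> Z \<and> u z = 0 \<and> mholo_on Z u \<and>
     (\<forall>y\<in>Z. u y \<in> qF W Q (\<Phi> z) \<and> \<Phi> y = act (mexp (u y)) (\<Phi> z))"

definition holo_to_D ::
  "'n::finite wfilt \<Rightarrow> 'n gforms \<Rightarrow> (int \<Rightarrow> int \<Rightarrow> nat)
     \<Rightarrow> (complex ^ 'm::finite) set \<Rightarrow> (complex ^ 'm \<Rightarrow> 'n hfilt) \<Rightarrow> bool" where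
  "holo_to_D W Q h A \<Phi> \<longleftrightarrow> \<Phi> ` A \<subseteq> classifying_space W Q h \<and>
     (\<forall>z\<in>A. \<exists>Z u. Z \<subseteq> A \<and> chart_rep W Q \<Phi> z Z u)"

definition D_differential ::
  "'n::finite wfilt \<Rightarrow> 'n gforms \<Rightarrow> (complex ^ 'm::finite \<Rightarrow> 'n hfilt)
     \<Rightarrow> complex ^ 'm \<Rightarrow> complex ^ 'm \<Rightarrow> 'n cmat" where
  "D_differential W Q \<Phi> z = (THE L. \<exists>Z u. chart_rep W Q \<Phi> z Z u \<and> (u has_derivative L) (at z))"

definition horizontal_on ::
  "'n::finite wfilt \<Rightarrow> 'n gforms \<Rightarrow> (complex ^ 'm::finite) set \<Rightarrow> (complex ^ 'm \<Rightarrow> 'n hfilt) \<Rightarrow> bool" where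
  "horizontal_on W Q A \<Phi> \<longleftrightarrow> (\<forall>z\<in>A. \<forall>v. D_differential W Q \<Phi> z v \<in> horizontal_space W Q (\<Phi> z))"

section \<open>Variations of mixed Hodge structure and period maps\<close>

text \<open>A local system with fibres \<open>(V, W, Q)\<close> is given by its parallel transport, a functor from
  the fundamental groupoid; \<open>T p\<close> maps the fibre at \<open>pathstart p\<close> to the one at \<open>pathfinish p\<close>.\<close>

definition local_system ::
  "'n::finite wfilt \<Rightarrow> 'n gforms \<Rightarrow> ((real \<Rightarrow> 's::topological_space) \<Rightarrow> 'n cmat) \<Rightarrow> bool" where
  "local_system W Q T \<longleftrightarrow> (\<forall>p. path p \<longrightarrow> T p \<in> GR W Q) \<and>
     (\<forall>p q. homotopic_paths UNIV p q \<longrightarrow> T p = T q) \<and>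
     (\<forall>p q. path p \<and> path q \<and> pathfinish p = pathstart q \<longrightarrow> T (p +++ q) = T q ** T p)"

definition monodromy_group ::
  "((real \<Rightarrow> 's::topological_space) \<Rightarrow> 'n::finite cmat) \<Rightarrow> 's \<Rightarrow> 'n cmat set" where
  "monodromy_group T b = {T p | p. path p \<and> pathstart p = b \<and> pathfinish p = b}"

text \<open>The family \<open>\<F>\<close> of filtrations of the fibres over \<open>U\<close>, transported to the fibre at \<open>b\<close>
  along paths inside \<open>U\<close> followed by a fixed path \<open>c\<close>.\<close>

definition local_lift ::
  "((real \<Rightarrow> 's::topological_space) \<Rightarrow> 'n::finite cmat) \<Rightarrow> ('s \<Rightarrow> 'n hfilt) \<Rightarrow> 's
     \<Rightarrow> 's set \<Rightarrow> ('s \<Rightarrow> 'n hfilt) \<Rightarrow> bool" where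
  "local_lift T \<F> b U f \<longleftrightarrow> open U \<and> path_connected U \<and>
     (\<exists>c. path c \<and> pathstart c \<in> U \<and> pathfinish c = b \<and>
        (\<forall>s\<in>U. \<forall>p. path p \<and> path_image p \<subseteq> U \<and> pathstart p = s \<and> pathfinish p = pathstart c
           \<longrightarrow> f s = act (T (p +++ c)) (\<F> s)))"

definition holo_subbundles :: "(complex ^ 'm::finite) set \<Rightarrow> (complex ^ 'm \<Rightarrow> 'n::finite hfilt) \<Rightarrow> bool" where
  "holo_subbundles A \<Phi> \<longleftrightarrow> (\<forall>p. \<forall>z\<in>A. \<exists>Z (r::nat) e. open Z \<and> z \<in> Z \<and> Z \<subseteq> A \<and>
     (\<forall>i<r. vholo_on Z (e i)) \<and>
     (\<forall>y\<in>Z. inj_on (\<lambda>i. e i y) {..<r} \<and> vec.independent ((\<lambda>i. e i y) ` {..<r}) \<and>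
        vec.span ((\<lambda>i. e i y) ` {..<r}) = \<Phi> y p))"

definition griffiths_transversal ::
  "(complex ^ 'm::finite) set \<Rightarrow> (complex ^ 'm \<Rightarrow> 'n::finite hfilt) \<Rightarrow> bool" where
  "griffiths_transversal A \<Phi> \<longleftrightarrow> (\<forall>p Z \<sigma>. open Z \<and> Z \<subseteq> A \<and> vholo_on Z \<sigma> \<and> (\<forall>y\<in>Z. \<sigma> y \<in> \<Phi> y p)
     \<longrightarrow> (\<forall>y\<in>Z. \<forall>v. frechet_derivative \<sigma> (at y) v \<in> \<Phi> y (p - 1)))"

text \<open>The local lifts are the Hodge filtrations written in flat frames.\<close>

definition gp_vmhs ::
  "'n::finite wfilt \<Rightarrow> 'n gforms \<Rightarrow> (int \<Rightarrow> int \<Rightarrow> nat)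
     \<Rightarrow> ('s::{t2_space, second_countable_topology}, 'm::finite) chart set
     \<Rightarrow> ((real \<Rightarrow> 's) \<Rightarrow> 'n cmat) \<Rightarrow> ('s \<Rightarrow> 'n hfilt) \<Rightarrow> bool" where
  "gp_vmhs W Q h \<A> T \<F> \<longleftrightarrow> local_system W Q T \<and> range \<F> \<subseteq> classifying_space W Q h \<and>
     (\<forall>b U f. local_lift T \<F> b U f \<longrightarrow> (\<forall>c\<in>\<A>.
        holo_subbundles (snd c ` (U \<inter> fst c)) (f \<circ> chart_inv c) \<and>
        griffiths_transversal (snd c ` (U \<inter> fst c)) (f \<circ> chart_inv c)))"

definition orbit :: "'n::finite cmat set \<Rightarrow> 'n hfilt \<Rightarrow> 'n hfilt set" where
  "orbit \<Gamma> F = (\<lambda>g. act g F) ` \<Gamma>"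

text \<open>The period map with base point \<open>b\<close>. Points of the quotient are orbits.\<close>

definition period_map ::
  "'n::finite wfilt \<Rightarrow> 'n gforms \<Rightarrow> (int \<Rightarrow> int \<Rightarrow> nat)
     \<Rightarrow> ('s::{t2_space, second_countable_topology}, 'm::finite) chart set
     \<Rightarrow> ((real \<Rightarrow> 's) \<Rightarrow> 'n cmat) \<Rightarrow> ('s \<Rightarrow> 'n hfilt) \<Rightarrow> 's \<Rightarrow> 'n cmat set
     \<Rightarrow> ('s \<Rightarrow> 'n hfilt set) \<Rightarrow> bool" where
  "period_map W Q h \<A> T \<F> b \<Gamma> \<phi> \<longleftrightarrow>
     gp_vmhs W Q h \<A> T \<F> \<and> \<Gamma> = monodromy_group T b \<and>
     (\<forall>s p. path p \<and> pathstart p = s \<and> pathfinish p = b \<longrightarrow> \<phi> s = orbit \<Gamma> (act (T p) (\<F> s))) \<and>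
     (\<forall>s. \<exists>U f. s \<in> U \<and> local_lift T \<F> b U f) \<and>
     (\<forall>U f. local_lift T \<F> b U f \<longrightarrow> (\<forall>s\<in>U. \<phi> s = orbit \<Gamma> (f s)) \<and>
        (\<forall>c\<in>\<A>. holo_to_D W Q h (snd c ` (U \<inter> fst c)) (f \<circ> chart_inv c) \<and>
                horizontal_on W Q (snd c ` (U \<inter> fst c)) (f \<circ> chart_inv c)))"

text \<open>Since \<open>\<Gamma>\<close> need not act discretely, the pullback along the period map is taken along its
  flat local lifts, any two of which differ locally by a fixed element of \<open>\<Gamma>\<close>.\<close>

definition is_pullback_metric ::
  "'n::finite wfilt \<Rightarrow> 'n gforms
     \<Rightarrow> ('s::{t2_space, second_countable_topology}, 'm::finite) chart set
     \<Rightarrow> ((real \<Rightarrow> 's) \<Rightarrow> 'n cmat) \<Rightarrow> ('s \<Rightarrow> 'n hfilt) \<Rightarrow> 's \<Rightarrow> ('s, 'm) chart_form \<Rightarrow> bool" where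
  "is_pullback_metric W Q \<A> T \<F> b g \<longleftrightarrow>
     (\<forall>U f. local_lift T \<F> b U f \<longrightarrow> (\<forall>c\<in>\<A>. \<forall>s\<in>U \<inter> fst c. \<forall>v w.
        (let L = D_differential W Q (f \<circ> chart_inv c) (snd c s)
         in g c s v w = hodge_metric_End W Q (f s) (L v) (L w))))"

end

theory Submission
  imports Defs "HOL-Complex_Analysis.Complex_Analysis"
begin

text \<open>
  If \<open>h\<^sup>p\<^sup>,\<^sup>q\<close> vanishes for \<open>p \<noteq> q\<close>, then \<open>V\<close> is the sum of the \<open>I\<^sup>p\<^sup>,\<^sup>p = F\<^sup>p \<inter> W\<^sub>2\<^sub>p\<close>, and \<open>qF W Q F\<close> is
  the Lie algebra of all endomorphisms acting trivially on \<open>gr\<^sup>W\<close>, independently of \<open>F\<close>. Its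
  unipotent group acts freely on \<open>D\<close> and isometrically on the mixed Hodge metrics, since these only
  depend on graded pieces. Hence in the exponential chart the metric is \<open>h\<^sub>F(P a, P b)\<close>, where
  \<open>P = e\<^sup>-\<^sup>u d e\<^sup>u\<close> is a holomorphic frame change, and its curvature vanishes. Along a horizontal map
  \<open>g(z) F\<close> with \<open>g\<close> unipotent, the form \<open>g\<^sup>-\<^sup>1 dg\<close> has degree \<open>-1\<close> and therefore equals \<open>dk\<close>, where \<open>k\<close>
  is the degree \<open>-1\<close> part of \<open>g\<close>. The pulled back metric is thus \<open>\<Sum> \<bar>dk\<^sub>i\<^sub>j\<bar>\<^sup>2\<close> with holomorphic \<open>k\<^sub>i\<^sub>j\<close>,
  which is Kaehler.
\<close>

section \<open>Matrix polynomials and their derivatives\<close>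

text \<open>Most objects here are definite descriptions: the Deligne bigrading, the adjoint, the
  tangent representative, the Chern form, the differential of a map to \<open>D\<close>. Each needs
  uniqueness before it can be computed. A single orthonormal basis compatible with both filtrations
  turns them into matrix identities; group elements carry such a basis at \<open>F\<close> to one at
  the translate of \<open>F\<close>, so its variation with \<open>F\<close> never has to be
  controlled. The connection form is \<open>P^-1 dP\<close>, and its curvature cancels by symmetry
  of the second derivatives of \<open>P\<close>. The exponential is replaced by the polynomial
  \<open>texp N\<close>, whose derivative formulas hold at every matrix; equality with
  \<open>mexp\<close> is needed only on the unipotent radical. On the Kaehler side, \<open>g\<close>
  is 1 plus terms of negative degree and \<open>dg = g \<theta>\<close>; if \<open>\<theta>\<close>
  has degree -1, it is the degree -1 part of \<open>dg\<close>. Closedness then rests on symmetric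
  second derivatives, obtained from Cauchy's formula because \<open>holo_on\<close> only asks for a
  complex-linear derivative at each point.\<close>

interpretation mm: bounded_bilinear "(**) :: 'n::finite cmat \<Rightarrow> 'n cmat \<Rightarrow> 'n cmat"
proof -
  have "bilinear ((**) :: 'n cmat \<Rightarrow> 'n cmat \<Rightarrow> 'n cmat)"
    unfolding bilinear_def
    by (intro conjI allI linearI)
      (auto simp: matrix_matrix_mult_def vec_eq_iff algebra_simps sum.distrib scaleR_sum_right
        intro!: sum.cong)
  then show "bounded_bilinear ((**) :: 'n cmat \<Rightarrow> 'n cmat \<Rightarrow> 'n cmat)"
    by (simp add: bilinear_conv_bounded_bilinear)
qed

lemma matrix_inverse_unique: "matrix_inv A = B" if "A ** B = mat 1" "B ** A = mat 1"
  for A B :: "'n::finite cmat"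
proof -
  have "A ** matrix_inv A = mat 1 \<and> matrix_inv A ** A = mat 1"
    unfolding matrix_inv_def by (rule someI[of _ B]) (use that in auto)
  then show ?thesis by (metis that(2) matrix_mul_assoc matrix_mul_lid matrix_mul_rid)
qed

lemma cscale_mult: "cscale c (A ** B) = cscale c A ** B" "cscale c (A ** B) = A ** cscale c B"
  for A :: "'n::finite cmat"
  by (auto simp: matrix_matrix_mult_def vec_eq_iff sum_distrib_left mult_ac intro!: sum.cong)

lemma cscale_vec: "cscale c A *v x = c *s (A *v x)" for A :: "'n::finite cmat"
  by (auto simp: matrix_vector_mult_def vec_eq_iff sum_distrib_left mult_ac intro!: sum.cong)

lemma cscale_add: "cscale c (A + B) = cscale c A + cscale c B" for A :: "'n::finite cmat"
  by (auto simp: vec_eq_iff algebra_simps)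

lemma cscale_zero [simp]: "cscale c 0 = (0 :: 'n::finite cmat)"
  by (auto simp: vec_eq_iff)

lemma cscale_scaleR: "cscale c (r *\<^sub>R A) = r *\<^sub>R cscale c A" for A :: "'n::finite cmat"
  by (auto simp: vec_eq_iff)

lemma cscale_sum: "cscale c (sum f I) = (\<Sum>i\<in>I. cscale c (f i))"
  for f :: "'i \<Rightarrow> 'n::finite cmat"
  by (induction I rule: infinite_finite_induct) (auto simp: cscale_add)

lemma mv_scaleR: "(r *\<^sub>R A) *v x = r *\<^sub>R (A *v x)" for A :: "'n::finite cmat"
  by (auto simp: matrix_vector_mult_def vec_eq_iff scaleR_sum_right)

lemma matrix_ext_vec: "(\<And>x. A *v x = B *v x) \<Longrightarrow> A = B" for A B :: "'n::finite cmat"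
  by (simp add: matrix_eq)

text \<open>Derivatives of powers by the non-commutative Leibniz rule. Three orders occur: the
  metric in the exponential chart contains the first derivative of the exponential, its connection
  form the second, the curvature the third.\<close>

primrec Dpow :: "nat \<Rightarrow> 'n::finite cmat \<Rightarrow> 'n cmat \<Rightarrow> 'n cmat" where
  "Dpow 0 u a = 0"
| "Dpow (Suc k) u a = a ** matpow u k + u ** Dpow k u a"

primrec D2pow :: "nat \<Rightarrow> 'n::finite cmat \<Rightarrow> 'n cmat \<Rightarrow> 'n cmat \<Rightarrow> 'n cmat" where
  "D2pow 0 u a b = 0"
| "D2pow (Suc k) u a b = a ** Dpow k u b + b ** Dpow k u a + u ** D2pow k u a b"

primrec D3pow :: "nat \<Rightarrow> 'n::finite cmat \<Rightarrow> 'n cmat \<Rightarrow> 'n cmat \<Rightarrow> 'n cmat \<Rightarrow> 'n cmat" where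
  "D3pow 0 u a b c = 0"
| "D3pow (Suc k) u a b c =
     a ** D2pow k u b c + b ** D2pow k u a c + c ** D2pow k u a b + u ** D3pow k u a b c"

text \<open>Symmetry of mixed second derivatives; together with its third-order analogue it is the
  source of the cancellation in the curvature.\<close>

lemma D2pow_sym: "D2pow k u a b = D2pow k u b a"
  by (induction k) (auto simp: algebra_simps)

lemma D3pow_sym: "D3pow k u a b c = D3pow k u b a c"
  by (induction k) (auto simp: algebra_simps D2pow_sym)

lemma Dpow_linear:
  "Dpow k u (a + b) = Dpow k u a + Dpow k u b"
  "Dpow k u (r *\<^sub>R a) = r *\<^sub>R Dpow k u a"
  "Dpow k u (cscale c a) = cscale c (Dpow k u a)"
  by (induction k) (auto simp: mm.add_left mm.add_right mm.scaleR_left mm.scaleR_right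
      scaleR_add_right cscale_add cscale_mult(1)[of c a] cscale_mult(2)[of c u])

lemma D2pow_linear:
  "D2pow k u (cscale c a) b = cscale c (D2pow k u a b)"
  by (induction k) (auto simp: mm.add_left mm.add_right mm.scaleR_left mm.scaleR_right Dpow_linear
      scaleR_add_right cscale_add cscale_mult(1)[of c a] cscale_mult(2)[of c u] cscale_mult(2)[of c b])

lemma matpow_has_derivative:
  assumes "(f has_derivative f') (at x within S)"
  shows "((\<lambda>x. matpow (f x) k) has_derivative (\<lambda>h. Dpow k (f x) (f' h))) (at x within S)"
proof (induction k)
  case (Suc k)
  show ?case
    by (rule has_derivative_eq_rhs, simp, rule mm.FDERIV[OF assms Suc]) (auto simp: algebra_simps)
qed simp

lemma Dpow_has_derivative:
  assumes "(f has_derivative f') (at x within S)" "(g has_derivative g') (at x within S)"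
  shows "((\<lambda>x. Dpow k (f x) (g x)) has_derivative
    (\<lambda>h. D2pow k (f x) (f' h) (g x) + Dpow k (f x) (g' h))) (at x within S)"
proof (induction k)
  case (Suc k)
  show ?case
    by (rule has_derivative_eq_rhs, simp, rule has_derivative_add[OF mm.FDERIV[OF assms(2)
            matpow_has_derivative[OF assms(1)]] mm.FDERIV[OF assms(1) Suc]])
      (auto simp: mm.add_right algebra_simps)
qed simp

lemma D2pow_has_derivative:
  assumes "(f has_derivative f') (at x within S)"
  shows "((\<lambda>x. D2pow k (f x) a b) has_derivative (\<lambda>h. D3pow k (f x) (f' h) a b)) (at x within S)"
proof (induction k)
  case (Suc k)
  note D = has_derivative_eq_rhs[OF Dpow_has_derivative[OF assms has_derivative_const]]
  show ?case
    by (rule has_derivative_eq_rhs, simp, rule has_derivative_add[OF has_derivative_add[OF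
            mm.FDERIV[OF has_derivative_const Dpow_has_derivative[OF assms has_derivative_const]]
            mm.FDERIV[OF has_derivative_const Dpow_has_derivative[OF assms has_derivative_const]]]
            mm.FDERIV[OF assms Suc]])
      (auto simp: mm.add_right algebra_simps Dpow_linear(2)[of _ _ 0, simplified])
qed simp

text \<open>A polynomial in \<open>u\<close>, hence differentiable everywhere by finite sums. It
  stands for the exponential only where powers of order \<open>N\<close> vanish.\<close>

definition texp :: "nat \<Rightarrow> 'n::finite cmat \<Rightarrow> 'n cmat" where
  "texp N u = (\<Sum>k<N. (1 / fact k) *\<^sub>R matpow u k)"

definition Dtexp :: "nat \<Rightarrow> 'n::finite cmat \<Rightarrow> 'n cmat \<Rightarrow> 'n cmat" where
  "Dtexp N u a = (\<Sum>k<N. (1 / fact k) *\<^sub>R Dpow k u a)"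

definition D2texp :: "nat \<Rightarrow> 'n::finite cmat \<Rightarrow> 'n cmat \<Rightarrow> 'n cmat \<Rightarrow> 'n cmat" where
  "D2texp N u a b = (\<Sum>k<N. (1 / fact k) *\<^sub>R D2pow k u a b)"

definition D3texp :: "nat \<Rightarrow> 'n::finite cmat \<Rightarrow> 'n cmat \<Rightarrow> 'n cmat \<Rightarrow> 'n cmat \<Rightarrow> 'n cmat" where
  "D3texp N u a b c = (\<Sum>k<N. (1 / fact k) *\<^sub>R D3pow k u a b c)"

lemma D2texp_sym: "D2texp N u a b = D2texp N u b a"
  by (simp add: D2texp_def D2pow_sym)

lemma D3texp_sym: "D3texp N u a b c = D3texp N u b a c"
  by (simp add: D3texp_def D3pow_sym)

lemma Dtexp_linear:
  "Dtexp N u (a + b) = Dtexp N u a + Dtexp N u b"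
  "Dtexp N u (r *\<^sub>R a) = r *\<^sub>R Dtexp N u a"
  "Dtexp N u (cscale c a) = cscale c (Dtexp N u a)"
  by (auto simp: Dtexp_def Dpow_linear scaleR_add_right sum.distrib scaleR_sum_right cscale_sum
      cscale_scaleR mult_ac)

lemma Dtexp_zero [simp]: "Dtexp N u 0 = 0"
  using Dtexp_linear(2)[of N u 0 0] by simp

lemma Dtexp_minus: "Dtexp N u (- a) = - Dtexp N u a"
  using Dtexp_linear(2)[of N u "-1" a] by simp

lemma D2texp_linear: "D2texp N u (cscale c a) b = cscale c (D2texp N u a b)"
  by (auto simp: D2texp_def D2pow_linear scaleR_add_right cscale_sum cscale_scaleR)

lemma texp_has_derivative:
  assumes "(f has_derivative f') (at x within S)"
  shows "((\<lambda>x. texp N (f x)) has_derivative (\<lambda>h. Dtexp N (f x) (f' h))) (at x within S)"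
  unfolding texp_def Dtexp_def
  by (intro has_derivative_sum has_derivative_scaleR_right matpow_has_derivative assms)

lemma Dtexp_has_derivative:
  assumes "(f has_derivative f') (at x within S)" "(g has_derivative g') (at x within S)"
  shows "((\<lambda>x. Dtexp N (f x) (g x)) has_derivative
    (\<lambda>h. D2texp N (f x) (f' h) (g x) + Dtexp N (f x) (g' h))) (at x within S)"
  unfolding D2texp_def Dtexp_def sum.distrib[symmetric] scaleR_add_right[symmetric]
  by (intro has_derivative_sum has_derivative_scaleR_right Dpow_has_derivative assms)

lemma D2texp_has_derivative:
  assumes "(f has_derivative f') (at x within S)"
  shows "((\<lambda>x. D2texp N (f x) a b) has_derivative (\<lambda>h. D3texp N (f x) (f' h) a b)) (at x within S)"
  unfolding D2texp_def D3texp_def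
  by (intro has_derivative_sum has_derivative_scaleR_right D2pow_has_derivative assms)

section \<open>The unipotent radical\<close>

text \<open>\<open>Wlow W 1\<close> is the Lie algebra of endomorphisms acting trivially on the graded pieces,
  and its powers lie in the deeper steps.\<close>

definition Wlow :: "'n::finite wfilt \<Rightarrow> nat \<Rightarrow> 'n cmat set" where
  "Wlow W k = {X. \<forall>j. \<forall>v\<in>WC W j. X *v v \<in> WC W (j - int k)}"

text \<open>\<open>WlowN\<close> kills every product of \<open>N\<close> factors that lower the
  weight. \<open>N2\<close> keeps the constant and the linear term in the truncated exponential, so
  that its derivative at 0 is the identity.\<close>

locale weight_filt =
  fixes W :: "'n::finite wfilt" and N :: nat
  assumes wf: "weight_filtration W" and N2: "2 \<le> N" and WlowN: "Wlow W N = {0}"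
begin

lemma W_subspace: "subspace (W k)"
  using wf by (auto simp: weight_filtration_def)

lemma WC_subspace: "vec.subspace (WC W k)"
proof -
  note S = subspace_add[OF W_subspace] subspace_scale[OF W_subspace] subspace_diff[OF W_subspace]
  have 1: "vRe (x + y) = vRe x + vRe y" "vIm (x + y) = vIm x + vIm y" for x y :: "complex^'n"
    by (auto simp: vRe_def vIm_def vec_eq_iff)
  have 2: "vRe (c *s x) = Re c *\<^sub>R vRe x - Im c *\<^sub>R vIm x" "vIm (c *s x) = Re c *\<^sub>R vIm x + Im c *\<^sub>R vRe x"
    for c and x :: "complex^'n"
    by (auto simp: vRe_def vIm_def vec_eq_iff)
  have "vRe 0 = (0::real^'n)" "vIm 0 = (0::real^'n)"
    by (auto simp: vRe_def vIm_def vec_eq_iff)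
  then show ?thesis
    unfolding vec.subspace_def WC_def by (auto simp: 1 2 subspace_0[OF W_subspace] intro!: S)
qed

lemma WC_cnj: "v \<in> WC W k \<Longrightarrow> vcnj v \<in> WC W k"
proof -
  assume "v \<in> WC W k"
  moreover have "vRe (vcnj v) = vRe v" "vIm (vcnj v) = - vIm v"
    by (auto simp: vRe_def vIm_def vcnj_def vec_eq_iff)
  ultimately show ?thesis by (auto simp: WC_def subspace_neg[OF W_subspace])
qed

lemma WC_mono: "k \<le> l \<Longrightarrow> WC W k \<subseteq> WC W l"
  using wf unfolding weight_filtration_def WC_def by blast

lemma WC_exhaust: "\<exists>k. WC W k = {0}" "\<exists>k. WC W k = UNIV"
proof -
  have "{v :: complex^'n. vRe v = 0 \<and> vIm v = 0} = {0}"
    by (auto simp: vRe_def vIm_def vec_eq_iff complex_eq_iff)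
  moreover obtain k l where "W k = {0}" "W l = UNIV"
    using wf unfolding weight_filtration_def by blast
  ultimately have "WC W k = {0}" "WC W l = UNIV" by (auto simp: WC_def)
  then show "\<exists>k. WC W k = {0}" "\<exists>k. WC W k = UNIV" by blast+
qed

lemmas WC_closed = vec.subspace_0[OF WC_subspace] vec.subspace_add[OF WC_subspace]
  vec.subspace_diff[OF WC_subspace] vec.subspace_neg[OF WC_subspace]
  vec.subspace_scale[OF WC_subspace]

lemma WC_scaleR: "v \<in> WC W k \<Longrightarrow> r *\<^sub>R v \<in> WC W k"
proof -
  assume "v \<in> WC W k"
  moreover have "r *\<^sub>R v = complex_of_real r *s v"
    by (auto simp: vec_eq_iff scaleR_conv_of_real[symmetric])
  ultimately show ?thesis by (simp add: WC_closed)
qed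

lemma Wlow_0 [simp]: "0 \<in> Wlow W k"
  by (auto simp: Wlow_def WC_closed)

lemma Wlow_add: "X \<in> Wlow W k \<Longrightarrow> Y \<in> Wlow W k \<Longrightarrow> X + Y \<in> Wlow W k"
  by (auto simp: Wlow_def WC_closed matrix_vector_mult_add_rdistrib)

lemma Wlow_minus: "X \<in> Wlow W k \<Longrightarrow> - X \<in> Wlow W k"
proof -
  have "(- X) *v v = - (X *v v)" for v
    by (auto simp: matrix_vector_mult_def vec_eq_iff sum_negf)
  then show "X \<in> Wlow W k \<Longrightarrow> - X \<in> Wlow W k"
    by (auto simp: Wlow_def WC_closed)
qed

lemma Wlow_diff: "X \<in> Wlow W k \<Longrightarrow> Y \<in> Wlow W k \<Longrightarrow> X - Y \<in> Wlow W k"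
  by (auto simp: Wlow_def WC_closed matrix_vector_mult_diff_rdistrib)

lemma Wlow_scaleR: "X \<in> Wlow W k \<Longrightarrow> r *\<^sub>R X \<in> Wlow W k"
  by (auto simp: Wlow_def WC_scaleR mv_scaleR)

lemma Wlow_cscale: "X \<in> Wlow W k \<Longrightarrow> cscale c X \<in> Wlow W k"
  by (auto simp: Wlow_def WC_closed cscale_vec)

lemma Wlow_sum: "(\<And>i. i \<in> I \<Longrightarrow> f i \<in> Wlow W k) \<Longrightarrow> sum f I \<in> Wlow W k"
  by (induction I rule: infinite_finite_induct) (auto intro: Wlow_add)

lemma Wlow_mono: "k \<le> l \<Longrightarrow> Wlow W l \<subseteq> Wlow W k"
  unfolding Wlow_def using WC_mono[of "j - int l" "j - int k" for j] by fastforce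

lemma Wlow_mult:
  assumes X: "X \<in> Wlow W k" and Y: "Y \<in> Wlow W l"
  shows "X ** Y \<in> Wlow W (k + l)"
  unfolding Wlow_def
proof safe
  fix j v
  assume "v \<in> WC W j"
  then have "X *v (Y *v v) \<in> WC W (j - int l - int k)"
    using X Y by (auto simp: Wlow_def)
  moreover have "j - int l - int k = j - int (k + l)" by simp
  ultimately show "(X ** Y) *v v \<in> WC W (j - int (k + l))"
    by (simp add: matrix_vector_mul_assoc)
qed

lemma Wlow_one: "mat 1 \<in> Wlow W 0"
  by (auto simp: Wlow_def)

lemma Wlow_big: "N \<le> k \<Longrightarrow> X \<in> Wlow W k \<Longrightarrow> X = 0"
  using Wlow_mono[of N k] WlowN by auto

section \<open>Finite exponentials on the unipotent radical\<close>

lemma matpow_Wlow: "u \<in> Wlow W 1 \<Longrightarrow> matpow u k \<in> Wlow W k"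
  using Wlow_mult[of u 1] by (induction k) (auto simp: Wlow_one)

text \<open>Every monomial of this derivative contains \<open>a\<close> once and \<open>u\<close>
  exactly \<open>k\<close> times, and depths add up.\<close>

lemma Dpow_Wlow: "u \<in> Wlow W 1 \<Longrightarrow> a \<in> Wlow W j \<Longrightarrow> Dpow (Suc k) u a \<in> Wlow W (j + k)"
proof (induction k)
  case (Suc k)
  then have "Dpow (Suc k) u a \<in> Wlow W (j + k)" by blast
  then have "u ** Dpow (Suc k) u a \<in> Wlow W (1 + (j + k))"
    using Suc by (intro Wlow_mult)
  moreover have "a ** matpow u (Suc k) \<in> Wlow W (j + Suc k)"
    using Suc by (intro Wlow_mult matpow_Wlow)
  ultimately show ?case
    by (subst Dpow.simps(2)) (auto intro: Wlow_add)
qed (simp add: Wlow_one)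

lemma Wlow_mult1: "X \<in> Wlow W k \<Longrightarrow> Y \<in> Wlow W l \<Longrightarrow> m \<le> k + l \<Longrightarrow> X ** Y \<in> Wlow W m"
  using Wlow_mult Wlow_mono by blast

lemma D2pow_Wlow: "u \<in> Wlow W 1 \<Longrightarrow> a \<in> Wlow W 1 \<Longrightarrow> b \<in> Wlow W 1 \<Longrightarrow> D2pow k u a b \<in> Wlow W 1"
proof (induction k)
  case (Suc k)
  have D: "Dpow k u c \<in> Wlow W 1" if "c \<in> Wlow W 1" for c
  proof (cases k)
    case (Suc l)
    then show ?thesis using Dpow_Wlow[OF \<open>u \<in> Wlow W 1\<close> that, of l] Wlow_mono[of 1 "1 + l"] by auto
  qed simp
  have "X ** Y \<in> Wlow W 1" if "X \<in> Wlow W 1" "Y \<in> Wlow W 1" for X Y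
    using Wlow_mult1[OF that, of 1] by simp
  then show ?case
    unfolding D2pow.simps using Suc D by (intro Wlow_add) blast+
qed simp

lemma texp_Wlow: "u \<in> Wlow W 1 \<Longrightarrow> texp N u - mat 1 \<in> Wlow W 1"
proof -
  assume u: "u \<in> Wlow W 1"
  obtain M where M: "N = Suc M" using N2 by (cases N) auto
  have "texp N u - mat 1 = (\<Sum>k<M. (1 / fact (Suc k)) *\<^sub>R matpow u (Suc k))"
    unfolding texp_def M sum.lessThan_Suc_shift by simp
  also have "\<dots> \<in> Wlow W 1"
    using matpow_Wlow[OF u] Wlow_mono[of 1 "Suc k" for k]
    by (intro Wlow_sum Wlow_scaleR) (simp del: matpow.simps, blast)
  finally show ?thesis .
qed

text \<open>The term of order 1 is \<open>a\<close> itself and all later ones contain a factor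
  \<open>u\<close>. Thus the differential of the exponential is the identity up to deeper terms,
  which later makes it invertible by a finite series.\<close>

lemma Dtexp_diff_Wlow:
  assumes u: "u \<in> Wlow W 1" and a: "a \<in> Wlow W j"
  shows "Dtexp N u a - a \<in> Wlow W (Suc j)"
proof -
  obtain M where M: "N = Suc (Suc M)" using le_Suc_ex[OF N2] by auto
  have t: "Dpow (Suc (Suc k)) u a \<in> Wlow W (Suc j)" for k
    using Dpow_Wlow[OF u a, of "Suc k"] Wlow_mono[of "Suc j" "j + Suc k"]
    by (auto simp del: Dpow.simps)
  have "Dtexp N u a - a = (\<Sum>k<M. (1 / fact (Suc (Suc k))) *\<^sub>R Dpow (Suc (Suc k)) u a)"
    unfolding Dtexp_def M sum.lessThan_Suc_shift by simp
  also have "\<dots> \<in> Wlow W (Suc j)"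
    by (intro Wlow_sum Wlow_scaleR t)
  finally show ?thesis .
qed

lemma Dtexp_Wlow: "u \<in> Wlow W 1 \<Longrightarrow> a \<in> Wlow W j \<Longrightarrow> Dtexp N u a \<in> Wlow W j"
  using Dtexp_diff_Wlow[of u a j] Wlow_mono[of j "Suc j"] Wlow_add[of "Dtexp N u a - a" j a] by auto

lemma D2texp_Wlow:
  "u \<in> Wlow W 1 \<Longrightarrow> a \<in> Wlow W 1 \<Longrightarrow> b \<in> Wlow W 1 \<Longrightarrow> D2texp N u a b \<in> Wlow W 1"
  unfolding D2texp_def by (intro Wlow_sum Wlow_scaleR D2pow_Wlow)

lemma Dtexp_0: "Dtexp N 0 a = a"
proof -
  obtain M where M: "N = Suc (Suc M)" using le_Suc_ex[OF N2] by auto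
  have "Dpow (Suc (Suc k)) 0 a = 0" for k by simp
  then show ?thesis
    unfolding Dtexp_def M sum.lessThan_Suc_shift by simp
qed

lemma texp_0: "texp N 0 = (mat 1 :: 'n cmat)"
proof -
  obtain M where M: "N = Suc M" using N2 by (cases N) auto
  show ?thesis
    unfolding texp_def M sum.lessThan_Suc_shift by simp
qed

text \<open>Powers from order \<open>N\<close> on vanish, so the series equals its partial
  sum.\<close>

lemma mexp_eq_texp: "u \<in> Wlow W 1 \<Longrightarrow> mexp u = texp N u"
  unfolding mexp_def texp_def
  by (intro suminf_finite) (auto simp: not_less Wlow_big[OF _ matpow_Wlow])

lemma matpow_minus: "matpow (- u) k = (-1) ^ k *\<^sub>R matpow u k" for u :: "'n cmat"
  by (induction k) (auto simp: mm.minus_left mm.scaleR_right)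

lemma matpow_add: "matpow u i ** matpow u j = matpow u (i + j)" for u :: "'n cmat"
  by (induction i) (auto simp: matrix_mul_assoc[symmetric])

lemma texp_minus:
  assumes u: "u \<in> Wlow W 1"
  shows "texp N (- u) ** texp N u = mat 1"
proof -
  have z: "matpow u k = 0" if "k \<ge> N" for k
    using Wlow_big[OF that matpow_Wlow[OF u]] .
  let ?f = "\<lambda>i j. ((-1) ^ i / (fact i * fact j) :: real) *\<^sub>R matpow u (i + j)"
  have "texp N (- u) ** texp N u = (\<Sum>i<N. \<Sum>j<N. ?f i j)"
    unfolding texp_def mm.sum_left unfolding mm.sum_right
    by (rule sum.cong[OF refl], rule sum.cong[OF refl])
      (simp add: mm.scaleR_left mm.scaleR_right matpow_minus matpow_add)
  also have "\<dots> = (\<Sum>(i, j)\<in>{..<N} \<times> {..<N}. ?f i j)"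
    by (simp add: sum.cartesian_product)
  \<comment> \<open>Outside the triangle \<open>i + j \<ge> N\<close>, so the power of
    \<open>u\<close> is zero; on the triangle the sum can be regrouped by \<open>k = i + j\<close>,
    where alternating binomial sums appear.\<close>
  also have "\<dots> = (\<Sum>(i, j)\<in>{(i, j). i + j < N}. ?f i j)"
  proof (rule sum.mono_neutral_right)
    show "{(i, j). i + j < N} \<subseteq> {..<N} \<times> {..<N}" by auto
    show "\<forall>x\<in>{..<N} \<times> {..<N} - {(i, j). i + j < N}. (case x of (i, j) \<Rightarrow> ?f i j) = 0"
      by (auto intro!: z)
  qed simp
  also have "\<dots> = (\<Sum>k<N. \<Sum>i\<le>k. ?f i (k - i))"
    by (rule sum.triangle_reindex)
  also have "\<dots> = (\<Sum>k<N. (if k = 0 then mat 1 else 0))"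
  proof (rule sum.cong[OF refl])
    fix k
    have "(\<Sum>i\<le>k. ?f i (k - i)) = (\<Sum>i\<le>k. (-1) ^ i / (fact i * fact (k - i)) :: real) *\<^sub>R matpow u k"
      by (simp add: scaleR_sum_left)
    also have "(\<Sum>i\<le>k. (-1) ^ i / (fact i * fact (k - i)) :: real) = (\<Sum>i\<le>k. (-1) ^ i * of_nat (k choose i)) / fact k"
      unfolding sum_divide_distrib
      by (rule sum.cong[OF refl]) (simp add: binomial_fact)
    also have "\<dots> = (if k = 0 then 1 else 0)"
      using choose_alternating_sum[of k, where 'a=real] by (cases "k = 0") auto
    finally show "(\<Sum>i\<le>k. ?f i (k - i)) = (if k = 0 then mat 1 else 0)" by auto
  qed
  also have "\<dots> = mat 1"
    using N2 by (subst sum.delta) auto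
  finally show ?thesis .
qed

lemma texp_inverse:
  assumes u: "u \<in> Wlow W 1"
  shows "texp N u ** texp N (- u) = mat 1" "invertible (texp N u)" "matrix_inv (texp N u) = texp N (- u)"
proof -
  show 1: "texp N u ** texp N (- u) = mat 1" using texp_minus[OF Wlow_minus[OF u]] by simp
  show "invertible (texp N u)" "matrix_inv (texp N u) = texp N (- u)"
    using 1 texp_minus[OF u] by (auto simp: invertible_def intro: matrix_inverse_unique)
qed

end

section \<open>Adapted frames\<close>

text \<open>A basis (the columns of \<open>B\<close>) with vector number \<open>j\<close> in \<open>I\<^sup>p\<^sup>,\<^sup>p\<close>, \<open>p = l j\<close>, orthonormal for
  the mixed Hodge metric.\<close>

definition adapted_frame ::
  "'n::finite wfilt \<Rightarrow> 'n gforms \<Rightarrow> 'n hfilt \<Rightarrow> ('n \<Rightarrow> int) \<Rightarrow> 'n cmat \<Rightarrow> bool" where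
  "adapted_frame W Q F l B \<longleftrightarrow> invertible B \<and>
     (\<forall>k. WC W k = (*v) B ` {x. \<forall>j. k < 2 * l j \<longrightarrow> x $ j = 0}) \<and>
     (\<forall>p. F p = (*v) B ` {x. \<forall>j. l j < p \<longrightarrow> x $ j = 0}) \<and>
     (\<forall>p x y. (\<forall>j. p < l j \<longrightarrow> x $ j = 0) \<longrightarrow> (\<forall>j. p < l j \<longrightarrow> y $ j = 0) \<longrightarrow>
        QC Q (2 * p) (B *v x) (vcnj (B *v y)) = (\<Sum>j | l j = p. x $ j * cnj (y $ j)))"

definition frob :: "'n::finite cmat \<Rightarrow> 'n cmat \<Rightarrow> complex" where
  "frob A C = (\<Sum>i\<in>UNIV. \<Sum>j\<in>UNIV. A $ i $ j * cnj (C $ i $ j))"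

definition hip :: "complex ^ 'n::finite \<Rightarrow> complex ^ 'n \<Rightarrow> complex" where
  "hip x y = (\<Sum>j\<in>UNIV. x $ j * cnj (y $ j))"

definition ctr :: "'n::finite cmat \<Rightarrow> 'n cmat" where
  "ctr A = (\<chi> i j. cnj (A $ j $ i))"

lemma hip_adjoint: "hip (A *v x) y = hip x (ctr A *v y)"
proof -
  have "hip (A *v x) y = (\<Sum>i\<in>UNIV. \<Sum>j\<in>UNIV. A $ i $ j * x $ j * cnj (y $ i))"
    by (simp add: hip_def matrix_vector_mult_def sum_distrib_right)
  also have "\<dots> = (\<Sum>j\<in>UNIV. \<Sum>i\<in>UNIV. A $ i $ j * x $ j * cnj (y $ i))"
    by (rule sum.swap)
  also have "\<dots> = hip x (ctr A *v y)"
    by (simp add: hip_def matrix_vector_mult_def sum_distrib_left ctr_def mult_ac)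
  finally show ?thesis .
qed

lemma hip_cancel: "(\<And>x. hip x y = hip x z) \<Longrightarrow> y = z"
proof -
  assume h: "\<And>x. hip x y = hip x z"
  have "hip (axis i 1) w = cnj (w $ i)" for i w
    by (simp add: hip_def axis_def if_distrib[of "\<lambda>a. a * _"] cong: if_cong)
  then have "cnj (y $ i) = cnj (z $ i)" for i
    using h by metis
  then show "y = z" by (simp add: vec_eq_iff)
qed

lemma trace_ctr: "trace (A ** ctr C) = frob A C"
  by (simp add: trace_def matrix_matrix_mult_def ctr_def frob_def)

lemma vec_basis_expansion: "x = (\<Sum>j\<in>UNIV. x $ j *s axis j 1)" for x :: "complex ^ 'n::finite"
  by (simp add: vec_eq_iff axis_def if_distrib cong: if_cong)

locale framed = weight_filt W N
  for W :: "'n::finite wfilt" and N +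
  fixes Q :: "'n gforms" and F :: "'n hfilt" and l :: "'n \<Rightarrow> int" and B :: "'n cmat"
  assumes frame: "adapted_frame W Q F l B"
begin

abbreviation "C \<equiv> matrix_inv B"

lemma BC: "B ** C = mat 1" "C ** B = mat 1"
proof -
  have "invertible B" using frame by (simp add: adapted_frame_def)
  then obtain B' where "B ** B' = mat 1" "B' ** B = mat 1" by (auto simp: invertible_def)
  then show "B ** C = mat 1" "C ** B = mat 1" by (auto dest: matrix_inverse_unique)
qed

lemma BCv [simp]: "B *v (C *v v) = v" "C *v (B *v v) = v"
  by (simp_all add: matrix_vector_mul_assoc BC)

lemma image_B: "(*v) B ` {x. P x} = {v. P (C *v v)}"
  by (auto intro: image_eqI[of _ _ "C *v _"])

lemma WC_iff: "v \<in> WC W k \<longleftrightarrow> (\<forall>j. k < 2 * l j \<longrightarrow> (C *v v) $ j = 0)"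
  using frame unfolding adapted_frame_def image_B by auto

lemma F_iff: "v \<in> F p \<longleftrightarrow> (\<forall>j. l j < p \<longrightarrow> (C *v v) $ j = 0)"
  using frame unfolding adapted_frame_def image_B by auto

lemma QC_frame: "(\<And>j. p < l j \<Longrightarrow> x $ j = 0) \<Longrightarrow> (\<And>j. p < l j \<Longrightarrow> y $ j = 0) \<Longrightarrow>
    QC Q (2 * p) (B *v x) (vcnj (B *v y)) = (\<Sum>j | l j = p. x $ j * cnj (y $ j))"
  using frame unfolding adapted_frame_def by blast

section \<open>The Deligne bigrading in coordinates\<close>

lemma coord_subspace: "vec.subspace {v. \<forall>j. P j \<longrightarrow> (C *v v) $ j = 0}"
  unfolding vec.subspace_def by (auto simp: matrix_vector_right_distrib vector_scalar_commute)

text \<open>Both indices are kept to match the type of a bigrading; off the diagonal the condition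
  kills every coordinate, so these pieces are zero.\<close>

definition tateI :: "int \<Rightarrow> int \<Rightarrow> (complex ^ 'n) set" where
  "tateI p q = {v. \<forall>j. \<not> (l j = p \<and> l j = q) \<longrightarrow> (C *v v) $ j = 0}"

definition tate_comp :: "complex ^ 'n \<Rightarrow> int \<times> int \<Rightarrow> complex ^ 'n" where
  "tate_comp v a = B *v (\<chi> j. if (l j, l j) = a then (C *v v) $ j else 0)"

lemma tateI_subspace: "vec.subspace (tateI p q)"
  unfolding tateI_def by (rule coord_subspace)

lemma zero_iff: "v = 0 \<longleftrightarrow> (\<forall>j. (C *v v) $ j = 0)"
proof
  assume "\<forall>j. (C *v v) $ j = 0"
  then have "C *v v = 0" by (simp add: vec_eq_iff)
  then show "v = 0" using BCv(1)[of v] by simp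
qed simp

text \<open>Expansion in the basis vectors, each of which lies in one diagonal piece. The predicate
  \<open>R\<close> is left free to cover the Hodge filtration, the weight filtration and the error
  term in the conjugation rule at once.\<close>

lemma span_tateI:
  "vec.span (\<Union>{tateI a b | a b. R a b}) = {v. \<forall>j. \<not> R (l j) (l j) \<longrightarrow> (C *v v) $ j = 0}" (is "?L = ?R")
proof (rule equalityI)
  show "?L \<subseteq> ?R"
    by (rule vec.span_minimal[OF _ coord_subspace]) (auto simp: tateI_def, metis)
  show "?R \<subseteq> ?L"
  proof
    fix v assume v: "v \<in> ?R"
    have "v = B *v (\<Sum>j\<in>UNIV. (C *v v) $ j *s axis j 1)"
      by (subst vec_basis_expansion[symmetric]) simp
    also have "\<dots> = (\<Sum>j\<in>UNIV. (C *v v) $ j *s (B *v axis j 1))"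
      by (simp add: vec.linear_sum[OF matrix_vector_mul_linear_gen] vector_scalar_commute)
    also have "\<dots> \<in> ?L"
    proof (rule vec.span_sum)
      fix j
      show "(C *v v) $ j *s (B *v axis j 1) \<in> ?L"
      proof (cases "R (l j) (l j)")
        case True
        moreover have "B *v axis j 1 \<in> tateI (l j) (l j)"
          by (auto simp: tateI_def axis_def)
        ultimately show ?thesis
          by (intro vec.span_scale vec.span_base) blast
      next
        case False
        then show ?thesis using v by (auto simp: vec.span_zero)
      qed
    qed
    finally show "v \<in> ?L" .
  qed
qed

lemma decomposes_tate: "decomposes tateI v x \<longleftrightarrow> x = tate_comp v"
proof
  have nz: "{a. tate_comp v a \<noteq> 0} \<subseteq> (\<lambda>j. (l j, l j)) ` UNIV" for v
  proof
    fix a assume "a \<in> {a. tate_comp v a \<noteq> 0}"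
    then obtain j where "(C *v tate_comp v a) $ j \<noteq> 0" unfolding mem_Collect_eq zero_iff by blast
    then show "a \<in> (\<lambda>j. (l j, l j)) ` UNIV"
      by (auto simp: tate_comp_def split: if_splits)
  qed
  \<comment> \<open>Coordinate \<open>j\<close> sees only the summand with index
    \<open>(l j, l j)\<close>, since all other pieces vanish there.\<close>
  have sum_coord: "(C *v (\<Sum>a | x a \<noteq> 0. x a)) $ j = (C *v x (l j, l j)) $ j"
    if x: "\<forall>p q. x (p, q) \<in> tateI p q" "finite {a. x a \<noteq> 0}" for x j
  proof -
    have "(C *v (\<Sum>a | x a \<noteq> 0. x a)) $ j = (\<Sum>a | x a \<noteq> 0. (C *v x a) $ j)"
      by (simp add: vec.linear_sum[OF matrix_vector_mul_linear_gen])
    also have "\<dots> = (\<Sum>a | x a \<noteq> 0. if a = (l j, l j) then (C *v x (l j, l j)) $ j else 0)"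
    proof (rule sum.cong[OF refl])
      fix a :: "int \<times> int"
      obtain p q where a: "a = (p, q)" by (cases a)
      have "x (p, q) \<in> tateI p q" using x by blast
      then show "(C *v x a) $ j = (if a = (l j, l j) then (C *v x (l j, l j)) $ j else 0)"
        by (auto simp: a tateI_def)
    qed
    also have "\<dots> = (C *v x (l j, l j)) $ j"
      using x(2) by (subst sum.delta) auto
    finally show ?thesis .
  qed
  {
    assume d: "decomposes tateI v x"
    show "x = tate_comp v"
    proof
      fix a :: "int \<times> int"
      obtain p q where a: "a = (p, q)" by (cases a)
      have x: "\<forall>p q. x (p, q) \<in> tateI p q" "finite {a. x a \<noteq> 0}" "v = (\<Sum>a | x a \<noteq> 0. x a)"
        using d by (auto simp: decomposes_def)
      have "(C *v x a) $ j = (if (l j, l j) = a then (C *v v) $ j else 0)" for j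
        unfolding x(3) sum_coord[OF x(1,2)] using x(1) by (auto simp: a tateI_def)
      then have "C *v x a = (\<chi> j. if (l j, l j) = a then (C *v v) $ j else 0)"
        by (simp add: vec_eq_iff)
      then show "x a = tate_comp v a"
        unfolding tate_comp_def by (metis BCv(1))
    qed
  }
  {
    assume x: "x = tate_comp v"
    have t: "\<forall>p q. tate_comp v (p, q) \<in> tateI p q" "finite {a. tate_comp v a \<noteq> 0}"
      using finite_subset[OF nz] by (auto simp: tateI_def tate_comp_def)
    have "(C *v v) $ j = (C *v (\<Sum>a | tate_comp v a \<noteq> 0. tate_comp v a)) $ j" for j
      unfolding sum_coord[OF t] by (simp add: tate_comp_def)
    then have "C *v v = C *v (\<Sum>a | tate_comp v a \<noteq> 0. tate_comp v a)"
      unfolding vec_eq_iff by blast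
    then have "v = (\<Sum>a | tate_comp v a \<noteq> 0. tate_comp v a)"
      by (metis BCv(1))
    then show "decomposes tateI v x"
      using t by (auto simp: decomposes_def x)
  }
qed

lemma tate_bigrading: "bigrading tateI"
  unfolding bigrading_def by (auto simp: tateI_subspace decomposes_tate)

lemma tateI_off: "p \<noteq> q \<Longrightarrow> tateI p q = {0}"
  by (auto simp: tateI_def zero_iff)

lemma F_eq: "F p = vec.span (\<Union>{tateI a b | a b. a \<ge> p})"
  unfolding span_tateI by (auto simp: F_iff)

lemma WC_eq: "WC W k = vec.span (\<Union>{tateI a b | a b. a + b \<le> k})"
  unfolding span_tateI by (auto simp: WC_iff)

lemma vcnj_simps [simp]: "vcnj (vcnj v) = v" "vcnj 0 = 0" "vcnj (u + v) = vcnj u + vcnj v"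
  "vcnj (c *s v) = cnj c *s vcnj v"
  by (auto simp: vcnj_def vec_eq_iff)

text \<open>On the diagonal the error term spans \<open>WC W (2 * p - 1)\<close> and both sides
  become \<open>WC W (2 * p)\<close>, so the rule reduces to the weight filtration being real. Off
  the diagonal both pieces are zero.\<close>

lemma tate_cnj:
  "vec.span (vcnj ` tateI p q \<union> \<Union>{tateI a b | a b. a < q \<and> b < p})
          = vec.span (tateI q p \<union> \<Union>{tateI a b | a b. a < q \<and> b < p})"
proof (cases "p = q")
  case False
  then show ?thesis by (simp add: tateI_off)
next
  case True
  let ?L = "\<Union>{tateI a b | a b. a < p \<and> b < p}"
  have L: "vec.span ?L = WC W (2 * p - 1)"
    unfolding span_tateI by (auto simp: WC_iff)
  have Lsub: "?L \<subseteq> WC W (2 * p)"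
    using vec.span_superset[of ?L] WC_mono[of "2 * p - 1" "2 * p"] unfolding L by auto
  have I: "tateI p p \<subseteq> WC W (2 * p)" by (auto simp: tateI_def WC_iff)
  have split: "\<exists>y\<in>tateI p p. \<exists>z\<in>WC W (2 * p - 1). v = y + z" if "v \<in> WC W (2 * p)" for v
  proof -
    let ?y = "tate_comp v (p, p)"
    have "?y \<in> tateI p p" by (auto simp: tate_comp_def tateI_def)
    moreover have "v - ?y \<in> WC W (2 * p - 1)"
      using that by (auto simp: WC_iff tate_comp_def matrix_vector_mult_diff_distrib)
    ultimately show ?thesis by (intro bexI[of _ ?y] bexI[of _ "v - ?y"]) auto
  qed
  have 1: "vec.span (tateI p p \<union> ?L) = WC W (2 * p)"
  proof (rule equalityI)
    show "vec.span (tateI p p \<union> ?L) \<subseteq> WC W (2 * p)"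
      using I Lsub by (intro vec.span_minimal WC_subspace) auto
    show "WC W (2 * p) \<subseteq> vec.span (tateI p p \<union> ?L)"
    proof
      fix v assume "v \<in> WC W (2 * p)"
      then obtain y z where "y \<in> tateI p p" "z \<in> vec.span ?L" "v = y + z" using split L by blast
      moreover have "z \<in> vec.span (tateI p p \<union> ?L)" if "z \<in> vec.span ?L"
        using vec.span_mono[of ?L "tateI p p \<union> ?L"] that by blast
      ultimately show "v \<in> vec.span (tateI p p \<union> ?L)"
        by (simp add: vec.span_add vec.span_base)
    qed
  qed
  have 2: "vec.span (vcnj ` tateI p p \<union> ?L) = WC W (2 * p)"
  proof (rule equalityI)
    show "vec.span (vcnj ` tateI p p \<union> ?L) \<subseteq> WC W (2 * p)"
      using I Lsub by (intro vec.span_minimal WC_subspace) (auto intro!: WC_cnj)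
    show "WC W (2 * p) \<subseteq> vec.span (vcnj ` tateI p p \<union> ?L)"
    proof
      fix v assume "v \<in> WC W (2 * p)"
      then obtain y z where yz: "y \<in> tateI p p" "z \<in> WC W (2 * p - 1)" "vcnj v = y + z"
        using split WC_cnj by blast
      then have "v = vcnj y + vcnj z" by (metis vcnj_simps(1,3))
      moreover have "vcnj z \<in> vec.span ?L" using yz L WC_cnj by blast
      then have "vcnj z \<in> vec.span (vcnj ` tateI p p \<union> ?L)"
        using vec.span_mono[of ?L "vcnj ` tateI p p \<union> ?L"] by blast
      ultimately show "v \<in> vec.span (vcnj ` tateI p p \<union> ?L)"
        using yz(1) by (simp add: vec.span_add vec.span_base)
    qed
  qed
  show ?thesis using 1 2 True by simp
qed

lemma tate_is_deligne: "is_deligne_bigrading W F tateI"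
  unfolding is_deligne_bigrading_def
  using tate_bigrading F_eq WC_eq tate_cnj by blast

text \<open>Proved for an arbitrary bigrading, because it is applied to an unknown competitor of
  \<open>tateI\<close>: membership in a filtration step becomes vanishing of components.\<close>

lemma decomposes_span:
  fixes I :: "int \<Rightarrow> int \<Rightarrow> (complex ^ 'n) set"
  assumes I: "bigrading I" and v: "v \<in> vec.span (\<Union>{I a b | a b. R a b})"
  shows "\<exists>x. decomposes I v x \<and> (\<forall>a b. \<not> R a b \<longrightarrow> x (a, b) = 0)"
proof -
  have sub: "vec.subspace (I p q)" for p q using I by (auto simp: bigrading_def)
  define G where "G v x \<longleftrightarrow> decomposes I v x \<and> (\<forall>a b. \<not> R a b \<longrightarrow> x (a, b) = 0)" for v x
  have sum_sup: "(\<Sum>a | x a \<noteq> 0. x a) = (\<Sum>a\<in>S. x a)" if "finite S" "{a. x a \<noteq> 0} \<subseteq> S"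
    for x :: "int \<times> int \<Rightarrow> complex ^ 'n" and S
    using that by (intro sum.mono_neutral_left) auto
  have add: "G (v + v') (\<lambda>a. x a + x' a)" if "G v x" "G v' x'" for v v' :: "complex ^ 'n" and x x'
  proof -
    let ?S = "{a. x a \<noteq> 0} \<union> {a. x' a \<noteq> 0}"
    have fin: "finite ?S" using that by (auto simp: G_def decomposes_def)
    have "{a. x a + x' a \<noteq> 0} \<subseteq> ?S" by auto
    then have "finite {a. x a + x' a \<noteq> 0}" "(\<Sum>a | x a + x' a \<noteq> 0. x a + x' a) = (\<Sum>a\<in>?S. x a + x' a)"
      using fin sum_sup[OF fin, of "\<lambda>a. x a + x' a"] finite_subset by blast+
    moreover have "v = (\<Sum>a\<in>?S. x a)" "v' = (\<Sum>a\<in>?S. x' a)"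
      using that sum_sup[OF fin, of x] sum_sup[OF fin, of x'] by (auto simp: G_def decomposes_def)
    ultimately show ?thesis
      using that by (auto simp: G_def decomposes_def sum.distrib intro!: vec.subspace_add[OF sub])
  qed
  have scale: "G (c *s v) (\<lambda>a. c *s x a)" if "G v x" for c and v :: "complex ^ 'n" and x
  proof -
    let ?S = "{a. x a \<noteq> 0}"
    have fin: "finite ?S" using that by (auto simp: G_def decomposes_def)
    have "{a. c *s x a \<noteq> 0} \<subseteq> ?S" by auto
    then have "finite {a. c *s x a \<noteq> 0}" "(\<Sum>a | c *s x a \<noteq> 0. c *s x a) = (\<Sum>a\<in>?S. c *s x a)"
      using fin sum_sup[OF fin, of "\<lambda>a. c *s x a"] finite_subset by blast+
    then show ?thesis
      using that by (auto simp: G_def decomposes_def vec.scale_sum_right intro!: vec.subspace_scale[OF sub])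
  qed
  have "\<exists>x. G v x"
    using v
  proof (induction rule: vec.span_induct_alt)
    case base
    have "G 0 (\<lambda>_. 0)" by (auto simp: G_def decomposes_def vec.subspace_0[OF sub])
    then show ?case by blast
  next
    case (step c w y)
    then obtain a b where ab: "R a b" "w \<in> I a b" by blast
    define x where "x e = (if e = (a, b) then w else 0)" for e
    have ne: "{e. x e \<noteq> 0} \<subseteq> {(a, b)}" by (auto simp: x_def)
    have "(\<Sum>e | x e \<noteq> 0. x e) = w"
      unfolding sum_sup[OF finite.insertI[OF finite.emptyI] ne] by (simp add: x_def)
    moreover have "x (p, q) \<in> I p q" for p q
      using ab vec.subspace_0[OF sub] by (auto simp: x_def)
    moreover have "finite {e. x e \<noteq> 0}" using finite_subset[OF ne] by simp
    moreover have "\<not> R a b \<longrightarrow> x (a, b) = 0" for a b using ab by (auto simp: x_def)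
    ultimately have "G w x" by (simp add: G_def decomposes_def)
    then show ?case using scale add step by blast
  qed
  then show ?thesis by (simp add: G_def)
qed

text \<open>For \<open>q < p\<close>, \<open>I p q\<close> lies in \<open>F p\<close> and in weight
  \<open>p + q < 2 * p\<close>, hence is zero. For \<open>p < q\<close> the conjugation rule then
  puts \<open>I p q\<close> into \<open>WC W (p + q - 1)\<close>, where uniqueness of components
  leaves only 0. The diagonal pieces are thereby forced to be
  \<open>F p \<inter> WC W (2 * p)\<close>.\<close>

lemma deligne_unique:
  assumes I: "is_deligne_bigrading W F I"
  shows "I = tateI"
proof -
  have big: "bigrading I" and IF: "F p = vec.span (\<Union>{I a b | a b. a \<ge> p})"
    and IW: "WC W k = vec.span (\<Union>{I a b | a b. a + b \<le> k})"
    and Ic: "vec.span (vcnj ` I p q \<union> \<Union>{I a b | a b. a < q \<and> b < p})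
          = vec.span (I q p \<union> \<Union>{I a b | a b. a < q \<and> b < p})" for p q k
    using I unfolding is_deligne_bigrading_def by blast+
  have sub: "vec.subspace (I p q)" for p q using big by (auto simp: bigrading_def)
  have uniq: "x = y" if "decomposes I v x" "decomposes I v y" for v x y
    using big that unfolding bigrading_def by blast
  have sF: "I p q \<subseteq> F p" for p q
    unfolding IF by (auto intro!: vec.span_base)
  have sW: "I p q \<subseteq> WC W (p + q)" for p q
    unfolding IW by (auto intro!: vec.span_base)
  have gt: "I p q = {0}" if "q < p" for p q
  proof -
    have "v = 0" if "v \<in> I p q" for v
    proof -
      have "v \<in> F p" "v \<in> WC W (p + q)" using sF[of p q] sW[of p q] that by auto
      moreover have "l j < p \<or> p + q < 2 * l j" for j using \<open>q < p\<close> by linarith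
      ultimately show ?thesis unfolding zero_iff F_iff WC_iff by blast
    qed
    then show ?thesis using vec.subspace_0[OF sub] by blast
  qed
  have single: "decomposes I v (\<lambda>e. if e = (p, q) then v else 0)" if "v \<in> I p q" for v p q
  proof -
    have ne: "{e. (if e = (p, q) then v else 0) \<noteq> 0} = (if v = 0 then {} else {(p, q)})" by auto
    show ?thesis
      unfolding decomposes_def ne using that vec.subspace_0[OF sub] by auto
  qed
  have lt: "I p q = {0}" if "p < q" for p q
  proof -
    have "v = 0" if v: "v \<in> I p q" for v
    proof -
      let ?L = "\<Union>{I a b | a b. a < q \<and> b < p}"
      have "vcnj v \<in> vec.span (vcnj ` I p q \<union> ?L)" using v by (intro vec.span_base) blast
      also have "\<dots> = vec.span (I q p \<union> ?L)" by (rule Ic)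
      also have "\<dots> \<subseteq> WC W (p + q - 1)"
      proof (rule vec.span_minimal[OF _ WC_subspace])
        have "I a b \<subseteq> WC W (p + q - 1)" if "a < q" "b < p" for a b
          using sW[of a b] WC_mono[of "a + b" "p + q - 1"] that by auto
        then show "I q p \<union> ?L \<subseteq> WC W (p + q - 1)"
          using gt[OF \<open>p < q\<close>] by (auto simp: WC_closed)
      qed
      finally have "v \<in> WC W (p + q - 1)" using WC_cnj[of "vcnj v"] by simp
      then obtain x where x: "decomposes I v x" "\<forall>a b. \<not> a + b \<le> p + q - 1 \<longrightarrow> x (a, b) = 0"
        using decomposes_span[OF big, of v "\<lambda>a b. a + b \<le> p + q - 1"] unfolding IW by blast
      have "x (p, q) = v" using uniq[OF x(1) single[OF v]] by simp
      then show "v = 0" using x(2) by simp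
    qed
    then show ?thesis using vec.subspace_0[OF sub] by blast
  qed
  have "I p p = tateI p p" for p
  proof (rule equalityI; rule subsetI)
    fix v assume "v \<in> I p p"
    then have "v \<in> F p" "v \<in> WC W (2 * p)" using sF[of p p] sW[of p p] by auto
    moreover have "l j = p \<or> l j < p \<or> 2 * p < 2 * l j" for j by linarith
    ultimately show "v \<in> tateI p p" unfolding tateI_def F_iff WC_iff by blast
  next
    fix v assume v: "v \<in> tateI p p"
    have "v \<in> F p" "v \<in> WC W (2 * p)" using v unfolding tateI_def F_iff WC_iff by auto
    then obtain x y where x: "decomposes I v x" "\<forall>a b. \<not> a \<ge> p \<longrightarrow> x (a, b) = 0"
      and y: "decomposes I v y" "\<forall>a b. \<not> a + b \<le> 2 * p \<longrightarrow> y (a, b) = 0"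
      using decomposes_span[OF big, of v "\<lambda>a b. a \<ge> p"] decomposes_span[OF big, of v "\<lambda>a b. a + b \<le> 2 * p"]
      unfolding IF IW by blast
    have xy: "x = y" using uniq x y by blast
    have "x (a, b) = 0" if "(a, b) \<noteq> (p, p)" for a b
    proof (cases "a = b")
      case True
      then show ?thesis using that x(2) y(2) xy by (cases "a \<ge> p") auto
    next
      case False
      then have "I a b = {0}" using gt lt by (meson linorder_neqE)
      then show ?thesis using x(1) unfolding decomposes_def by blast
    qed
    then have ne: "{a. x a \<noteq> 0} \<subseteq> {(p, p)}" by auto
    have "v = (\<Sum>a | x a \<noteq> 0. x a)" using x(1) by (simp add: decomposes_def)
    also have "\<dots> = (\<Sum>a\<in>{(p, p)}. x a)" using ne by (intro sum.mono_neutral_left) auto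
    finally have "v = x (p, p)" by simp
    then show "v \<in> I p p" using x(1) unfolding decomposes_def by blast
  qed
  then show ?thesis
    using gt lt tateI_off by (intro ext) (metis linorder_neqE)
qed

lemma deligne_eq: "deligne W F = tateI"
  unfolding deligne_def using tate_is_deligne deligne_unique by (rule the_equality)

section \<open>The mixed Hodge metrics in coordinates\<close>

lemma deligne_comp_eq: "deligne_comp W F v = tate_comp v"
  by (simp add: deligne_comp_def deligne_eq decomposes_tate)

text \<open>Only diagonal pieces contribute, where the factor \<open>\<i> powi (p - p)\<close> is 1
  and the frame is orthonormal; grouping the coordinates by the value of \<open>l\<close> gives the
  standard hermitian product.\<close>

lemma hodge_metric_eq: "hodge_metric W Q F u v = hip (C *v u) (C *v v)"
proof -
  let ?g = "\<lambda>j. (C *v u) $ j * cnj ((C *v v) $ j)"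
  have "tateI p q \<noteq> {0} \<longleftrightarrow> p = q \<and> p \<in> range l" for p q
  proof
    assume "tateI p q \<noteq> {0}"
    then obtain v where "v \<in> tateI p q" "v \<noteq> 0" using vec.subspace_0[OF tateI_subspace] by blast
    then obtain j where "l j = p" "l j = q" unfolding tateI_def zero_iff by blast
    then show "p = q \<and> p \<in> range l" by auto
  next
    assume "p = q \<and> p \<in> range l"
    then obtain j where "p = l j" "q = l j" by auto
    then have "B *v axis j 1 \<in> tateI p q" by (auto simp: tateI_def axis_def)
    moreover have "B *v axis j 1 \<noteq> 0" by (auto simp: zero_iff axis_def)
    ultimately show "tateI p q \<noteq> {0}" by blast
  qed
  then have ne: "{(p, q). tateI p q \<noteq> {0}} = (\<lambda>p. (p, p)) ` range l" by auto
  have "hodge_metric W Q F u v = (\<Sum>p\<in>range l. \<i> powi (p - p) *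
      QC Q (p + p) (tate_comp u (p, p)) (vcnj (tate_comp v (p, p))))"
    unfolding hodge_metric_def deligne_eq deligne_comp_eq ne
    by (subst sum.reindex) (simp_all add: inj_on_def o_def)
  also have "\<dots> = (\<Sum>p\<in>range l. \<Sum>j | l j = p. ?g j)"
  proof (rule sum.cong[OF refl])
    fix p
    have "QC Q (2 * p) (tate_comp u (p, p)) (vcnj (tate_comp v (p, p))) = (\<Sum>j | l j = p. ?g j)"
      unfolding tate_comp_def by (subst QC_frame) auto
    then show "\<i> powi (p - p) * QC Q (p + p) (tate_comp u (p, p)) (vcnj (tate_comp v (p, p)))
        = (\<Sum>j | l j = p. ?g j)" by (simp flip: mult_2)
  qed
  also have "\<dots> = (\<Sum>j\<in>UNIV. ?g j)"
    using sum.group[of UNIV "range l" l ?g] by simp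
  finally show ?thesis by (simp add: hip_def)
qed

text \<open>Passing to frame coordinates makes the adjoint the conjugate transpose and the metric on
  endomorphisms the Frobenius product.\<close>

definition hat :: "'n cmat \<Rightarrow> 'n cmat" where
  "hat X = C ** X ** B"

lemma hat_mv: "C *v (X *v v) = hat X *v (C *v v)"
  by (simp add: hat_def matrix_vector_mul_assoc[symmetric])

lemma hodge_adjoint_eq: "hodge_adjoint W Q F X = B ** ctr (hat X) ** C"
  unfolding hodge_adjoint_def hodge_metric_eq
proof (rule the_equality)
  have "C *v ((B ** ctr (hat X) ** C) *v v) = ctr (hat X) *v (C *v v)" for v
    by (simp add: matrix_vector_mul_assoc[symmetric])
  then show A: "\<forall>u v. hip (C *v (X *v u)) (C *v v) = hip (C *v u) (C *v ((B ** ctr (hat X) ** C) *v v))"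
    by (simp only: hat_mv[of X] hip_adjoint[of "hat X"]) simp
  fix X' assume X': "\<forall>u v. hip (C *v (X *v u)) (C *v v) = hip (C *v u) (C *v (X' *v v))"
  show "X' = B ** ctr (hat X) ** C"
  proof (rule matrix_ext_vec)
    fix v
    have "hip (C *v (B *v x)) (C *v (X' *v v)) = hip (C *v (B *v x)) (C *v ((B ** ctr (hat X) ** C) *v v))" for x
      using A X' by metis
    then have "C *v (X' *v v) = C *v ((B ** ctr (hat X) ** C) *v v)"
      by (intro hip_cancel) simp
    then show "X' *v v = (B ** ctr (hat X) ** C) *v v" by (metis BCv(1))
  qed
qed

lemma hodge_metric_End_eq: "hodge_metric_End W Q F X Y = frob (hat X) (hat Y)"
proof -
  have "hodge_metric_End W Q F X Y = trace ((X ** (B ** ctr (hat Y))) ** C)"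
    by (simp add: hodge_metric_End_def hodge_adjoint_eq matrix_mul_assoc)
  also have "\<dots> = trace (C ** (X ** (B ** ctr (hat Y))))"
    by (rule trace_mul_sym)
  also have "\<dots> = trace (hat X ** ctr (hat Y))"
    by (simp add: hat_def matrix_mul_assoc)
  finally show ?thesis by (simp add: trace_ctr)
qed

end

section \<open>Existence of adapted frames\<close>

text \<open>All hypotheses are restricted to \<open>S\<close>, since the form in question behaves
  well only on a weight step and is positive only on a Tate piece. The induction adds one vector of
  a basis at a time and keeps the span.\<close>

lemma gram_schmidt:
  fixes \<beta> :: "complex ^ 'n::finite \<Rightarrow> complex ^ 'n \<Rightarrow> complex"
  assumes S: "vec.subspace S"
    and add: "\<And>u v w. u \<in> S \<Longrightarrow> v \<in> S \<Longrightarrow> w \<in> S \<Longrightarrow> \<beta> (u + v) w = \<beta> u w + \<beta> v w"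
    and scale: "\<And>c u v. u \<in> S \<Longrightarrow> v \<in> S \<Longrightarrow> \<beta> (c *s u) v = c * \<beta> u v"
    and herm: "\<And>u v. u \<in> S \<Longrightarrow> v \<in> S \<Longrightarrow> \<beta> u v = cnj (\<beta> v u)"
    and pos: "\<And>u. u \<in> S \<Longrightarrow> u \<noteq> 0 \<Longrightarrow> 0 < Re (\<beta> u u)"
  shows "\<exists>E. finite E \<and> E \<subseteq> S \<and> vec.independent E \<and> vec.span E = S \<and>
    (\<forall>e\<in>E. \<forall>e'\<in>E. \<beta> e e' = (if e = e' then 1 else 0))"
proof -
  note closed = vec.subspace_0[OF S] vec.subspace_add[OF S] vec.subspace_diff[OF S] vec.subspace_neg[OF S]
    vec.subspace_scale[OF S] vec.subspace_sum[OF S]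
  have sum: "\<beta> (\<Sum>i\<in>I. f i) w = (\<Sum>i\<in>I. \<beta> (f i) w)"
    if "finite I" "\<And>i. i \<in> I \<Longrightarrow> f i \<in> S" "w \<in> S"
    for I :: "(complex ^ 'n) set" and f w
    using that
  proof (induction I rule: finite_induct)
    case empty
    then show ?case using scale[of 0 w 0] closed by simp
  next
    case (insert i I)
    then show ?case by (simp add: add closed)
  qed
  have diff: "\<beta> (u - v) w = \<beta> u w - \<beta> v w" if "u \<in> S" "v \<in> S" "w \<in> S" for u v w
    using add[of u "(-1) *s v" w] scale[of v w "-1"] that closed by simp
  have "\<exists>E. finite E \<and> E \<subseteq> S \<and> vec.independent E \<and> vec.span E = vec.span A \<and>
    (\<forall>e\<in>E. \<forall>e'\<in>E. \<beta> e e' = (if e = e' then 1 else 0))"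
    if "finite A" "A \<subseteq> S" "vec.independent A" for A
    using that
  proof (induction A rule: finite_induct)
    case empty
    show ?case by (intro exI[of _ "{}"]) (simp add: vec.independent_empty)
  next
    case (insert a A)
    have "vec.independent A" using vec.independent_mono[OF insert.prems(2)] by blast
    then obtain E where E: "finite E" "E \<subseteq> S" "vec.independent E" "vec.span E = vec.span A"
      and on: "\<And>e e'. e \<in> E \<Longrightarrow> e' \<in> E \<Longrightarrow> \<beta> e e' = (if e = e' then 1 else 0)"
      using insert.IH insert.prems(1) by (metis insert_subset)
    have aS: "a \<in> S" using insert by auto
    have a_span: "a \<notin> vec.span E" using insert E(4) by (simp add: vec.independent_insert)
    define s where "s = (\<Sum>e\<in>E. \<beta> a e *s e)"
    define c where "c = a - s"
    have sE: "s \<in> vec.span E" unfolding s_def by (intro vec.span_sum vec.span_scale vec.span_base)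
    have sS: "s \<in> S" using E(2) unfolding s_def by (intro closed) auto
    have cS: "c \<in> S" using aS sS by (simp add: c_def closed)
    have c0: "c \<noteq> 0" using a_span sE by (auto simp: c_def)
    have ce: "\<beta> c e = 0" if "e \<in> E" for e
    proof -
      have eS: "e \<in> S" using that E(2) by auto
      have "\<beta> s e = (\<Sum>e'\<in>E. \<beta> (\<beta> a e' *s e') e)"
        unfolding s_def using E(1,2) eS by (intro sum) (auto intro: closed)
      also have "\<dots> = (\<Sum>e'\<in>E. if e' = e then \<beta> a e else 0)"
        using E(2) eS that by (intro sum.cong) (auto simp: scale on)
      also have "\<dots> = \<beta> a e" using E(1) that by simp
      finally show ?thesis using diff[OF aS sS eS] by (simp add: c_def)
    qed
    define n where "n = Re (\<beta> c c)"
    have n: "n > 0" using pos[OF cS c0] by (simp add: n_def)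
    have "Im (\<beta> c c) = 0" using herm[OF cS cS] by (metis cnj.simps(2) equal_neg_zero)
    then have cc: "\<beta> c c = of_real n" by (simp add: n_def complex_eq_iff)
    define r where "r = complex_of_real (1 / sqrt n)"
    define b where "b = r *s c"
    have r: "r \<noteq> 0" "cnj r = r" using n by (auto simp: r_def)
    have bS: "b \<in> S" using cS by (simp add: b_def closed)
    have "\<beta> c b = cnj (r * \<beta> c c)" using herm[OF cS bS] scale[OF cS cS] by (simp add: b_def)
    then have "\<beta> b b = r * (r * of_real n)"
      using scale[OF cS bS] by (simp add: b_def cc r)
    also have "\<dots> = of_real ((1 / sqrt n) * ((1 / sqrt n) * n))"
      unfolding r_def of_real_mult ..
    also have "(1 / sqrt n) * ((1 / sqrt n) * n) = 1"
      using n by (simp add: real_div_sqrt)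
    finally have bb: "\<beta> b b = 1" by simp
    have be: "\<beta> b e = 0" "\<beta> e b = 0" if "e \<in> E" for e
    proof -
      have eS: "e \<in> S" using that E(2) by auto
      show "\<beta> b e = 0" using scale[OF cS eS] ce[OF that] by (simp add: b_def)
      then show "\<beta> e b = 0" using herm[OF eS bS] by simp
    qed
    have bE: "b \<notin> E" using be bb by force
    have c_eq: "c = (1 / r) *s b" using r by (simp add: b_def)
    have "b \<notin> vec.span E"
    proof
      assume "b \<in> vec.span E"
      then have "c \<in> vec.span E" unfolding c_eq by (rule vec.span_scale)
      then have "c + s \<in> vec.span E" using sE by (rule vec.span_add)
      then show False using a_span by (simp add: c_def)
    qed
    then have ind: "vec.independent (insert b E)" using E(3) bE by (simp add: vec.independent_insert)
    have "vec.span (insert b E) = vec.span (insert a A)"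
    proof (rule equalityI; rule vec.span_minimal[OF _ vec.subspace_span])
      have sub: "vec.span A \<subseteq> vec.span (insert a A)" by (rule vec.span_mono) auto
      have "a - s \<in> vec.span (insert a A)"
        using sE sub unfolding E(4) by (intro vec.span_diff[OF vec.span_base]) auto
      then have "b \<in> vec.span (insert a A)" unfolding b_def c_def by (rule vec.span_scale)
      then show "insert b E \<subseteq> vec.span (insert a A)"
        using vec.span_superset[of E] sub E(4) by auto
      have sub': "vec.span E \<subseteq> vec.span (insert b E)" by (rule vec.span_mono) auto
      have "c + s \<in> vec.span (insert b E)" unfolding c_eq
        using sE sub' by (intro vec.span_add[OF vec.span_scale[OF vec.span_base]]) auto
      then have "a \<in> vec.span (insert b E)" by (simp add: c_def)
      then show "insert a A \<subseteq> vec.span (insert b E)"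
        using vec.span_superset[of A] sub' E(4) by auto
    qed
    moreover have "insert b E \<subseteq> S" using bS E(2) by simp
    moreover have "\<forall>e\<in>insert b E. \<forall>e'\<in>insert b E. \<beta> e e' = (if e = e' then 1 else 0)"
      using on be bb bE by auto
    ultimately show ?case using ind E(1) by (intro exI[of _ "insert b E"]) simp
  qed
  moreover obtain A where A: "A \<subseteq> S" "vec.independent A" "S \<subseteq> vec.span A"
    using vec.basis_exists[of S] by metis
  moreover have "vec.span A = S" using A S vec.span_minimal by blast
  ultimately show ?thesis using vec.finiteI_independent[OF A(2)] by metis
qed

lemma vRe_simps [simp]: "vRe (u + v) = vRe u + vRe v" "vRe (u - v) = vRe u - vRe v"
  "vRe (c *s v) = Re c *\<^sub>R vRe v - Im c *\<^sub>R vIm v" "vRe (vcnj v) = vRe v"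
  by (auto simp: vRe_def vIm_def vcnj_def vec_eq_iff)

lemma vIm_simps [simp]: "vIm (u + v) = vIm u + vIm v" "vIm (u - v) = vIm u - vIm v"
  "vIm (c *s v) = Re c *\<^sub>R vIm v + Im c *\<^sub>R vRe v" "vIm (vcnj v) = - vIm v"
  by (auto simp: vRe_def vIm_def vcnj_def vec_eq_iff)

lemma vcnj_vcnj: "vcnj (vcnj v) = v"
  by (simp add: vcnj_def vec_eq_iff)

locale polarized = weight_filt W N for W :: "'n::finite wfilt" and N +
  fixes Q :: "'n gforms"
  assumes gf: "graded_forms W Q"
begin

lemma Q_left: "u \<in> W k \<Longrightarrow> v \<in> W k \<Longrightarrow> w \<in> W k \<Longrightarrow> Q k (u + v) w = Q k u w + Q k v w"
  "u \<in> W k \<Longrightarrow> w \<in> W k \<Longrightarrow> Q k (c *\<^sub>R u) w = c * Q k u w"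
  "u \<in> W k \<Longrightarrow> v \<in> W k \<Longrightarrow> w \<in> W k \<Longrightarrow> Q k (u - v) w = Q k u w - Q k v w"
  "u \<in> W k \<Longrightarrow> w \<in> W k \<Longrightarrow> Q k (- u) w = - Q k u w"
proof -
  show 1: "u \<in> W k \<Longrightarrow> v \<in> W k \<Longrightarrow> w \<in> W k \<Longrightarrow> Q k (u + v) w = Q k u w + Q k v w" for u v w
    using gf unfolding graded_forms_def by blast
  show 2: "u \<in> W k \<Longrightarrow> w \<in> W k \<Longrightarrow> Q k (c *\<^sub>R u) w = c * Q k u w" for c u w
    using gf unfolding graded_forms_def by blast
  show 3: "u \<in> W k \<Longrightarrow> w \<in> W k \<Longrightarrow> Q k (- u) w = - Q k u w" for u w
    using 2[of u w "-1"] by simp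
  show "u \<in> W k \<Longrightarrow> v \<in> W k \<Longrightarrow> w \<in> W k \<Longrightarrow> Q k (u - v) w = Q k u w - Q k v w"
    using 1[of u "- v" w] 3[of v w] subspace_neg[OF W_subspace] by simp
qed

lemma Q_right: "u \<in> W k \<Longrightarrow> v \<in> W k \<Longrightarrow> w \<in> W k \<Longrightarrow> Q k w (u + v) = Q k w u + Q k w v"
  "u \<in> W k \<Longrightarrow> w \<in> W k \<Longrightarrow> Q k w (- u) = - Q k w u"
proof -
  show "u \<in> W k \<Longrightarrow> v \<in> W k \<Longrightarrow> w \<in> W k \<Longrightarrow> Q k w (u + v) = Q k w u + Q k w v"
    using gf unfolding graded_forms_def by blast
  have "u \<in> W k \<Longrightarrow> w \<in> W k \<Longrightarrow> Q k w (c *\<^sub>R u) = c * Q k w u" for c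
    using gf unfolding graded_forms_def by blast
  from this[of "-1"] show "u \<in> W k \<Longrightarrow> w \<in> W k \<Longrightarrow> Q k w (- u) = - Q k w u" by simp
qed

lemmas W_closed = subspace_add[OF W_subspace] subspace_scale[OF W_subspace]
  subspace_diff[OF W_subspace] subspace_neg[OF W_subspace]

lemma QC_add: "u \<in> WC W k \<Longrightarrow> v \<in> WC W k \<Longrightarrow> w \<in> WC W k \<Longrightarrow> QC Q k (u + v) w = QC Q k u w + QC Q k v w"
  by (simp add: QC_def WC_def Q_left complex_eq_iff)

lemma QC_add_right: "u \<in> WC W k \<Longrightarrow> v \<in> WC W k \<Longrightarrow> w \<in> WC W k \<Longrightarrow> QC Q k w (u + v) = QC Q k w u + QC Q k w v"
  by (simp add: QC_def WC_def Q_right complex_eq_iff)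

lemma QC_scale: "u \<in> WC W k \<Longrightarrow> w \<in> WC W k \<Longrightarrow> QC Q k (c *s u) w = c * QC Q k u w"
  by (simp add: QC_def WC_def Q_left W_closed complex_eq_iff algebra_simps)

lemma QC_cnj: "u \<in> WC W k \<Longrightarrow> w \<in> WC W k \<Longrightarrow> cnj (QC Q k u w) = QC Q k (vcnj u) (vcnj w)"
  by (simp add: QC_def WC_def Q_left Q_right W_closed complex_eq_iff)

lemma QC_sym: "u \<in> WC W k \<Longrightarrow> w \<in> WC W k \<Longrightarrow> even k \<Longrightarrow> QC Q k u w = QC Q k w u"
proof -
  assume "u \<in> WC W k" "w \<in> WC W k" "even k"
  moreover have "Q k u w = Q k w u" if "u \<in> W k" "w \<in> W k" for u w
  proof -
    have "Q k u w = (-1) powi k * Q k w u"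
      using gf that unfolding graded_forms_def by blast
    then show ?thesis using \<open>even k\<close> by simp
  qed
  ultimately show ?thesis by (simp add: QC_def WC_def)
qed

lemma QC_low: "u \<in> WC W k \<Longrightarrow> v \<in> WC W (k - 1) \<Longrightarrow> QC Q k u v = 0"
  "u \<in> WC W k \<Longrightarrow> v \<in> WC W (k - 1) \<Longrightarrow> QC Q k v u = 0"
  using gf unfolding graded_forms_def QC_def WC_def by (auto simp: complex_eq_iff)

text \<open>The polarization in type \<open>(p, p)\<close>, where the power of \<open>\<i>\<close>
  is 1; on \<open>WC W (2 * p)\<close> it is hermitian because the weight is even.\<close>

definition qform :: "int \<Rightarrow> complex ^ 'n \<Rightarrow> complex ^ 'n \<Rightarrow> complex" where
  "qform p u v = QC Q (2 * p) u (vcnj v)"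

lemma qform_add: "u \<in> WC W (2 * p) \<Longrightarrow> v \<in> WC W (2 * p) \<Longrightarrow> w \<in> WC W (2 * p) \<Longrightarrow>
    qform p (u + v) w = qform p u w + qform p v w"
  by (simp add: qform_def QC_add WC_cnj)

lemma qform_scale: "u \<in> WC W (2 * p) \<Longrightarrow> w \<in> WC W (2 * p) \<Longrightarrow> qform p (c *s u) w = c * qform p u w"
  by (simp add: qform_def QC_scale WC_cnj)

lemma qform_herm: "u \<in> WC W (2 * p) \<Longrightarrow> w \<in> WC W (2 * p) \<Longrightarrow> qform p u w = cnj (qform p w u)"
  by (simp add: qform_def QC_cnj WC_cnj vcnj_vcnj QC_sym)

lemma qform_sum:
  assumes "finite I" "\<And>i. i \<in> I \<Longrightarrow> f i \<in> WC W (2 * p)" "w \<in> WC W (2 * p)"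
  shows "qform p (\<Sum>i\<in>I. f i) w = (\<Sum>i\<in>I. qform p (f i) w)"
  using assms
proof (induction I rule: finite_induct)
  case empty
  then show ?case using qform_scale[of 0 p w 0] WC_closed by simp
next
  case (insert i I)
  then show ?case by (simp add: qform_add WC_closed vec.subspace_sum[OF WC_subspace])
qed

end

section \<open>Filtrations of mixed Hodge structures of Hodge-Tate type\<close>

lemma vcnj_subspace: "vec.subspace S \<Longrightarrow> vec.subspace (vcnj ` S)"
proof -
  assume S: "vec.subspace S"
  have 1: "vcnj 0 = 0" "vcnj u + vcnj v = vcnj (u + v)" "c *s vcnj u = vcnj (cnj c *s u)"
    for u v :: "complex ^ 'a" and c
    by (auto simp: vcnj_def vec_eq_iff)
  show ?thesis
    unfolding vec.subspace_def
    using vec.subspace_0[OF S] vec.subspace_add[OF S] vec.subspace_scale[OF S]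
    by (auto simp: 1 intro!: imageI) (metis 1(1) image_eqI)
qed

locale tate_type = polarized W N Q for W :: "'n::finite wfilt" and N Q +
  fixes h :: "int \<Rightarrow> int \<Rightarrow> nat" and F :: "'n hfilt"
  assumes h0: "\<And>p q. p \<noteq> q \<Longrightarrow> h p q = 0" and FD: "F \<in> classifying_space W Q h"
begin

lemma hf: "vec.subspace (F p)" "p \<le> q \<Longrightarrow> F q \<subseteq> F p" "\<exists>p. F p = {0}"
  and mhs: "{x + y | x y. x \<in> Fgr W F k p \<and> y \<in> vcnj ` Fgr W F k (k - p + 1)} = WC W k"
  and pol: "u \<in> Hgr W F p q - WC W (p + q - 1) \<Longrightarrow> 0 < Re (\<i> powi (p - q) * QC Q (p + q) u (vcnj u))"
  and dimH: "vec.dim (Hgr W F p q) = h p q + vec.dim (WC W (p + q - 1))"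
  using FD unfolding classifying_space_def mixed_hodge_structure_def hodge_filtration_def
    graded_polarized_def by blast+

lemma Fgr_subspace: "vec.subspace (Fgr W F k p)"
  unfolding Fgr_def by (intro vec.subspace_sums vec.subspace_inter hf WC_subspace)

lemma Fgr_bounds: "WC W (k - 1) \<subseteq> Fgr W F k p" "Fgr W F k p \<subseteq> WC W k"
proof -
  have "v \<in> Fgr W F k p" if "v \<in> WC W (k - 1)" for v
  proof -
    have "v = 0 + v" "0 \<in> F p \<inter> WC W k" using vec.subspace_0[OF hf(1)] WC_closed(1) by auto
    then show ?thesis unfolding Fgr_def using that by blast
  qed
  then show "WC W (k - 1) \<subseteq> Fgr W F k p" by blast
  show "Fgr W F k p \<subseteq> WC W k"
    unfolding Fgr_def using WC_mono[of "k - 1" k] by (auto intro!: WC_closed)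
qed

lemma vcnj_WC: "vcnj ` WC W k = WC W k"
  using WC_cnj by (auto intro!: image_eqI[of _ vcnj "vcnj _"] simp: vcnj_vcnj)

text \<open>\<open>Hgr\<close> contains the lower weight step, and the prescribed Hodge number 0
  gives both the same dimension.\<close>

lemma Hgr_off: "p \<noteq> q \<Longrightarrow> Hgr W F p q = WC W (p + q - 1)"
proof -
  assume "p \<noteq> q"
  have "WC W (p + q - 1) \<subseteq> vcnj ` Fgr W F (p + q) q"
    using image_mono[OF Fgr_bounds(1)[of "p + q" q], of vcnj] by (simp add: vcnj_WC)
  then have "WC W (p + q - 1) \<subseteq> Hgr W F p q"
    unfolding Hgr_def using Fgr_bounds(1)[of "p + q" p] by blast
  moreover have "vec.subspace (Hgr W F p q)"
    unfolding Hgr_def by (intro vec.subspace_inter vcnj_subspace Fgr_subspace)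
  moreover have "vec.dim (Hgr W F p q) \<le> vec.dim (WC W (p + q - 1))"
    using dimH[of p q] h0[OF \<open>p \<noteq> q\<close>] by simp
  ultimately show ?thesis
    using vec.subspace_dim_equal[OF WC_subspace] by blast
qed

text \<open>Oppositeness at \<open>p + 1\<close>: when one of the two complementary summands of the
  graded piece vanishes, the other is everything.\<close>

lemma WC_in_cnj_Fgr: "Fgr W F k (p + 1) = WC W (k - 1) \<Longrightarrow> WC W k \<subseteq> vcnj ` Fgr W F k (k - p)"
proof
  fix v assume e: "Fgr W F k (p + 1) = WC W (k - 1)" and "v \<in> WC W k"
  then have "v \<in> {x + y | x y. x \<in> WC W (k - 1) \<and> y \<in> vcnj ` Fgr W F k (k - p)}"
    using mhs[of k "p + 1"] by simp
  then obtain x y where xy: "x \<in> WC W (k - 1)" "y \<in> vcnj ` Fgr W F k (k - p)" "v = x + y" by blast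
  have "WC W (k - 1) \<subseteq> vcnj ` Fgr W F k (k - p)"
    using image_mono[OF Fgr_bounds(1)[of k "k - p"], of vcnj] by (simp add: vcnj_WC)
  then show "v \<in> vcnj ` Fgr W F k (k - p)"
    using xy vec.subspace_add[OF vcnj_subspace[OF Fgr_subspace]] by blast
qed

text \<open>Descending induction from a step where \<open>F\<close> is zero. If the step
  \<open>p + 1\<close> vanishes on the graded piece, the conjugate of step \<open>k - p\<close> is
  everything, so step \<open>p\<close> equals its Hodge summand of type \<open>(p, k - p)\<close>;
  this one is off the diagonal and hence zero.\<close>

lemma Fgr_high: "2 * p > k \<Longrightarrow> Fgr W F k p = WC W (k - 1)"
proof -
  obtain p0 where p0: "F p0 = {0}" using hf(3) by blast
  have big: "Fgr W F k p = WC W (k - 1)" if "p \<ge> p0" for p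
  proof -
    have "F p = {0}" using hf(2)[OF that] p0 vec.subspace_0[OF hf(1)] by blast
    then show ?thesis unfolding Fgr_def using WC_closed(1) by auto
  qed
  have "2 * p > k \<longrightarrow> Fgr W F k p = WC W (k - 1)" if "p \<le> p0" for p
    using that
  proof (induction p rule: int_le_induct)
    case base
    then show ?case using big by simp
  next
    case (step i)
    let ?p = "i - 1"
    show ?case
    proof
      assume k: "k < 2 * ?p"
      then have "Fgr W F k (?p + 1) = WC W (k - 1)" using step by simp
      then have "Fgr W F k ?p \<subseteq> vcnj ` Fgr W F k (k - ?p)"
        using WC_in_cnj_Fgr Fgr_bounds(2) by blast
      then have "Fgr W F k ?p \<subseteq> Hgr W F ?p (k - ?p)" unfolding Hgr_def by simp
      also have "\<dots> = WC W (k - 1)" using Hgr_off[of ?p "k - ?p"] k by simp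
      finally show "Fgr W F k ?p = WC W (k - 1)" using Fgr_bounds(1)[of k ?p] by blast
    qed
  qed
  then show "2 * p > k \<Longrightarrow> Fgr W F k p = WC W (k - 1)" using big by (cases "p \<le> p0") auto
qed

lemma Fgr_mid: "Fgr W F (2 * p) p = WC W (2 * p)"
proof -
  have "WC W (2 * p) \<subseteq> vcnj ` Fgr W F (2 * p) p"
    using WC_in_cnj_Fgr[of "2 * p" p] Fgr_high[of "2 * p" "p + 1"] by simp
  then have "vcnj ` WC W (2 * p) \<subseteq> vcnj ` vcnj ` Fgr W F (2 * p) p" by (rule image_mono)
  then show ?thesis using Fgr_bounds(2)[of "2 * p" p] by (auto simp: vcnj_WC image_image vcnj_vcnj)
qed

text \<open>In weight \<open>2 * p - 1\<close> the two opposite summands are step \<open>p\<close>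
  and its own conjugate. Both vanish by \<open>Fgr_high\<close>, so the graded piece is
  zero.\<close>

lemma WC_odd: "WC W (2 * p - 1) = WC W (2 * p - 2)"
proof -
  have e: "Fgr W F (2 * p - 1) p = WC W (2 * p - 2)" using Fgr_high[of "2 * p - 1" p] by simp
  have "WC W (2 * p - 1) = {x + y | x y. x \<in> WC W (2 * p - 2) \<and> y \<in> WC W (2 * p - 2)}"
    using mhs[of "2 * p - 1" p] by (simp add: e vcnj_WC)
  then have "WC W (2 * p - 1) \<subseteq> WC W (2 * p - 2)" by (auto intro: WC_closed)
  then show ?thesis using WC_mono[of "2 * p - 2" "2 * p - 1"] by auto
qed

lemma F_WC_split:
  assumes "v \<in> WC W (2 * p)"
  obtains x y where "x \<in> F p \<inter> WC W (2 * p)" "y \<in> WC W (2 * (p - 1))" "v = x + y"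
proof -
  have e: "2 * (p - 1) = 2 * p - 2" by simp
  from assms have "v \<in> Fgr W F (2 * p) p" by (simp add: Fgr_mid)
  then show ?thesis unfolding Fgr_def WC_odd e[symmetric] using that by blast
qed

text \<open>Since step \<open>p + 1\<close> vanishes on the graded piece of weight
  \<open>2 * p\<close>, such a vector already lies in weight \<open>2 * (p - 1)\<close>. The
  intersection thus descends with \<open>p\<close> until the weight filtration is zero.\<close>

lemma F_WC_trivial: "F (p + 1) \<inter> WC W (2 * p) = {0}"
proof -
  have low: "F (p + 1) \<inter> WC W (2 * p) \<subseteq> F p \<inter> WC W (2 * (p - 1))" for p
  proof -
    have "F (p + 1) \<inter> WC W (2 * p) \<subseteq> Fgr W F (2 * p) (p + 1)"
      unfolding Fgr_def using WC_closed(1) by (auto intro!: exI[of _ 0] exI)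
    also have "\<dots> = WC W (2 * (p - 1))"
      using Fgr_high[of "2 * p" "p + 1"] WC_odd[of p] by (simp add: algebra_simps)
    finally show ?thesis using hf(2)[of p "p + 1"] by auto
  qed
  obtain k where k: "WC W k = {0}" using WC_exhaust by blast
  define p0 where "p0 = k div 2"
  have small: "F (p + 1) \<inter> WC W (2 * p) = {0}" if "p \<le> p0" for p
  proof -
    have "WC W (2 * p) \<subseteq> {0}" using WC_mono[of "2 * p" k] that unfolding k[symmetric] p0_def by auto
    then show ?thesis using vec.subspace_0[OF hf(1)] WC_closed(1) by blast
  qed
  have "F (p + 1) \<inter> WC W (2 * p) = {0}" if "p0 \<le> p" for p
    using that
  proof (induction p rule: int_ge_induct)
    case base
    then show ?case using small by simp
  next
    case (step i)
    have "F (i + 1 + 1) \<inter> WC W (2 * (i + 1)) \<subseteq> {0}"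
      using low[of "i + 1"] step by simp
    then show ?case using vec.subspace_0[OF hf(1)] WC_closed(1) by blast
  qed
  then show ?thesis using small by (cases "p \<le> p0") auto
qed

definition tate_piece :: "int \<Rightarrow> (complex ^ 'n) set" where
  "tate_piece p = F p \<inter> WC W (2 * p)"

lemma tate_piece_subspace: "vec.subspace (tate_piece p)"
  unfolding tate_piece_def by (intro vec.subspace_inter hf WC_subspace)

text \<open>Positivity holds off \<open>WC W (2 * p - 1)\<close>; by \<open>WC_odd\<close> and
  \<open>F_WC_trivial\<close> the Tate piece meets that step only in 0.\<close>

lemma qform_pos: "u \<in> tate_piece p \<Longrightarrow> u \<noteq> 0 \<Longrightarrow> 0 < Re (qform p u u)"
proof -
  assume u: "u \<in> tate_piece p" "u \<noteq> 0"
  have pp: "p + p = 2 * p" "2 * p - 2 = 2 * (p - 1)" "p - 1 + 1 = p" by auto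
  have "u \<in> Hgr W F p p" using u by (simp add: Hgr_def pp Fgr_mid vcnj_WC tate_piece_def)
  moreover have "u \<notin> WC W (2 * p - 1)"
  proof
    assume "u \<in> WC W (2 * p - 1)"
    then show False using F_WC_trivial[of "p - 1"] u unfolding WC_odd pp by (auto simp: tate_piece_def)
  qed
  ultimately show ?thesis using pol[of u p p] by (simp add: qform_def pp)
qed

lemma tate_basis: "\<exists>E. finite E \<and> E \<subseteq> tate_piece p \<and> vec.independent E \<and> vec.span E = tate_piece p \<and>
    (\<forall>e\<in>E. \<forall>e'\<in>E. qform p e e' = (if e = e' then 1 else 0))"
  by (rule gram_schmidt[OF tate_piece_subspace])
    (auto simp: qform_add qform_scale qform_pos tate_piece_def intro: qform_herm)

text \<open>The columns are the orthonormal bases \<open>S p\<close> of all Tate pieces together.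
  Their independence is not shown directly: the union \<open>U p\<close> spans a weight step and has
  at most its dimension many elements, so in the full space it is a spanning set of exactly
  \<open>CARD('n)\<close> vectors.\<close>

lemma ex_adapted_frame: "\<exists>l B. adapted_frame W Q F l B"
proof -
  obtain S where S: "\<And>p. finite (S p)" "\<And>p. S p \<subseteq> tate_piece p" "\<And>p. vec.independent (S p)"
    "\<And>p. vec.span (S p) = tate_piece p"
    "\<And>p e e'. e \<in> S p \<Longrightarrow> e' \<in> S p \<Longrightarrow> qform p e e' = (if e = e' then 1 else 0)"
    using tate_basis by metis
  define U where "U p = (\<Union>a\<in>{..p}. S a)" for p
  have piece_WC: "tate_piece a \<subseteq> WC W (2 * p)" if "a \<le> p" for a p
    using WC_mono[of "2 * a" "2 * p"] that by (auto simp: tate_piece_def)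
  have triv: "tate_piece q \<inter> WC W (2 * p) = {0}" if "p < q" for p q
  proof -
    have "tate_piece q \<inter> WC W (2 * p) \<subseteq> {0}"
      using F_WC_trivial[of p] hf(2)[of "p + 1" q] that by (auto simp: tate_piece_def)
    then show ?thesis using vec.subspace_0[OF tate_piece_subspace] WC_closed(1) by blast
  qed
  have S0: "0 \<notin> S p" for p using S(3) vec.dependent_zero by blast
  obtain k where k: "WC W k = {0}" using WC_exhaust by blast
  define p0 where "p0 = k div 2"
  have small: "WC W (2 * p) = {0}" if "p \<le> p0" for p
  proof -
    have "2 * p \<le> k" using that unfolding p0_def by linarith
    then show ?thesis using WC_mono[of "2 * p" k] WC_closed(1) unfolding k by blast
  qed
  have Ssmall: "S p = {}" if "p \<le> p0" for p
  proof -
    have "S p \<subseteq> {0}" using S(2)[of p] small[OF that] unfolding tate_piece_def by auto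
    then show ?thesis using S0[of p] by auto
  qed
  have Usmall: "U p = {}" if "p \<le> p0" for p
    unfolding U_def using Ssmall that by auto
  have main: "finite (U p) \<and> vec.span (U p) = WC W (2 * p) \<and> card (U p) \<le> vec.dim (WC W (2 * p))" if "p0 \<le> p" for p
    using that
  proof (induction p rule: int_ge_induct)
    case base
    then show ?case by (simp add: Usmall small)
  next
    case (step i)
    have Us: "U (i + 1) = U i \<union> S (i + 1)"
    proof -
      have "{..i + 1} = insert (i + 1) {..i}" by auto
      then show ?thesis by (auto simp: U_def)
    qed
    have sums: "WC W (2 * (i + 1)) = {x + y | x y. x \<in> WC W (2 * i) \<and> y \<in> tate_piece (i + 1)}"
    proof (intro equalityI subsetI)
      fix v assume "v \<in> WC W (2 * (i + 1))"
      then obtain x y where "x \<in> F (i + 1) \<inter> WC W (2 * (i + 1))" "y \<in> WC W (2 * i)" "v = x + y"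
        by (rule F_WC_split) simp
      then show "v \<in> {x + y | x y. x \<in> WC W (2 * i) \<and> y \<in> tate_piece (i + 1)}"
        unfolding tate_piece_def using add.commute[of x y] by blast
    next
      fix v assume "v \<in> {x + y | x y. x \<in> WC W (2 * i) \<and> y \<in> tate_piece (i + 1)}"
      then obtain x y where "x \<in> WC W (2 * i)" "y \<in> tate_piece (i + 1)" "v = x + y" by blast
      moreover have "x \<in> WC W (2 * (i + 1))" if "x \<in> WC W (2 * i)" for x
        using WC_mono[of "2 * i" "2 * (i + 1)"] that by auto
      moreover have "y \<in> WC W (2 * (i + 1))" if "y \<in> tate_piece (i + 1)" for y
        using piece_WC[of "i + 1" "i + 1"] that by auto
      ultimately show "v \<in> WC W (2 * (i + 1))" by (simp add: WC_closed(2))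
    qed
    have "vec.span (U (i + 1)) = {x + y | x y. x \<in> vec.span (U i) \<and> y \<in> vec.span (S (i + 1))}"
      unfolding Us by (rule vec.span_Un)
    then have sp: "vec.span (U (i + 1)) = WC W (2 * (i + 1))"
      using step S(4) sums by simp
    have "card (U (i + 1)) \<le> card (U i) + card (S (i + 1))"
      unfolding Us by (rule card_Un_le)
    also have "card (S (i + 1)) = vec.dim (tate_piece (i + 1))"
      using vec.dim_span[of "S (i + 1)"] vec.dim_eq_card_independent[OF S(3)] S(4) by metis
    also have "card (U i) + vec.dim (tate_piece (i + 1)) \<le> vec.dim (WC W (2 * i)) + vec.dim (tate_piece (i + 1))"
      using step by simp
    also have "\<dots> = vec.dim (WC W (2 * (i + 1)))"
      using vec.dim_sums_Int[OF WC_subspace[of "2 * i"] tate_piece_subspace[of "i + 1"]] triv[of i "i + 1"]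
      unfolding sums[symmetric] by (simp add: Int_commute)
    finally show ?case using sp step S(1) by (simp add: Us)
  qed
  have spanU: "vec.span (U p) = WC W (2 * p)" for p
    using main[of p] small[of p] Usmall[of p] by (cases "p0 \<le> p") auto
  obtain k1 where k1: "WC W k1 = UNIV" using WC_exhaust by blast
  \<comment> \<open>From \<open>p1\<close> on the weight steps of index \<open>2 * p\<close> are
    everything; adding the absolute value ensures \<open>k1 \<le> 2 * p\<close> for negative
    \<open>k1\<close> too.\<close>
  define p1 where "p1 = max p0 k1 + \<bar>k1\<bar>"
  have big: "WC W (2 * p) = UNIV" if "p \<ge> p1" for p
  proof -
    have "k1 \<le> 2 * p" using that unfolding p1_def by linarith
    then show ?thesis using WC_mono[of k1 "2 * p"] k1 by auto
  qed
  have p01: "p0 \<le> p1" by (simp add: p1_def)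
  have card: "card (U p) = CARD('n)" if "p \<ge> p1" for p
  proof -
    have "vec.dim (UNIV :: (complex ^ 'n) set) \<le> card (U p)"
      using main[of p] big[OF that] that p01 by (intro vec.dim_le_card) auto
    then show ?thesis using main[of p] big[OF that] that p01 by (simp add: vec.dim_UNIV card_cart_basis)
  qed
  have Umono: "U p \<subseteq> U q" if "p \<le> q" for p q using that by (force simp: U_def)
  \<comment> \<open>Beyond \<open>p1\<close> the cardinality is constant, so an increasing family
    gains no further vectors.\<close>
  have Usub: "U p \<subseteq> U p1" for p
  proof (cases "p \<le> p1")
    case False
    then have "U p1 = U p"
      using card[of p] card[of p1] main[of p] p01 by (intro card_subset_eq Umono) auto
    then show ?thesis by simp
  qed (simp add: Umono)
  obtain e where e: "bij_betw e (UNIV :: 'n set) (U p1)"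
    using finite_same_card_bij[of "UNIV :: 'n set" "U p1"] card[of p1] main[of p1] p01 by auto
  have einj: "e i = e j \<longleftrightarrow> i = j" for i j using e by (auto simp: bij_betw_def inj_on_def)
  have "\<exists>p. e j \<in> S p" for j using e by (auto simp: bij_betw_def U_def)
  then obtain l where l: "\<And>j. e j \<in> S (l j)" by metis
  \<comment> \<open>The sets \<open>S a\<close> are disjoint: for \<open>a < b\<close> a common
    vector would lie in \<open>F b\<close> and in weight \<open>2 * a\<close>, hence be 0, which a
    basis excludes.\<close>
  have luniq: "p = l j" if "e j \<in> S p" for p j
  proof -
    have *: False if "x \<in> S a" "x \<in> S b" "a < b" for x a b
    proof -
      have "x \<in> tate_piece b \<inter> WC W (2 * a)" using piece_WC[of a a] S(2)[of a] S(2)[of b] that by auto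
      then show False using triv[OF \<open>a < b\<close>] that(1) S0[of a] by auto
    qed
    show ?thesis using *[OF l[of j] that] *[OF that l[of j]] by (cases p "l j" rule: linorder_cases) auto
  qed
  have Ueq: "U p = e ` {j. l j \<le> p}" for p
  proof (intro equalityI subsetI)
    fix x assume x: "x \<in> U p"
    then obtain j where j: "x = e j" using Usub[of p] e by (auto simp: bij_betw_def)
    obtain a where "a \<le> p" "x \<in> S a" using x by (auto simp: U_def)
    then show "x \<in> e ` {j. l j \<le> p}" using luniq j by blast
  qed (use l in \<open>auto simp: U_def\<close>)
  have epiece: "e j \<in> tate_piece (l j)" for j using l S(2) by blast
  define B :: "'n cmat" where "B = (\<chi> i j. e j $ i)"
  have Bmv: "B *v x = (\<Sum>j\<in>UNIV. x $ j *s e j)" for x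
    by (simp add: matrix_vector_mult_def B_def vec_eq_iff mult.commute)
  have Bax: "B *v axis j 1 = e j" for j
  proof -
    have "B *v axis j 1 = (\<Sum>i\<in>UNIV. if i = j then e j else 0)"
      unfolding Bmv by (intro sum.cong) (auto simp: axis_def)
    then show ?thesis by simp
  qed
  have imsub: "vec.subspace ((*v) B ` {x. \<forall>j. P j \<longrightarrow> x $ j = 0})" for P
    by (intro vec.linear_subspace_image matrix_vector_mul_linear_gen) (auto simp: vec.subspace_def)
  have wB: "WC W (2 * p) = (*v) B ` {x. \<forall>j. p < l j \<longrightarrow> x $ j = 0}" for p
  proof (intro equalityI)
    have "U p \<subseteq> (*v) B ` {x. \<forall>j. p < l j \<longrightarrow> x $ j = 0}"
    proof
      fix x assume "x \<in> U p"
      then obtain j where "x = e j" "l j \<le> p" unfolding Ueq by blast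
      then show "x \<in> (*v) B ` {x. \<forall>j. p < l j \<longrightarrow> x $ j = 0}"
        by (auto simp: Bax[symmetric] axis_def intro!: imageI)
    qed
    then show "WC W (2 * p) \<subseteq> (*v) B ` {x. \<forall>j. p < l j \<longrightarrow> x $ j = 0}"
      unfolding spanU[symmetric] by (rule vec.span_minimal[OF _ imsub])
    show "(*v) B ` {x. \<forall>j. p < l j \<longrightarrow> x $ j = 0} \<subseteq> WC W (2 * p)"
    proof clarify
      fix x :: "complex ^ 'n" assume x: "\<forall>j. p < l j \<longrightarrow> x $ j = 0"
      show "B *v x \<in> WC W (2 * p)"
        unfolding Bmv
      proof (rule vec.subspace_sum[OF WC_subspace])
        fix j
        show "x $ j *s e j \<in> WC W (2 * p)"
          using x epiece[of j] piece_WC[of "l j" p] by (cases "p < l j") (auto intro: WC_closed)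
      qed
    qed
  qed
  have "surj ((*v) B)" using wB[of p1] big[of p1] by (auto simp: surj_def)
  then obtain B' where "B ** B' = mat 1" using matrix_right_invertible_surjective[of B] by (auto simp: surj_def)
  then have inv: "invertible B" using invertible_right_inverse by blast
  have Binj: "x = 0" if "B *v x = 0" for x
  proof -
    have "\<exists>B'. B' ** B = mat 1" using inv invertible_left_inverse by blast
    then show ?thesis using that matrix_left_invertible_ker[of B] by blast
  qed
  have WB: "WC W k = (*v) B ` {x. \<forall>j. k < 2 * l j \<longrightarrow> x $ j = 0}" for k
  proof -
    have "WC W k = WC W (2 * (k div 2))"
    proof (cases "even k")
      case False
      then have "k = 2 * (k div 2 + 1) - 1" by presburger
      then show ?thesis using WC_odd[of "k div 2 + 1"] by simp
    qed simp
    moreover have "k < 2 * a \<longleftrightarrow> k div 2 < a" for a :: int by linarith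
    ultimately show ?thesis using wB[of "k div 2"] by simp
  qed
  have FB: "F p = (*v) B ` {x. \<forall>j. l j < p \<longrightarrow> x $ j = 0}" for p
  proof (intro equalityI)
    have sub: "B *v x \<in> F p" if x: "\<forall>j. l j < p \<longrightarrow> x $ j = 0" for x
      unfolding Bmv
    proof (rule vec.subspace_sum[OF hf(1)])
      fix j
      have "e j \<in> F p" if "p \<le> l j"
        using epiece[of j] hf(2)[OF that] by (auto simp: tate_piece_def)
      then show "x $ j *s e j \<in> F p"
        using x vec.subspace_scale[OF hf(1)] vec.subspace_0[OF hf(1)] by (cases "l j < p") auto
    qed
    then show "(*v) B ` {x. \<forall>j. l j < p \<longrightarrow> x $ j = 0} \<subseteq> F p" by blast
    show "F p \<subseteq> (*v) B ` {x. \<forall>j. l j < p \<longrightarrow> x $ j = 0}"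
    proof
      fix v assume v: "v \<in> F p"
      obtain x where x: "v = B *v x" using \<open>surj ((*v) B)\<close> by (auto simp: surj_def)
      \<comment> \<open>The part \<open>y\<close> with levels at least \<open>p\<close> is in
        \<open>F p\<close>, so the remainder \<open>z\<close> is in \<open>F p\<close> as well; it
        has weight \<open>2 * (p - 1)\<close> and vanishes by \<open>F_WC_trivial\<close>.\<close>
      define y where "y = (\<chi> j. if l j < p then 0 else x $ j)"
      define z where "z = (\<chi> j. if l j < p then x $ j else 0)"
      have "x = y + z" by (simp add: y_def z_def vec_eq_iff)
      then have "B *v z = v - B *v y" by (simp add: x matrix_vector_right_distrib)
      moreover have "B *v y \<in> F p" by (rule sub) (simp add: y_def)
      ultimately have "B *v z \<in> F (p - 1 + 1)" using v vec.subspace_diff[OF hf(1)] by simp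
      moreover have "B *v z \<in> WC W (2 * (p - 1))"
        unfolding wB by (intro imageI) (auto simp: z_def)
      ultimately have "B *v z = 0" using F_WC_trivial[of "p - 1"] by blast
      then have "z = 0" by (rule Binj)
      then have z0: "z $ j = 0" for j by simp
      have "x $ j = 0" if "l j < p" for j
        using that z0[of j] by (simp add: z_def)
      then have "\<forall>j. l j < p \<longrightarrow> x $ j = 0" by blast
      then show "v \<in> (*v) B ` {x. \<forall>j. l j < p \<longrightarrow> x $ j = 0}" using x by blast
    qed
  qed
  have QB: "qform p (B *v x) (B *v y) = (\<Sum>j | l j = p. x $ j * cnj (y $ j))"
    if x: "\<forall>j. p < l j \<longrightarrow> x $ j = 0" and y: "\<forall>j. p < l j \<longrightarrow> y $ j = 0" for p x y
  proof -
    have eW: "e j \<in> WC W (2 * p)" if "l j \<le> p" for j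
      using epiece[of j] piece_WC[OF that] by blast
    \<comment> \<open>Basis vectors of smaller level lie in the next lower weight step, which the
      form ignores; only the level \<open>p\<close> survives.\<close>
    have low: "qform p v (e j) = 0" "qform p (e j) v = 0" if "l j < p" "v \<in> WC W (2 * p)" for j v
    proof -
      have "e j \<in> WC W (2 * p - 1)"
        using epiece[of j] piece_WC[of "l j" "l j"] WC_mono[of "2 * l j" "2 * p - 1"] that by auto
      then show "qform p v (e j) = 0" "qform p (e j) v = 0"
        using that unfolding qform_def by (auto intro: QC_low(1)[OF _ WC_cnj] QC_low(2)[OF WC_cnj])
    qed
    have xe: "x $ j *s e j \<in> WC W (2 * p)" if "\<forall>j. p < l j \<longrightarrow> x $ j = 0" for x :: "complex ^ 'n" and j
      using that eW[of j] by (cases "p < l j") (auto intro: WC_closed)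
    have BW: "B *v x \<in> WC W (2 * p)" if "\<forall>j. p < l j \<longrightarrow> x $ j = 0" for x :: "complex ^ 'n"
      unfolding Bmv using xe[OF that] by (intro vec.subspace_sum[OF WC_subspace])
    have ee: "qform p (e j) (e i) = (if i = j then 1 else 0)" if "l i = p" "l j = p" for i j
      using S(5)[of "e j" p "e i"] l[of i] l[of j] that einj by auto
    have expand: "qform p (B *v x) v = (\<Sum>j | l j = p. x $ j * qform p (e j) v)"
      if x: "\<forall>j. p < l j \<longrightarrow> x $ j = 0" and v: "v \<in> WC W (2 * p)" for x v
    proof -
      have "qform p (B *v x) v = (\<Sum>j\<in>UNIV. qform p (x $ j *s e j) v)"
        unfolding Bmv using xe[OF x] v by (intro qform_sum) auto
      also have "\<dots> = (\<Sum>j\<in>UNIV. if l j = p then x $ j * qform p (e j) v else 0)"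
      proof (rule sum.cong[OF refl])
        fix j
        show "qform p (x $ j *s e j) v = (if l j = p then x $ j * qform p (e j) v else 0)"
        proof (cases "p < l j")
          case True
          then show ?thesis using x v qform_scale[of 0 p v 0] WC_closed(1) by simp
        next
          case False
          then show ?thesis using eW[of j] v low[of j v] by (simp add: qform_scale)
        qed
      qed
      finally show ?thesis by (simp add: sum.If_cases)
    qed
    have "qform p (e j) (B *v y) = cnj (y $ j)" if "l j = p" for j
    proof -
      have "qform p (e j) (B *v y) = cnj (qform p (B *v y) (e j))"
        using eW[of j] BW[OF y] that by (intro qform_herm) auto
      also have "qform p (B *v y) (e j) = (\<Sum>i | l i = p. y $ i * qform p (e i) (e j))"
        using expand[OF y] eW[of j] that by simp
      also have "\<dots> = (\<Sum>i | l i = p. if i = j then y $ j else 0)"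
        using that by (intro sum.cong) (auto simp: ee)
      also have "\<dots> = y $ j" using that by simp
      finally show ?thesis .
    qed
    then show ?thesis using expand[OF x BW[OF y]] by simp
  qed
  have "adapted_frame W Q F l B"
    unfolding adapted_frame_def using inv WB FB QB unfolding qform_def by blast
  then show ?thesis by blast
qed

end

text \<open>Prevents the simplifier from turning \<open>Wlow W 1\<close> into \<open>Wlow W (Suc 0)\<close>.\<close>

declare One_nat_def [simp del]

section \<open>The tangent spaces of the classifying space\<close>

text \<open>The maps which preserve \<open>W\<close> and the graded hermitian forms; both the unipotent radical and
  the real group consist of such maps.\<close>

definition metric_group :: "'n::finite wfilt \<Rightarrow> 'n gforms \<Rightarrow> 'n cmat set" where
  "metric_group W Q = {g. invertible g \<and> (\<forall>k. (*v) g ` WC W k = WC W k) \<and>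
     (\<forall>k. \<forall>u\<in>WC W k. \<forall>v\<in>WC W k. QC Q k (g *v u) (vcnj (g *v v)) = QC Q k u (vcnj v))}"

lemma mv_nth: "(A *v x) $ i = (\<Sum>j\<in>UNIV. A $ i $ j * x $ j)"
  by (simp add: matrix_vector_mult_def)

lemma act_mult: "act (g ** g') F = act g (act g' F)"
  by (simp add: act_def image_image matrix_vector_mul_assoc)

lemma act_one [simp]: "act (mat 1) F = F"
  by (simp add: act_def)

lemma matrix_inverse: "invertible g \<Longrightarrow> g ** matrix_inv g = mat 1"
  "invertible g \<Longrightarrow> matrix_inv g ** g = mat 1" for g :: "'n::finite cmat"
  unfolding invertible_def by (auto dest: matrix_inverse_unique)

lemma matrix_inv_mult:
  fixes g h :: "'n::finite cmat"
  assumes "invertible g" "invertible h"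
  shows "matrix_inv (g ** h) = matrix_inv h ** matrix_inv g"
proof (rule matrix_inverse_unique)
  have "g ** h ** (matrix_inv h ** matrix_inv g) = g ** (h ** matrix_inv h) ** matrix_inv g"
    by (simp only: matrix_mul_assoc)
  then show "g ** h ** (matrix_inv h ** matrix_inv g) = mat 1" by (simp add: matrix_inverse assms)
  have "matrix_inv h ** matrix_inv g ** (g ** h) = matrix_inv h ** (matrix_inv g ** g) ** h"
    by (simp only: matrix_mul_assoc)
  then show "matrix_inv h ** matrix_inv g ** (g ** h) = mat 1" by (simp add: matrix_inverse assms)
qed

lemma metric_group_mult:
  assumes "g \<in> metric_group W Q" "g' \<in> metric_group W Q"
  shows "g ** g' \<in> metric_group W Q"
  unfolding metric_group_def
proof (intro CollectI conjI allI ballI)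
  show "invertible (g ** g')" using assms by (simp add: metric_group_def invertible_mult)
  fix k
  have im: "(*v) g ` WC W k = WC W k" "(*v) g' ` WC W k = WC W k"
    using assms by (auto simp: metric_group_def)
  show "(*v) (g ** g') ` WC W k = WC W k"
    using im by (simp add: matrix_vector_mul_assoc[symmetric] image_image[symmetric, of "(*v) g" "(*v) g'"])
  fix u v assume uv: "u \<in> WC W k" "v \<in> WC W k"
  then have "g' *v u \<in> WC W k" "g' *v v \<in> WC W k" using im by blast+
  then show "QC Q k ((g ** g') *v u) (vcnj ((g ** g') *v v)) = QC Q k u (vcnj v)"
    using assms uv by (simp add: metric_group_def matrix_vector_mul_assoc[symmetric])
qed

lemma metric_group_inv:
  assumes g: "g \<in> metric_group W Q"
  shows "matrix_inv g \<in> metric_group W Q"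
proof -
  have inv: "invertible g" using g by (simp add: metric_group_def)
  have c: "matrix_inv g *v (g *v v) = v" "g *v (matrix_inv g *v v) = v" for v
    using matrix_inverse[OF inv] by (simp_all add: matrix_vector_mul_assoc)
  have im: "(*v) g ` WC W k = WC W k" for k
    using g by (auto simp: metric_group_def)
  have "(*v) (matrix_inv g) ` (*v) g ` WC W k = WC W k" for k
    by (simp add: image_image c)
  then have im': "(*v) (matrix_inv g) ` WC W k = WC W k" for k by (simp add: im)
  have "QC Q k (matrix_inv g *v u) (vcnj (matrix_inv g *v v)) = QC Q k u (vcnj v)"
    if "u \<in> WC W k" "v \<in> WC W k" for k u v
  proof -
    have "matrix_inv g *v u \<in> WC W k" "matrix_inv g *v v \<in> WC W k" using that im' by blast+
    then have "QC Q k (g *v (matrix_inv g *v u)) (vcnj (g *v (matrix_inv g *v v)))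
        = QC Q k (matrix_inv g *v u) (vcnj (matrix_inv g *v v))"
      using g by (simp add: metric_group_def)
    then show ?thesis by (simp add: c)
  qed
  moreover have "invertible (matrix_inv g)"
    using matrix_inverse[OF inv] by (auto simp: invertible_def)
  ultimately show ?thesis using im' by (simp add: metric_group_def)
qed

text \<open>Transport of frames with the levels \<open>l\<close> unchanged: all metric computations
  at a translate of \<open>F\<close> are thereby reduced to the frame at \<open>F\<close>.\<close>

lemma adapted_frame_act:
  assumes f: "adapted_frame W Q F l B" and g: "g \<in> metric_group W Q"
  shows "adapted_frame W Q (act g F) l (g ** B)"
proof -
  have inv: "invertible (g ** B)" using f g by (simp add: adapted_frame_def metric_group_def invertible_mult)
  have WB: "WC W k = (*v) B ` {x. \<forall>j. k < 2 * l j \<longrightarrow> x $ j = 0}" for k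
    using f unfolding adapted_frame_def by blast
  have FB: "F p = (*v) B ` {x. \<forall>j. l j < p \<longrightarrow> x $ j = 0}" for p
    using f unfolding adapted_frame_def by blast
  have im: "(*v) (g ** B) ` X = (*v) g ` (*v) B ` X" for X
    by (simp add: image_image matrix_vector_mul_assoc)
  have "WC W k = (*v) (g ** B) ` {x. \<forall>j. k < 2 * l j \<longrightarrow> x $ j = 0}" for k
    unfolding im WB[symmetric] using g by (simp add: metric_group_def)
  moreover have "act g F p = (*v) (g ** B) ` {x. \<forall>j. l j < p \<longrightarrow> x $ j = 0}" for p
    unfolding im FB[symmetric] by (simp add: act_def)
  moreover have "QC Q (2 * p) ((g ** B) *v x) (vcnj ((g ** B) *v y)) = (\<Sum>j | l j = p. x $ j * cnj (y $ j))"
    if "\<forall>j. p < l j \<longrightarrow> x $ j = 0" "\<forall>j. p < l j \<longrightarrow> y $ j = 0" for p x y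
  proof -
    have "B *v x \<in> WC W (2 * p)" "B *v y \<in> WC W (2 * p)" unfolding WB using that by auto
    then have "QC Q (2 * p) (g *v (B *v x)) (vcnj (g *v (B *v y))) = QC Q (2 * p) (B *v x) (vcnj (B *v y))"
      using g by (simp add: metric_group_def)
    also have "\<dots> = (\<Sum>j | l j = p. x $ j * cnj (y $ j))"
      using f that unfolding adapted_frame_def by blast
    finally show ?thesis by (simp add: matrix_vector_mul_assoc)
  qed
  ultimately show ?thesis using inv unfolding adapted_frame_def by blast
qed

context polarized
begin

text \<open>Real matrices commute with conjugation, so preserving the bilinear form implies
  preserving the hermitian one.\<close>

lemma GR_metric_group: "GR W Q \<subseteq> metric_group W Q"
proof
  fix g assume g: "g \<in> GR W Q"
  then obtain A where A: "g = map_matrix complex_of_real A" by (auto simp: GR_def)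
  have cnj: "vcnj (g *v v) = g *v vcnj v" for v
    by (simp add: A vcnj_def matrix_vector_mult_def vec_eq_iff)
  show "g \<in> metric_group W Q"
    using g WC_cnj by (simp add: metric_group_def cnj GR_def GC_def)
qed

definition unip :: "'n cmat set" where
  "unip = {n. n - mat 1 \<in> Wlow W 1}"

lemma mexp_unip: "u \<in> Wlow W 1 \<Longrightarrow> mexp u \<in> unip"
  by (simp add: unip_def mexp_eq_texp texp_Wlow)

lemma unip_mult: "n \<in> unip \<Longrightarrow> m \<in> unip \<Longrightarrow> n ** m \<in> unip"
proof -
  assume nm: "n \<in> unip" "m \<in> unip"
  have eq: "n ** m - mat 1 = (n - mat 1) ** (m - mat 1) + (n - mat 1) + (m - mat 1)"
    by (simp add: mm.diff_left mm.diff_right)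
  show ?thesis using nm unfolding unip_def mem_Collect_eq eq
    by (intro Wlow_add Wlow_mult1[of _ 1 _ 1]) auto
qed

text \<open>The geometric series in the nilpotent \<open>x = mat 1 - n\<close> is finite.\<close>

lemma unip_inv:
  assumes n: "n \<in> unip"
  shows "matrix_inv n \<in> unip" "invertible n"
proof -
  define x where "x = mat 1 - n"
  have x: "x \<in> Wlow W 1" using Wlow_minus[of "n - mat 1" 1] n by (simp add: unip_def x_def)
  obtain M where M: "N = Suc M" using N2 by (cases N) auto
  define m where "m = (\<Sum>k<N. matpow x k)"
  have "matpow x N = 0" using Wlow_big[OF _ matpow_Wlow[OF x]] by simp
  moreover have "m - x ** m = mat 1 - matpow x N"
    unfolding m_def mm.sum_right by (induction N) (auto simp: algebra_simps)
  ultimately have nm: "n ** m = mat 1" by (simp add: x_def mm.diff_left)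
  then have mn: "m ** n = mat 1" by (simp add: matrix_left_right_inverse)
  have "m - mat 1 = (\<Sum>k<M. matpow x (Suc k))"
    unfolding m_def M sum.lessThan_Suc_shift by simp
  also have "\<dots> \<in> Wlow W 1"
    using matpow_Wlow[OF x] Wlow_mono[of 1 "Suc k" for k]
    by (intro Wlow_sum) (simp del: matpow.simps, blast)
  finally have "m \<in> unip" by (simp add: unip_def)
  then show "matrix_inv n \<in> unip" using matrix_inverse_unique[OF nm mn] by simp
  show "invertible n" using nm mn by (auto simp: invertible_def)
qed

text \<open>\<open>n\<close> moves a vector of weight \<open>k\<close> by one of weight
  \<open>k - 1\<close>, which the form \<open>Q k\<close> annihilates in either argument. Hence both
  the bilinear and the hermitian form are unchanged.\<close>

lemma unipotent_preserves:
  assumes n0: "n \<in> unip"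
  shows "n \<in> metric_group W Q" "n \<in> GC W Q"
proof -
  have n: "n - mat 1 \<in> Wlow W 1" using n0 by (simp add: unip_def)
  define n' where "n' = matrix_inv n"
  have n': "n' - mat 1 \<in> Wlow W 1" "n ** n' = mat 1" "n' ** n = mat 1"
    using unip_inv[OF n0] by (auto simp: unip_def n'_def matrix_inverse)
  have mv: "m *v v - v \<in> WC W (k - 1)" if "m - mat 1 \<in> Wlow W 1" "v \<in> WC W k" for m v k
    using that by (auto simp: Wlow_def matrix_vector_mult_diff_rdistrib)
  have low: "v \<in> WC W k" if "v \<in> WC W (k - 1)" for v k
    using WC_mono[of "k - 1" k] that by auto
  have mem: "m *v v \<in> WC W k" if "m - mat 1 \<in> Wlow W 1" "v \<in> WC W k" for m v k
    using WC_closed(2)[OF low[OF mv[OF that]] that(2)] by simp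
  have inv: "invertible n" using n' by (auto simp: invertible_def)
  have im: "(*v) n ` WC W k = WC W k" for k
  proof (intro equalityI subsetI)
    fix v assume "v \<in> WC W k"
    moreover have "v = n *v (n' *v v)" using n' by (simp add: matrix_vector_mul_assoc)
    ultimately show "v \<in> (*v) n ` WC W k" using mem[OF n'(1)] by (intro image_eqI[of _ _ "n' *v v"])
  qed (use mem[OF n] in auto)
  have 1: "QC Q k (n *v u) w = QC Q k u w" if "u \<in> WC W k" "w \<in> WC W k" for u w k
    using QC_add[OF that(1) low[OF mv[OF n that(1)]] that(2)] QC_low(2)[OF that(2) mv[OF n that(1)]] by simp
  have 2: "QC Q k u (n *v w) = QC Q k u w" if "u \<in> WC W k" "w \<in> WC W k" for u w k
    using QC_add_right[OF that(2) low[OF mv[OF n that(2)]] that(1)] QC_low(1)[OF that(1) mv[OF n that(2)]] by simp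
  have 3: "QC Q k u (vcnj (n *v w)) = QC Q k u (vcnj w)" if "u \<in> WC W k" "w \<in> WC W k" for u w k
  proof -
    have "vcnj (n *v w) = vcnj w + vcnj (n *v w - w)"
      by (simp add: vcnj_def vec_eq_iff)
    moreover have "QC Q k u (vcnj w + vcnj (n *v w - w)) = QC Q k u (vcnj w) + QC Q k u (vcnj (n *v w - w))"
      using that low[OF mv[OF n that(2)]] by (intro QC_add_right WC_cnj) auto
    moreover have "QC Q k u (vcnj (n *v w - w)) = 0"
      using that mv[OF n that(2)] by (intro QC_low(1) WC_cnj) auto
    ultimately show ?thesis by simp
  qed
  show "n \<in> metric_group W Q" unfolding metric_group_def using inv im by (simp add: 1 3 WC_cnj mem[OF n])
  show "n \<in> GC W Q" unfolding GC_def using inv im by (simp add: 1 2 mem[OF n])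
qed

lemmas mexp_preserves = unipotent_preserves[OF mexp_unip]

lemma mexp_zero: "mexp 0 = (mat 1 :: 'n cmat)"
  by (simp add: mexp_eq_texp texp_0)

lemma Wlow_gC: "u \<in> Wlow W 1 \<Longrightarrow> u \<in> gC W Q"
  by (auto simp: gC_def lie_alg_def intro: mexp_preserves Wlow_scaleR)

end

locale tate_frame = framed W N Q F l B + polarized W N Q
  for W :: "'n::finite wfilt" and N Q F l B
begin

lemma matrix_inv_frame: "invertible g \<Longrightarrow> matrix_inv (g ** B) = C ** matrix_inv g"
  for g :: "'n cmat"
  by (rule matrix_inv_mult) (use BC in \<open>auto simp: invertible_def\<close>)

lemma hat_inv: "X = B ** hat X ** C"
proof -
  have "B ** hat X ** C = (B ** C) ** X ** (B ** C)" by (simp only: hat_def matrix_mul_assoc)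
  then show ?thesis by (simp add: BC)
qed

lemma hat_column: "(C *v (X *v (B *v axis j 1))) $ i = hat X $ i $ j"
proof -
  have "hat X *v axis j 1 = (\<Sum>i\<in>UNIV. if i = j then column j (hat X) else 0)"
    unfolding matrix_mult_sum by (intro sum.cong) (auto simp: axis_def)
  then show ?thesis unfolding hat_mv[of X] by (simp add: column_def)
qed

text \<open>Entry \<open>(i, j)\<close> maps level \<open>l j\<close> to level \<open>l i\<close>,
  so acting trivially on the graded pieces means being strictly block triangular. Lowering the
  weight by 1 already lowers the level, as all weights are even.\<close>

lemma hat_low: "X \<in> Wlow W 1 \<longleftrightarrow> (\<forall>i j. l j \<le> l i \<longrightarrow> hat X $ i $ j = 0)"
proof (intro iffI allI impI)
  fix i j assume X: "X \<in> Wlow W 1" and ij: "l j \<le> l i"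
  have "B *v axis j 1 \<in> WC W (2 * l j)" by (auto simp: WC_iff axis_def)
  then have "X *v (B *v axis j 1) \<in> WC W (2 * l j - 1)" using X by (auto simp: Wlow_def)
  then show "hat X $ i $ j = 0" using ij unfolding WC_iff hat_column by simp
next
  assume h: "\<forall>i j. l j \<le> l i \<longrightarrow> hat X $ i $ j = 0"
  have "X *v v \<in> WC W (k - 1)" if v: "v \<in> WC W k" for k v
    unfolding WC_iff hat_mv
  proof safe
    fix i assume i: "k - 1 < 2 * l i"
    show "(hat X *v (C *v v)) $ i = 0"
      unfolding mv_nth[of "hat X"]
    proof (intro sum.neutral ballI)
      fix j
      show "hat X $ i $ j * (C *v v) $ j = 0"
        using h v i unfolding WC_iff by (cases "l j \<le> l i") auto
    qed
  qed
  then show "X \<in> Wlow W 1" by (simp add: Wlow_def)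
qed

lemma tateI_WC: "v \<in> tateI p q \<Longrightarrow> 2 * p \<le> k \<Longrightarrow> v \<in> WC W k"
  by (auto simp: tateI_def WC_iff)

lemma Wlow_real_subspace: "subspace (Wlow W k)"
  by (auto simp: subspace_def intro: Wlow_add Wlow_scaleR)

text \<open>It suffices to look at the diagonal pieces, which span: there the first index drops by
  at least 1, and it alone determines the weight of a nonzero image.\<close>

lemma g_rs_Wlow: "X \<in> g_rs W Q F r s \<Longrightarrow> r < 0 \<Longrightarrow> X \<in> Wlow W 1"
proof -
  assume X: "X \<in> g_rs W Q F r s" and r: "r < 0"
  have "X *v v \<in> WC W (k - 1)" if "v \<in> WC W k" for k v
  proof -
    have "vec.subspace {v. X *v v \<in> WC W (k - 1)}"
      unfolding vec.subspace_def by (auto simp: matrix_vector_right_distrib vector_scalar_commute WC_closed)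
    moreover have "\<Union>{tateI a b | a b. a + b \<le> k} \<subseteq> {v. X *v v \<in> WC W (k - 1)}"
    proof clarify
      fix a b v assume ab: "a + b \<le> k" and v: "v \<in> tateI a b"
      show "X *v v \<in> WC W (k - 1)"
      proof (cases "a = b")
        case True
        have "X *v v \<in> tateI (a + r) (b + s)" using X v by (auto simp: g_rs_def deligne_eq)
        then show ?thesis using ab r True by (intro tateI_WC[of _ "a + r" "b + s"]) auto
      next
        case False
        then show ?thesis using v by (simp add: tateI_off WC_closed)
      qed
    qed
    ultimately show ?thesis
      using that unfolding WC_eq by (metis (no_types, lifting) mem_Collect_eq subsetD vec.span_minimal)
  qed
  then show ?thesis by (simp add: Wlow_def)
qed

text \<open>For the harder inclusion, a strictly block triangular matrix is the sum of its block
  diagonals \<open>Y r\<close>, and \<open>Y r\<close> has type \<open>(r, r)\<close> with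
  \<open>r < 0\<close>.\<close>

lemma qF_eq: "qF W Q F = Wlow W 1"
proof (rule equalityI)
  show "qF W Q F \<subseteq> Wlow W 1"
    unfolding qF_def by (rule span_minimal[OF _ Wlow_real_subspace]) (auto intro: g_rs_Wlow)
  show "Wlow W 1 \<subseteq> qF W Q F"
  proof
    fix X assume X: "X \<in> Wlow W 1"
    define Y where "Y r = B ** (\<chi> i j. if l i - l j = r then hat X $ i $ j else 0) ** C" for r
    have hatY: "hat (Y r) = (\<chi> i j. if l i - l j = r then hat X $ i $ j else 0)" for r
    proof -
      have "hat (Y r) = (C ** B) ** (\<chi> i j. if l i - l j = r then hat X $ i $ j else 0) ** (C ** B)"
        by (simp only: hat_def Y_def matrix_mul_assoc)
      then show ?thesis by (simp add: BC)
    qed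
    let ?R = "(\<lambda>(i, j). l i - l j) ` UNIV"
    have "hat X = (\<Sum>r\<in>?R. (\<chi> i j. if l i - l j = r then hat X $ i $ j else 0))"
      by (simp add: vec_eq_iff) (metis (mono_tags, lifting) UNIV_I image_eqI case_prod_conv)
    then have "X = B ** (\<Sum>r\<in>?R. (\<chi> i j. if l i - l j = r then hat X $ i $ j else 0)) ** C"
      using hat_inv by metis
    also have "\<dots> = (\<Sum>r\<in>?R. Y r)" by (simp add: mm.sum_left mm.sum_right Y_def)
    also have "\<dots> \<in> qF W Q F"
      unfolding qF_def
    proof (rule span_sum)
      fix r
      show "Y r \<in> span (\<Union>{g_rs W Q F r s | r s. r < 0})"
      proof (cases "r < 0")
        case True
        have "Y r \<in> Wlow W 1" using X unfolding hat_low hatY by simp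
        moreover have "Y r *v v \<in> tateI (p + r) (q + r)" if v: "v \<in> tateI p q" for p q v
          unfolding tateI_def mem_Collect_eq hat_mv[of "Y r"] hatY
        proof (intro allI impI)
          fix i assume i: "\<not> (l i = p + r \<and> l i = q + r)"
          show "((\<chi> i j. if l i - l j = r then hat X $ i $ j else 0) *v (C *v v)) $ i = 0"
            unfolding mv_nth[of "\<chi> i j. if l i - l j = r then hat X $ i $ j else 0"] vec_lambda_beta
          proof (intro sum.neutral ballI)
            fix j
            show "(if l i - l j = r then hat X $ i $ j else 0) * (C *v v) $ j = 0"
              using v i by (cases "l i - l j = r") (auto simp: tateI_def)
          qed
        qed
        ultimately have "Y r \<in> g_rs W Q F r r" by (auto simp: g_rs_def deligne_eq Wlow_gC)
        then show ?thesis using True by (intro span_base) blast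
      next
        case False
        have "hat (Y r) = 0" unfolding hatY using X False unfolding hat_low by (auto simp: vec_eq_iff)
        then have "Y r = 0" using hat_inv[of "Y r"] by simp
        then show ?thesis by (simp add: span_zero)
      qed
    qed
    finally show "X \<in> qF W Q F" .
  qed
qed

lemma hat_simps: "hat (X + Y) = hat X + hat Y" "hat (X - Y) = hat X - hat Y" "hat (r *\<^sub>R X) = r *\<^sub>R hat X"
  "hat 0 = 0" "hat (cscale c X) = cscale c (hat X)"
proof -
  show "hat (cscale c X) = cscale c (hat X)"
    unfolding hat_def by (simp only: cscale_mult(2)[of c C, symmetric] cscale_mult(1)[of c _ B, symmetric])
qed (simp_all add: hat_def mm.add_left mm.add_right mm.diff_left mm.diff_right mm.scaleR_left mm.scaleR_right)

lemma horizontal_hat: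
  assumes "X \<in> horizontal_space W Q F" and "l i \<noteq> l j - 1"
  shows "hat X $ i $ j = 0"
proof -
  have "horizontal_space W Q F \<subseteq> {X. hat X $ i $ j = 0}"
    unfolding horizontal_space_def
  proof (rule span_minimal)
    show "(\<Union>s. g_rs W Q F (- 1) s) \<subseteq> {X. hat X $ i $ j = 0}"
    proof safe
      fix s X assume X: "X \<in> g_rs W Q F (- 1) s"
      have "B *v axis j 1 \<in> tateI (l j) (l j)" by (auto simp: tateI_def axis_def)
      then have "X *v (B *v axis j 1) \<in> tateI (l j + - 1) (l j + s)" using X by (auto simp: g_rs_def deligne_eq)
      then show "hat X $ i $ j = 0" using assms(2) unfolding tateI_def hat_column[symmetric] by auto
    qed
    show "subspace {X. hat X $ i $ j = 0}" by (auto simp: subspace_def hat_simps)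
  qed
  then show ?thesis using assms(1) by blast
qed

text \<open>Entries of \<open>n - mat 1\<close> that do not lower the level vanish because of the
  weight filtration, those that lower it because \<open>n\<close> preserves
  \<open>F (l j)\<close>.\<close>

lemma unipotent_free: "n \<in> unip \<Longrightarrow> act n F = F \<Longrightarrow> n = mat 1"
proof -
  assume n0: "n \<in> unip" and F: "act n F = F"
  then have n: "n - mat 1 \<in> Wlow W 1" by (simp add: unip_def)
  have "hat (n - mat 1) $ i $ j = 0" for i j
  proof (cases "l j \<le> l i")
    case True
    then show ?thesis using n unfolding hat_low by blast
  next
    case False
    let ?v = "B *v axis j 1"
    have v: "?v \<in> F (l j)" by (auto simp: F_iff axis_def)
    have "n *v ?v \<in> act n F (l j)" using v by (auto simp: act_def)
    then have "n *v ?v \<in> F (l j)" unfolding F .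
    then have "(C *v (n *v ?v)) $ i = 0" "(C *v ?v) $ i = 0" using False v unfolding F_iff by auto
    then have "(C *v ((n - mat 1) *v ?v)) $ i = 0"
      by (simp add: matrix_vector_mult_diff_rdistrib matrix_vector_mult_diff_distrib)
    then show ?thesis by (simp only: hat_column)
  qed
  then have "hat (n - mat 1) = 0" by (simp add: vec_eq_iff)
  then have "n - mat 1 = 0" using hat_inv[of "n - mat 1"] by simp
  then show ?thesis by simp
qed

lemma unip_act_eq:
  assumes n: "n \<in> unip" and m: "m \<in> unip" and eq: "act n F = act m F"
  shows "n = m"
proof -
  note inv = matrix_inverse[OF unip_inv(2)[OF m]]
  have "act (matrix_inv m ** n) F = act (matrix_inv m ** m) F" by (simp add: act_mult eq)
  then have "act (matrix_inv m ** n) F = F" by (simp add: inv)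
  then have "matrix_inv m ** n = mat 1" using n m by (intro unipotent_free unip_mult unip_inv)
  then have "m ** (matrix_inv m ** n) = m" by simp
  then show ?thesis by (simp add: matrix_mul_assoc inv)
qed

lemma texp_line_derivative:
  "((\<lambda>t. texp N (u + t *\<^sub>R a)) has_vector_derivative Dtexp N u a) (at 0)"
  unfolding has_vector_derivative_def
  by (rule has_derivative_eq_rhs, rule texp_has_derivative, auto intro!: derivative_eq_intros)
    (simp add: Dtexp_linear)

text \<open>If \<open>w\<close> is another candidate, the one-parameter group of
  \<open>X - w\<close> is unipotent and fixes \<open>F\<close>, hence is trivial by freeness; its
  derivative at 0 is \<open>X - w\<close>.\<close>

lemma tangent_rep_eq:
  assumes X: "X \<in> Wlow W 1"
  shows "tangent_rep W Q F X = X"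
  unfolding tangent_rep_def qF_eq
proof (rule the_equality)
  have "mat 1 \<in> GC W Q" using mexp_preserves(2)[of 0] by (simp add: mexp_zero)
  then show "X \<in> Wlow W 1 \<and> X - X \<in> lie_alg {g \<in> GC W Q. act g F = F}"
    using X by (simp add: lie_alg_def mexp_zero)
next
  fix w assume w: "w \<in> Wlow W 1 \<and> X - w \<in> lie_alg {g \<in> GC W Q. act g F = F}"
  let ?Y = "X - w"
  have Y: "t *\<^sub>R ?Y \<in> Wlow W 1" for t using w X by (auto intro: Wlow_diff Wlow_scaleR)
  have "mexp (t *\<^sub>R ?Y) = mat 1" for t
    using unipotent_free[OF mexp_unip[OF Y[of t]]] w by (simp add: lie_alg_def)
  then have "texp N (0 + t *\<^sub>R ?Y) = mat 1" for t
    using mexp_eq_texp[OF Y[of t]] by simp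
  then have "((\<lambda>t. mat 1) has_vector_derivative Dtexp N 0 ?Y) (at 0)"
    using texp_line_derivative[of 0 ?Y] by simp
  then have "Dtexp N 0 ?Y = 0"
    using vector_derivative_unique_at has_vector_derivative_const by blast
  then show "w = X" by (simp add: Dtexp_0)
qed

end

section \<open>Flatness\<close>

interpretation frob: bounded_bilinear "frob :: 'n::finite cmat \<Rightarrow> 'n cmat \<Rightarrow> complex"
proof -
  have "bilinear (frob :: 'n cmat \<Rightarrow> 'n cmat \<Rightarrow> complex)"
    unfolding bilinear_def
    by (intro conjI allI linearI)
      (simp_all add: frob_def algebra_simps sum.distrib scaleR_sum_right)
  then show "bounded_bilinear (frob :: 'n cmat \<Rightarrow> 'n cmat \<Rightarrow> complex)"
    by (simp add: bilinear_conv_bounded_bilinear)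
qed

lemma frob_cscale: "frob (cscale c A) D = c * frob A D" "frob A (cscale c D) = cnj c * frob A D"
  by (simp_all add: frob_def sum_distrib_left mult_ac)

lemma frob_cnj: "cnj (frob A D) = frob D A"
  by (simp add: frob_def mult.commute)

lemma frob_self: "frob A A = of_real (\<Sum>i\<in>UNIV. \<Sum>j\<in>UNIV. (cmod (A $ i $ j))\<^sup>2)"
  by (simp only: frob_def of_real_sum complex_norm_square)

lemma frob_pos: "0 \<le> Re (frob A A)"
  by (simp add: frob_self sum_nonneg)

lemma frob_zero: "frob A A = 0 \<Longrightarrow> A = 0"
proof -
  assume "frob A A = 0"
  then have "(\<Sum>i\<in>UNIV. \<Sum>j\<in>UNIV. (cmod (A $ i $ j))\<^sup>2) = 0" unfolding frob_self of_real_eq_0_iff .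
  then have "\<forall>i. (\<Sum>j\<in>UNIV. (cmod (A $ i $ j))\<^sup>2) = 0"
    by (subst (asm) sum_nonneg_eq_0_iff) (auto intro: sum_nonneg)
  then have "A $ i $ j = 0" for i j
    by (subst (asm) sum_nonneg_eq_0_iff) auto
  then show "A = 0" by (simp add: vec_eq_iff)
qed

text \<open>\<open>LP N u\<close> is the differential of the exponential map at \<open>u\<close> in the left trivialization.\<close>

definition LP :: "nat \<Rightarrow> 'n::finite cmat \<Rightarrow> 'n cmat \<Rightarrow> 'n cmat" where
  "LP N u a = texp N (- u) ** Dtexp N u a"

text \<open>First and, in \<open>D2LP\<close>, second derivative of \<open>LP N u s\<close> with
  respect to \<open>u\<close>; the minus signs come from the inner derivative of
  \<open>- u\<close>.\<close>

definition DLP :: "nat \<Rightarrow> 'n::finite cmat \<Rightarrow> 'n cmat \<Rightarrow> 'n cmat \<Rightarrow> 'n cmat" where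
  "DLP N u b s = texp N (- u) ** D2texp N u b s - Dtexp N (- u) b ** Dtexp N u s"

definition D2LP :: "nat \<Rightarrow> 'n::finite cmat \<Rightarrow> 'n cmat \<Rightarrow> 'n cmat \<Rightarrow> 'n cmat \<Rightarrow> 'n cmat" where
  "D2LP N u a b s = texp N (- u) ** D3texp N u a b s - Dtexp N (- u) a ** D2texp N u b s
     - Dtexp N (- u) b ** D2texp N u a s + D2texp N (- u) a b ** Dtexp N u s"

text \<open>The outer terms are symmetric by the symmetry of the derivatives of \<open>texp\<close>,
  and the two middle terms are exchanged.\<close>

lemma D2LP_sym: "D2LP N u a b s = D2LP N u b a s"
  by (simp add: D2LP_def D2texp_sym[of N "- u" a b] D3texp_sym[of N u a b] algebra_simps)

lemma LP_linear: "LP N u (a + b) = LP N u a + LP N u b" "LP N u (cscale c a) = cscale c (LP N u a)"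
  "LP N u 0 = 0" "LP N u (- a) = - LP N u a"
  by (simp_all add: LP_def Dtexp_linear Dtexp_minus mm.add_right mm.minus_right cscale_mult(2))

lemma LP_diff: "LP N u (a - b) = LP N u a - LP N u b"
  using LP_linear(1)[of N u a "- b"] LP_linear(4)[of N u b] by simp

lemma DLP_cscale: "DLP N u (cscale c b) s = cscale c (DLP N u b s)"
proof -
  have "cscale c (x - y) = cscale c x - cscale c y" for x y :: "'a cmat"
    by (simp add: vec_eq_iff algebra_simps)
  then show ?thesis
    by (simp add: DLP_def D2texp_linear Dtexp_linear)
      (metis cscale_mult)
qed

lemma LP_has_derivative:
  assumes f: "(f has_derivative f') (at x within S)" and g: "(g has_derivative g') (at x within S)"
  shows "((\<lambda>x. LP N (f x) (g x)) has_derivative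
    (\<lambda>h. DLP N (f x) (f' h) (g x) + LP N (f x) (g' h))) (at x within S)"
  unfolding LP_def DLP_def
  by (rule has_derivative_eq_rhs[OF mm.FDERIV[OF texp_has_derivative[OF has_derivative_minus[OF f]]
          Dtexp_has_derivative[OF f g]]])
    (auto simp: Dtexp_minus mm.add_right mm.minus_left)

lemma DLP_has_derivative:
  fixes f :: "'a::real_normed_vector \<Rightarrow> 'n::finite cmat"
  assumes f: "(f has_derivative f') (at x within S)"
  shows "((\<lambda>x. DLP N (f x) b s) has_derivative (\<lambda>h. D2LP N (f x) (f' h) b s)) (at x within S)"
proof -
  have m: "D2texp N u (- a) c = - D2texp N u a c" for u a c :: "'n cmat"
  proof -
    have "cscale (- 1) X = - X" for X :: "'n cmat" by (simp add: vec_eq_iff)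
    then show ?thesis using D2texp_linear[of N u "-1" a c] by simp
  qed
  show ?thesis
    unfolding DLP_def D2LP_def
    by (rule has_derivative_eq_rhs[OF has_derivative_diff[OF
            mm.FDERIV[OF texp_has_derivative[OF has_derivative_minus[OF f]] D2texp_has_derivative[OF f]]
            mm.FDERIV[OF Dtexp_has_derivative[OF has_derivative_minus[OF f] has_derivative_const]
              Dtexp_has_derivative[OF f has_derivative_const]]]])
      (auto simp: Dtexp_minus m mm.minus_left fun_eq_iff)
qed

section \<open>Inverting the differential of the exponential map\<close>

context weight_filt
begin

text \<open>Both factors of \<open>LP\<close>, the exponential of \<open>- u\<close> and the
  differential of the exponential, are the identity up to a gain of one step in depth.\<close>

lemma LP_diff_Wlow:
  assumes u: "u \<in> Wlow W 1" and z: "z \<in> Wlow W j"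
  shows "z - LP N u z \<in> Wlow W (Suc j)"
proof -
  have eq: "z - LP N u z = - (Dtexp N u z - z) - (texp N (- u) - mat 1) ** Dtexp N u z"
    by (simp add: LP_def mm.diff_left)
  have 1: "(texp N (- u) - mat 1) ** Dtexp N u z \<in> Wlow W (Suc j)"
    using Wlow_mult[OF texp_Wlow[OF Wlow_minus[OF u]] Dtexp_Wlow[OF u z]] unfolding plus_1_eq_Suc .
  show ?thesis unfolding eq
    by (rule Wlow_diff[OF Wlow_minus[OF Dtexp_diff_Wlow[OF u z]] 1])
qed

lemma DLP_Wlow: "u \<in> Wlow W 1 \<Longrightarrow> b \<in> Wlow W 1 \<Longrightarrow> s \<in> Wlow W 1 \<Longrightarrow> DLP N u b s \<in> Wlow W 1"
proof -
  assume u: "u \<in> Wlow W 1" and b: "b \<in> Wlow W 1" and s: "s \<in> Wlow W 1"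
  have "texp N (- u) ** D2texp N u b s
      = (texp N (- u) - mat 1) ** D2texp N u b s + D2texp N u b s"
    by (simp add: mm.diff_left)
  also have "\<dots> \<in> Wlow W 1"
    by (intro Wlow_add Wlow_mult1[of _ 1 _ 1] texp_Wlow Wlow_minus D2texp_Wlow u b s) simp
  finally have "texp N (- u) ** D2texp N u b s \<in> Wlow W 1" .
  then show ?thesis unfolding DLP_def
    by (rule Wlow_diff) (intro Wlow_mult1[of _ 1 _ 1] Dtexp_Wlow Wlow_minus u b s, simp)
qed

text \<open>The inverse of \<open>LP N u\<close> by its Neumann series, which is finite since \<open>1 - LP N u\<close> is
  nilpotent on the unipotent radical.\<close>

definition LPinv :: "'n cmat \<Rightarrow> 'n cmat \<Rightarrow> 'n cmat" where
  "LPinv u y = (\<Sum>k<N. ((\<lambda>z. z - LP N u z) ^^ k) y)"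

lemma neumann_Wlow:
  assumes u: "u \<in> Wlow W 1" and y: "y \<in> Wlow W 1"
  shows "((\<lambda>z. z - LP N u z) ^^ k) y \<in> Wlow W (Suc k)"
proof (induction k)
  case 0
  then show ?case using y by (simp add: One_nat_def)
next
  case (Suc k)
  then show ?case using LP_diff_Wlow[OF u] by simp
qed

lemma LPinv:
  assumes u: "u \<in> Wlow W 1" and y: "y \<in> Wlow W 1"
  shows "LPinv u y \<in> Wlow W 1" "LP N u (LPinv u y) = y"
proof -
  let ?T = "\<lambda>z. z - LP N u z"
  have "(?T ^^ k) y \<in> Wlow W 1" for k
    using neumann_Wlow[OF u y, of k] Wlow_mono[of 1 "Suc k"] by auto
  then show "LPinv u y \<in> Wlow W 1"
    unfolding LPinv_def by (intro Wlow_sum)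
  \<comment> \<open>A telescoping sum, as \<open>LP N u\<close> is the identity minus
    \<open>?T\<close>; at \<open>M = N\<close> the remainder has depth beyond
    \<open>N\<close>.\<close>
  have "LP N u (\<Sum>k<M. (?T ^^ k) y) = y - (?T ^^ M) y" for M
    by (induction M) (auto simp: LP_linear)
  moreover have "(?T ^^ N) y = 0" using Wlow_big[OF _ neumann_Wlow[OF u y, of N]] by simp
  ultimately show "LP N u (LPinv u y) = y" by (simp add: LPinv_def)
qed

lemma LP_inj:
  assumes u: "u \<in> Wlow W 1" and x: "x \<in> Wlow W 1" and 0: "LP N u x = 0"
  shows "x = 0"
proof -
  \<comment> \<open>A vector in the kernel is fixed by the nilpotent operator, hence zero.\<close>
  have "((\<lambda>z. z - LP N u z) ^^ k) x = x" for k by (induction k) (auto simp: 0)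
  then show ?thesis using Wlow_big[OF _ neumann_Wlow[OF u x, of N]] by simp
qed

lemma LP_0: "LP N 0 a = a" for a :: "'n cmat"
  by (simp add: LP_def texp_0 Dtexp_0)

text \<open>The Neumann series only supplies differentiability. The value comes from differentiating
  the identity \<open>LP N u (LPinv u y) = y\<close>, evaluated at 0, where \<open>LP N 0\<close> is
  the identity.\<close>

lemma LPinv_derivative:
  assumes u: "u \<in> Wlow W 1" and a: "a \<in> Wlow W 1" and b: "b \<in> Wlow W 1" and s: "s \<in> Wlow W 1"
  shows "ddir (\<lambda>u. LPinv u (DLP N u b s)) 0 a = D2LP N 0 a b s - DLP N 0 a (DLP N 0 b s)"
proof -
  let ?y = "\<lambda>t. DLP N (t *\<^sub>R a) b s" and ?x = "\<lambda>t. LPinv (t *\<^sub>R a) (DLP N (t *\<^sub>R a) b s)"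
  have line: "((\<lambda>t::real. t *\<^sub>R a) has_derivative (\<lambda>t. t *\<^sub>R a)) (at 0)"
    by (auto intro!: derivative_eq_intros)
  have dy: "(?y has_derivative (\<lambda>h. D2LP N 0 (h *\<^sub>R a) b s)) (at 0)"
    using DLP_has_derivative[OF line, of N b s] by simp
  have ta: "t *\<^sub>R a \<in> Wlow W 1" for t :: real using a by (rule Wlow_scaleR)
  have "((\<lambda>t. ((\<lambda>z. z - LP N (t *\<^sub>R a) z) ^^ k) (?y t)) differentiable (at (0::real)))" for k
  proof (induction k)
    case 0
    then show ?case using dy by (auto simp: differentiable_def)
  next
    case (Suc k)
    then obtain z' where "((\<lambda>t. ((\<lambda>z. z - LP N (t *\<^sub>R a) z) ^^ k) (?y t)) has_derivative z') (at 0)"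
      by (auto simp: differentiable_def)
    from has_derivative_diff[OF this LP_has_derivative[OF line this]]
    show ?case by (auto simp: differentiable_def)
  qed
  then have "?x differentiable (at 0)"
    unfolding LPinv_def by (intro differentiable_sum) auto
  then obtain x' where x': "(?x has_vector_derivative x') (at 0)"
    using vector_derivative_works by blast
  have 0: "0 \<in> Wlow W 1" by simp
  have x0: "?x 0 = DLP N 0 b s"
    using LPinv(2)[OF 0 DLP_Wlow[OF 0 b s]] by (simp add: LP_0)
  have "((\<lambda>t. LP N (t *\<^sub>R a) (?x t)) has_derivative
      (\<lambda>h. DLP N 0 (h *\<^sub>R a) (?x 0) + h *\<^sub>R x')) (at 0)"
    using LP_has_derivative[OF line x'[unfolded has_vector_derivative_def], of N] by (simp add: LP_0)
  moreover have "LP N (t *\<^sub>R a) (?x t) = ?y t" for t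
    using LPinv(2)[OF ta DLP_Wlow[OF ta b s]] .
  ultimately have "(?y has_derivative (\<lambda>h. DLP N 0 (h *\<^sub>R a) (?x 0) + h *\<^sub>R x')) (at 0)" by simp
  then have "(\<lambda>h. DLP N 0 (h *\<^sub>R a) (?x 0) + h *\<^sub>R x') = (\<lambda>h. D2LP N 0 (h *\<^sub>R a) b s)"
    using dy has_derivative_unique by blast
  then have "DLP N 0 (1 *\<^sub>R a) (?x 0) + 1 *\<^sub>R x' = D2LP N 0 (1 *\<^sub>R a) b s" by (rule fun_cong)
  then have "x' = D2LP N 0 a b s - DLP N 0 a (DLP N 0 b s)" using x0 by (simp add: algebra_simps)
  then show ?thesis
    using vector_derivative_at[OF x'] by (simp add: ddir_def)
qed

end

section \<open>Chern connection and curvature in the exponential chart\<close>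

context tate_frame
begin

lemma frame_mexp: "u \<in> Wlow W 1 \<Longrightarrow> tate_frame W N Q (act (mexp u) F) l (mexp u ** B)"
  using adapted_frame_act[OF frame mexp_preserves(1)] by unfold_locales

lemma ddir_mexp:
  assumes u: "u \<in> Wlow W 1" and a: "a \<in> Wlow W 1"
  shows "ddir mexp u a = Dtexp N u a"
proof -
  have "mexp (u + t *\<^sub>R a) = texp N (u + t *\<^sub>R a)" for t
    using u a by (intro mexp_eq_texp Wlow_add Wlow_scaleR)
  then show ?thesis
    unfolding ddir_def using vector_derivative_at[OF texp_line_derivative[of u a]] by simp
qed

text \<open>The chart pushes \<open>c\<close> to the right-trivialized differential
  \<open>Dtexp N u c ** texp N (- u)\<close>. Reading it in the translated frame
  \<open>mexp u ** B\<close> conjugates by the exponential and yields the left trivialization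
  \<open>LP\<close> in the fixed frame.\<close>

lemma chart_metric_eq:
  assumes u: "u \<in> Wlow W 1" and a: "a \<in> Wlow W 1" and b: "b \<in> Wlow W 1"
  shows "chart_metric W Q F u a b = frob (hat (LP N u a)) (hat (LP N u b))"
proof -
  interpret fr: tate_frame W N Q "act (mexp u) F" l "mexp u ** B" by (rule frame_mexp[OF u])
  note m = mexp_eq_texp[OF u] texp_inverse[OF u] texp_minus[OF u]
  have push: "chart_push W Q F u c = Dtexp N u c ** texp N (- u)" if c: "c \<in> Wlow W 1" for c
  proof -
    have "Dtexp N u c ** texp N (- u) = Dtexp N u c ** (texp N (- u) - mat 1) + Dtexp N u c"
      by (simp add: mm.diff_right)
    also have "\<dots> \<in> Wlow W 1"
      by (intro Wlow_add Wlow_mult1[of _ 1 _ 1] texp_Wlow Dtexp_Wlow Wlow_minus u c) simp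
    finally show ?thesis
      unfolding chart_push_def ddir_mexp[OF u c] using fr.tangent_rep_eq by (simp add: m)
  qed
  have inv: "matrix_inv (mexp u ** B) = C ** texp N (- u)"
    by (simp add: matrix_inv_frame m)
  have "fr.hat (Dtexp N u c ** texp N (- u)) = hat (LP N u c)" for c
  proof -
    have "fr.hat (Dtexp N u c ** texp N (- u))
        = C ** (texp N (- u) ** Dtexp N u c) ** (texp N (- u) ** texp N u) ** B"
      unfolding fr.hat_def inv by (simp only: m(1) matrix_mul_assoc)
    then show ?thesis by (simp add: hat_def LP_def m)
  qed
  then show ?thesis
    unfolding chart_metric_def push[OF a] push[OF b] fr.hodge_metric_End_eq by simp
qed

lemma hat_bounded_linear: "bounded_linear hat"
  by (intro linear_conv_bounded_linear[THEN iffD1] linearI) (simp_all add: hat_simps)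

text \<open>\<open>DLP\<close> is complex linear in its direction, so in the \<open>(1,0)\<close>
  part of the derivative the contribution of the conjugate-linear argument cancels.\<close>

lemma del_chart_metric:
  assumes u: "u \<in> Wlow W 1" and a: "a \<in> Wlow W 1" and s: "s \<in> Wlow W 1" and t: "t \<in> Wlow W 1"
  shows "del_dir (\<lambda>u. chart_metric W Q F u s t) u a = frob (hat (DLP N u a s)) (hat (LP N u t))"
proof -
  have dd: "ddir (\<lambda>u. chart_metric W Q F u s t) u a
      = frob (hat (LP N u s)) (hat (DLP N u a t)) + frob (hat (DLP N u a s)) (hat (LP N u t))"
    if a: "a \<in> Wlow W 1" for a
  proof -
    have line: "((\<lambda>r::real. u + r *\<^sub>R a) has_derivative (\<lambda>r. r *\<^sub>R a)) (at 0)"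
      by (auto intro!: derivative_eq_intros)
    have LPd: "((\<lambda>r. LP N (u + r *\<^sub>R a) c) has_derivative (\<lambda>h. h *\<^sub>R DLP N u a c)) (at 0)" for c
    proof -
      have "DLP N u (h *\<^sub>R a) c = h *\<^sub>R DLP N u a c" for h
      proof -
        have "h *\<^sub>R A = cscale (of_real h) A" for A :: "'n cmat"
          by (simp add: vec_eq_iff scaleR_conv_of_real[symmetric])
        then show ?thesis by (simp add: DLP_cscale)
      qed
      then show ?thesis
        using LP_has_derivative[OF line has_derivative_const[of c], of N] by (simp add: LP_linear)
    qed
    have "((\<lambda>r. frob (hat (LP N (u + r *\<^sub>R a) s)) (hat (LP N (u + r *\<^sub>R a) t))) has_vector_derivative
       frob (hat (LP N u s)) (hat (DLP N u a t)) + frob (hat (DLP N u a s)) (hat (LP N u t))) (at 0)"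
      unfolding has_vector_derivative_def
      by (rule has_derivative_eq_rhs[OF frob.FDERIV[OF
              bounded_linear.has_derivative[OF hat_bounded_linear LPd]
              bounded_linear.has_derivative[OF hat_bounded_linear LPd]]])
        (auto simp: hat_simps frob.scaleR_left frob.scaleR_right scaleR_add_right)
    moreover have "chart_metric W Q F (u + r *\<^sub>R a) s t
        = frob (hat (LP N (u + r *\<^sub>R a) s)) (hat (LP N (u + r *\<^sub>R a) t))" for r
      using a u s t by (intro chart_metric_eq Wlow_add Wlow_scaleR)
    ultimately show ?thesis by (simp add: ddir_def vector_derivative_at)
  qed
  show ?thesis
    unfolding del_dir_def dd[OF a] dd[OF Wlow_cscale[OF a]]
    by (simp add: DLP_cscale hat_simps frob_cscale algebra_simps)
qed

text \<open>The frame change \<open>LP\<close> makes the metric constant, so the connection form is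
  \<open>P^-1 dP\<close>.\<close>

lemma chern_form_eq:
  assumes u: "u \<in> Wlow W 1" and b: "b \<in> Wlow W 1" and s: "s \<in> Wlow W 1"
  shows "chern_form (qF W Q F) (chart_metric W Q F) u b s = LPinv u (DLP N u b s)"
  unfolding chern_form_def qF_eq
proof (rule the_equality)
  note inv = LPinv[OF u DLP_Wlow[OF u b s]]
  show "LPinv u (DLP N u b s) \<in> Wlow W 1 \<and> (\<forall>t\<in>Wlow W 1. chart_metric W Q F u (LPinv u (DLP N u b s)) t
      = del_dir (\<lambda>u. chart_metric W Q F u s t) u b)"
    using inv u b s by (simp add: del_chart_metric chart_metric_eq)
  fix x assume x: "x \<in> Wlow W 1 \<and> (\<forall>t\<in>Wlow W 1. chart_metric W Q F u x t
      = del_dir (\<lambda>u. chart_metric W Q F u s t) u b)"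
  let ?d = "x - LPinv u (DLP N u b s)"
  have d: "?d \<in> Wlow W 1" using x inv by (intro Wlow_diff) auto
  \<comment> \<open>Testing two solutions against their difference \<open>?d\<close>, so that
    positivity of the Frobenius product applies.\<close>
  have "frob (hat (LP N u x)) (hat (LP N u ?d)) = frob (hat (DLP N u b s)) (hat (LP N u ?d))"
  proof -
    have "x \<in> Wlow W 1" using x by blast
    moreover have "chart_metric W Q F u x ?d = del_dir (\<lambda>u. chart_metric W Q F u s ?d) u b"
      using x d by blast
    ultimately show ?thesis using d u b s by (simp only: del_chart_metric chart_metric_eq)
  qed
  then have "frob (hat (LP N u ?d)) (hat (LP N u ?d)) = 0"
    by (simp add: LP_diff inv hat_simps frob.diff_left)
  then have "hat (LP N u ?d) = 0" by (rule frob_zero)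
  then have "LP N u ?d = 0" using hat_inv[of "LP N u ?d"] by simp
  then have "?d = 0" by (rule LP_inj[OF u d])
  then show "x = LPinv u (DLP N u b s)" by simp
qed

text \<open>In \<open>dA\<close> the second derivatives of \<open>LP\<close> cancel by symmetry, and
  the remaining products of first derivatives are exactly cancelled by the quadratic term.\<close>

theorem curvature_zero:
  assumes a: "a \<in> Wlow W 1" and b: "b \<in> Wlow W 1" and s: "s \<in> Wlow W 1"
  shows "hodge_curvature W Q F a b s = 0"
proof -
  let ?A = "chern_form (qF W Q F) (chart_metric W Q F)"
  have 0: "0 \<in> Wlow W 1" by simp
  have d: "ddir (\<lambda>u. ?A u b s) 0 a = D2LP N 0 a b s - DLP N 0 a (DLP N 0 b s)"
    if a: "a \<in> Wlow W 1" and b: "b \<in> Wlow W 1" for a b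
  proof -
    have "?A (0 + t *\<^sub>R a) b s = LPinv (0 + t *\<^sub>R a) (DLP N (0 + t *\<^sub>R a) b s)" for t
      using a b s by (intro chern_form_eq Wlow_add Wlow_scaleR 0)
    then have "ddir (\<lambda>u. ?A u b s) 0 a = ddir (\<lambda>u. LPinv u (DLP N u b s)) 0 a"
      by (simp add: ddir_def)
    then show ?thesis using LPinv_derivative[OF 0 a b s] by simp
  qed
  have A0: "?A 0 a s = DLP N 0 a s" if "a \<in> Wlow W 1" "s \<in> Wlow W 1" for a s
    using chern_form_eq[OF 0 that] LPinv(2)[OF 0 DLP_Wlow[OF 0 that]] by (simp add: LP_0)
  have D: "DLP N 0 a s \<in> Wlow W 1" "DLP N 0 b s \<in> Wlow W 1" using DLP_Wlow 0 a b s by auto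
  show ?thesis
    unfolding hodge_curvature_def chern_curvature_def Let_def d[OF a b] d[OF b a]
      A0[OF a s] A0[OF b s] A0[OF a D(2)] A0[OF b D(1)]
    by (simp add: D2LP_sym[of N 0 a b s])
qed

end

section \<open>Holomorphic functions of several variables\<close>

lemma norm_smult: "norm (c *s v) = cmod c * norm v" for v :: "complex ^ 'm::finite"
  by (simp add: norm_vec_def norm_mult L2_set_right_distrib)

lemma smult_bounded_linear: "bounded_linear (\<lambda>c. c *s v)" for v :: "complex ^ 'm::finite"
  by (rule bounded_linear_intro[of _ "norm v"]) (auto simp: norm_smult vec_eq_iff algebra_simps)

lemma holo_onD:
  assumes "holo_on A f" "z \<in> A"
  shows "(f has_derivative frechet_derivative f (at z)) (at z)"
    and "frechet_derivative f (at z) (c *s v) = c * frechet_derivative f (at z) v"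
proof -
  obtain f' where f': "(f has_derivative f') (at z)" "\<And>c v. f' (c *s v) = c * f' v"
    using assms unfolding holo_on_def by blast
  have "frechet_derivative f (at z) = f'" using frechet_derivative_at[OF f'(1)] by simp
  then show "(f has_derivative frechet_derivative f (at z)) (at z)"
    "frechet_derivative f (at z) (c *s v) = c * frechet_derivative f (at z) v"
    using f' by auto
qed

lemma holo_on_continuous: "holo_on A f \<Longrightarrow> continuous_on A f"
  by (meson holo_onD(1) has_derivative_continuous continuous_at_imp_continuous_on)

lemma holo_on_line:
  assumes "holo_on A f" "z + \<zeta> *s v \<in> A"
  shows "((\<lambda>\<zeta>. f (z + \<zeta> *s v)) has_field_derivative frechet_derivative f (at (z + \<zeta> *s v)) v) (at \<zeta>)"
proof -
  have "((\<lambda>\<zeta>. z + \<zeta> *s v) has_derivative (\<lambda>h. h *s v)) (at \<zeta>)"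
    using bounded_linear.has_derivative[OF smult_bounded_linear has_derivative_ident]
    by (auto intro!: derivative_eq_intros)
  from has_derivative_compose[OF this holo_onD(1)[OF assms]]
  show ?thesis
    by (simp add: has_field_derivative_def holo_onD(2)[OF assms] mult.commute[of _ "frechet_derivative f _ v"])
qed

text \<open>The circle about 0, parametrized by the unit interval in the same way as
  \<open>circlepath\<close>.\<close>

definition circ :: "real \<Rightarrow> real \<Rightarrow> complex" where
  "circ r t = of_real r * exp (2 * of_real pi * \<i> * of_real t)"

lemma circ_norm: "0 \<le> r \<Longrightarrow> cmod (circ r t) = r"
  by (simp add: circ_def norm_mult norm_exp_eq_Re)

lemma circ_nz: "0 < r \<Longrightarrow> circ r t \<noteq> 0"
  by (simp add: circ_def)

lemma continuous_on_circ [continuous_intros]: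
  "continuous_on S g \<Longrightarrow> continuous_on S (\<lambda>x. circ r (g x))"
  unfolding circ_def by (intro continuous_intros)

text \<open>Cauchy's formula for the derivative at 0 of the restriction of \<open>f\<close> to a
  complex line; the differential of the circle cancels one of the two factors in the denominator.
  The right side involves values of \<open>f\<close> only, so it can be differentiated in
  \<open>z\<close>.\<close>

lemma Cauchy_directional:
  assumes f: "holo_on A f" and r: "0 < r" and A: "\<And>\<zeta>. cmod \<zeta> \<le> r \<Longrightarrow> z + \<zeta> *s v \<in> A"
  shows "frechet_derivative f (at z) v = integral (cbox 0 1) (\<lambda>t. f (z + circ r t *s v) / circ r t)"
proof -
  let ?g = "\<lambda>\<zeta>. f (z + \<zeta> *s v)"
  have d: "(?g has_field_derivative frechet_derivative f (at (z + \<zeta> *s v)) v) (at \<zeta>)" if "cmod \<zeta> \<le> r" for \<zeta>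
    using f A[OF that] by (rule holo_on_line)
  have "continuous_on (cball 0 r) ?g"
    using d by (intro continuous_at_imp_continuous_on ballI) (auto intro!: DERIV_isCont)
  moreover have "?g holomorphic_on ball 0 r"
  proof -
    have "\<exists>f'. (?g has_field_derivative f') (at \<zeta>)" if "\<zeta> \<in> ball 0 r" for \<zeta>
      using d[of \<zeta>] that by (intro exI) simp
    then show ?thesis by (simp add: holomorphic_on_open)
  qed
  ultimately have "(?g has_field_derivative (1 / (2 * of_real pi * \<i>) *
      contour_integral (circlepath 0 r) (\<lambda>u. ?g u / (u - 0)\<^sup>2))) (at 0)"
    using r by (intro Cauchy_derivative_integral_circlepath) auto
  then have "frechet_derivative f (at z) v
      = 1 / (2 * of_real pi * \<i>) * contour_integral (circlepath 0 r) (\<lambda>u. ?g u / u\<^sup>2)"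
    using d[of 0] r DERIV_unique by fastforce
  also have "\<dots> = integral {0..1} (\<lambda>t. 1 / (2 * of_real pi * \<i>) *
      (?g (circlepath 0 r t) / (circlepath 0 r t)\<^sup>2 * vector_derivative (circlepath 0 r) (at t)))"
    unfolding contour_integral_integral by (rule integral_mult_right[symmetric])
  also have "\<dots> = integral {0..1} (\<lambda>t. ?g (circ r t) / circ r t)"
  proof (rule integral_cong)
    fix t :: real
    have 1: "circlepath 0 r t = circ r t" by (simp add: circlepath circ_def)
    have 2: "vector_derivative (circlepath 0 r) (at t) = 2 * of_real pi * \<i> * circ r t"
      by (simp add: vector_derivative_circlepath circ_def)
    show "1 / (2 * of_real pi * \<i>) *
      (?g (circlepath 0 r t) / (circlepath 0 r t)\<^sup>2 * vector_derivative (circlepath 0 r) (at t)) = ?g (circ r t) / circ r t"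
      unfolding 1 2 using circ_nz[OF r, of t] by (simp add: field_simps power2_eq_square)
  qed
  finally show ?thesis by (simp add: cbox_interval)
qed

lemma holo_on_radius:
  fixes v :: "complex ^ 'm::finite"
  assumes "open A" "z0 \<in> A"
  obtains d r where "0 < d" "0 < r" "\<And>z \<zeta>. z \<in> ball z0 d \<Longrightarrow> cmod \<zeta> \<le> r \<Longrightarrow> z + \<zeta> *s v \<in> A"
proof -
  obtain e where e: "0 < e" "ball z0 e \<subseteq> A" using assms open_contains_ball by blast
  \<comment> \<open>Half of \<open>e\<close> is left for the motion of \<open>z\<close>, half for
    \<open>\<zeta> *s v\<close>; the summand 1 covers \<open>v = 0\<close>.\<close>
  define r where "r = e / (2 * (1 + norm v))"
  have v: "0 < 2 * (1 + norm v)" by (simp add: add_pos_nonneg)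
  have r: "0 < r" "r * norm v \<le> e / 2"
  proof -
    show "0 < r" using e v by (simp add: r_def)
    then have "r * norm v \<le> r * (1 + norm v)" by (simp add: algebra_simps)
    also have "\<dots> = e / 2" using v by (simp add: r_def field_simps)
    finally show "r * norm v \<le> e / 2" .
  qed
  have "z + \<zeta> *s v \<in> A" if "z \<in> ball z0 (e / 2)" "cmod \<zeta> \<le> r" for z \<zeta>
  proof -
    have "norm (\<zeta> *s v) \<le> r * norm v" using that by (simp add: norm_smult mult_right_mono)
    then have "dist z0 (z + \<zeta> *s v) < e"
      using that r norm_triangle_ineq[of "z - z0" "\<zeta> *s v"]
      by (simp add: dist_norm norm_minus_commute algebra_simps)
    then show ?thesis using e by auto
  qed
  then show thesis using that[of "e / 2" r] e r by simp
qed

text \<open>The integrand in \<open>Cauchy_directional\<close> is jointly continuous in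
  \<open>z\<close> and \<open>t\<close>. This continuity is what differentiation under the integral
  sign requires next.\<close>

lemma holo_on_derivative_continuous:
  assumes A: "open A" and f: "holo_on A f"
  shows "continuous_on A (\<lambda>z. frechet_derivative f (at z) v)"
proof (intro continuous_at_imp_continuous_on ballI)
  fix z0 assume "z0 \<in> A"
  then obtain d r where d: "0 < d" "0 < r" and dr: "\<And>z \<zeta>. z \<in> ball z0 d \<Longrightarrow> cmod \<zeta> \<le> r \<Longrightarrow> z + \<zeta> *s v \<in> A"
    using holo_on_radius[OF A] by metis
  have "continuous_on (ball z0 d \<times> cbox (0::real) 1) (\<lambda>(z, t). f (z + circ r t *s v) / circ r t)"
    unfolding case_prod_unfold
    by (intro continuous_intros continuous_on_compose2[OF holo_on_continuous[OF f]]
        bounded_linear.continuous_on[OF smult_bounded_linear])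
      (use d dr in \<open>auto simp: circ_nz circ_norm\<close>)
  then have "continuous_on (ball z0 d) (\<lambda>z. integral (cbox 0 1) (\<lambda>t. f (z + circ r t *s v) / circ r t))"
    by (rule integral_continuous_on_param)
  then have "continuous_on (ball z0 d) (\<lambda>z. frechet_derivative f (at z) v)"
    by (rule continuous_on_eq) (use Cauchy_directional[OF f d(2) dr] in simp)
  then show "isCont (\<lambda>z. frechet_derivative f (at z) v) z0"
    using d by (simp add: continuous_on_eq_continuous_at)
qed

lemma holo_on_second_derivative:
  assumes A: "open A" and f: "holo_on A f" and z0A: "z0 \<in> A"
  obtains r where "0 < r" "((\<lambda>z. frechet_derivative f (at z) v) has_derivative
    (\<lambda>h. integral (cbox 0 1) (\<lambda>t. frechet_derivative f (at (z0 + circ r t *s v)) h / circ r t))) (at z0)"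
    "\<And>\<zeta>. cmod \<zeta> \<le> r \<Longrightarrow> z0 + \<zeta> *s v \<in> A"
proof -
  obtain d r where d: "0 < d" "0 < r" and dr: "\<And>z \<zeta>. z \<in> ball z0 d \<Longrightarrow> cmod \<zeta> \<le> r \<Longrightarrow> z + \<zeta> *s v \<in> A"
    using holo_on_radius[OF A z0A] by metis
  let ?U = "ball z0 d"
  have mem: "z + circ r t *s v \<in> A" if "z \<in> ?U" for z t
    using dr that d by (simp add: circ_norm)
  \<comment> \<open>The Leibniz rule takes the derivative of the integrand as a continuous map into
    bounded linear operators.\<close>
  define fx where "fx z t = Blinfun (\<lambda>h. frechet_derivative f (at (z + circ r t *s v)) h / circ r t)" for z t
  have bl: "bounded_linear (\<lambda>h. frechet_derivative f (at (z + circ r t *s v)) h / circ r t)" if "z \<in> ?U" for z t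
    using has_derivative_bounded_linear[OF holo_onD(1)[OF f mem[OF that]]]
    by (intro bounded_linear_divide[THEN bounded_linear_compose])
  have fx: "blinfun_apply (fx z t) = (\<lambda>h. frechet_derivative f (at (z + circ r t *s v)) h / circ r t)" if "z \<in> ?U" for z t
    unfolding fx_def by (rule bounded_linear_Blinfun_apply[OF bl[OF that]])
  have cont_f: "continuous_on (?U \<times> cbox (0::real) 1) (\<lambda>(z, t). f (z + circ r t *s v) / circ r t)"
    unfolding case_prod_unfold
    by (intro continuous_intros continuous_on_compose2[OF holo_on_continuous[OF f]]
        bounded_linear.continuous_on[OF smult_bounded_linear])
      (use d mem in \<open>auto simp: circ_nz\<close>)
  have cont_fx: "continuous_on (?U \<times> cbox (0::real) 1) (\<lambda>(z, t). fx z t)"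
  proof (rule continuous_on_blinfun_componentwise)
    fix i :: "complex ^ 'a" assume "i \<in> Basis"
    have "continuous_on (?U \<times> cbox (0::real) 1)
       (\<lambda>(z, t). frechet_derivative f (at (z + circ r t *s v)) i / circ r t)"
      unfolding case_prod_unfold
      by (intro continuous_intros continuous_on_compose2[OF holo_on_derivative_continuous[OF A f]]
          bounded_linear.continuous_on[OF smult_bounded_linear])
        (use d mem in \<open>auto simp: circ_nz\<close>)
    then show "continuous_on (?U \<times> cbox (0::real) 1) (\<lambda>x. blinfun_apply (case x of (z, t) \<Rightarrow> fx z t) i)"
      by (rule continuous_on_eq) (auto simp: fx)
  qed
  have z0: "z0 \<in> ?U" using d by simp
  have cont_pair: "continuous_on (cbox (0::real) 1) (\<lambda>t. (z, t))" for z :: "complex ^ 'a"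
    by (intro continuous_on_Pair continuous_on_const continuous_on_id)
  have "((\<lambda>z. integral (cbox (0::real) 1) (\<lambda>t. f (z + circ r t *s v) / circ r t)) has_derivative
      integral (cbox 0 1) (fx z0)) (at z0 within ?U)"
  proof (rule leibniz_rule[OF _ _ cont_fx z0 convex_ball])
    fix z :: "complex ^ 'a" and t :: real assume z: "z \<in> ?U"
    have "((\<lambda>z. z + circ r t *s v) has_derivative (\<lambda>h. h)) (at z)"
      by (auto intro!: derivative_eq_intros)
    from has_derivative_compose[OF this holo_onD(1)[OF f mem[OF z]]]
    show "((\<lambda>z. f (z + circ r t *s v) / circ r t) has_derivative blinfun_apply (fx z t)) (at z within ?U)"
      unfolding fx[OF z] by (rule has_derivative_at_withinI[OF bounded_linear.has_derivative[OF bounded_linear_divide]])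
  next
    fix z assume z: "z \<in> ?U"
    have "continuous_on (cbox (0::real) 1) (\<lambda>t. f (z + circ r t *s v) / circ r t)"
      using continuous_on_compose2[OF cont_f cont_pair[of z]] z by (auto simp: image_subset_iff)
    then show "(\<lambda>t. f (z + circ r t *s v) / circ r t) integrable_on cbox 0 1"
      by (rule integrable_continuous)
  qed
  then have "((\<lambda>z. integral (cbox (0::real) 1) (\<lambda>t. f (z + circ r t *s v) / circ r t)) has_derivative
      integral (cbox 0 1) (fx z0)) (at z0)"
    unfolding at_within_open[OF z0 open_ball] .
  then have D: "((\<lambda>z. frechet_derivative f (at z) v) has_derivative integral (cbox 0 1) (fx z0)) (at z0)"
    by (rule has_derivative_transform_within_open[OF _ open_ball z0])
      (use Cauchy_directional[OF f d(2) dr] in simp)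
  have int: "fx z0 integrable_on cbox 0 1"
    using continuous_on_compose2[OF cont_fx cont_pair[of z0]] z0
    by (intro integrable_continuous) (auto simp: image_subset_iff)
  have "blinfun_apply (integral (cbox 0 1) (fx z0)) h
      = integral (cbox 0 1) (\<lambda>t. frechet_derivative f (at (z0 + circ r t *s v)) h / circ r t)" for h
    unfolding blinfun_apply_integral[OF int] fx[OF z0] ..
  then have "blinfun_apply (integral (cbox 0 1) (fx z0))
      = (\<lambda>h. integral (cbox 0 1) (\<lambda>t. frechet_derivative f (at (z0 + circ r t *s v)) h / circ r t))" by blast
  then have D': "((\<lambda>z. frechet_derivative f (at z) v) has_derivative
      (\<lambda>h. integral (cbox 0 1) (\<lambda>t. frechet_derivative f (at (z0 + circ r t *s v)) h / circ r t))) (at z0)"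
    using D by simp
  show ?thesis by (rule that[OF d(2) D' dr[OF z0]])
qed

lemma holo_on_derivative:
  assumes A: "open A" and f: "holo_on A f"
  shows "holo_on A (\<lambda>z. frechet_derivative f (at z) v)"
  unfolding holo_on_def
proof
  fix z0 assume z0: "z0 \<in> A"
  obtain r where r: "0 < r" and D: "((\<lambda>z. frechet_derivative f (at z) v) has_derivative
    (\<lambda>h. integral (cbox 0 1) (\<lambda>t. frechet_derivative f (at (z0 + circ r t *s v)) h / circ r t))) (at z0)"
    and mem: "\<And>\<zeta>. cmod \<zeta> \<le> r \<Longrightarrow> z0 + \<zeta> *s v \<in> A"
    using holo_on_second_derivative[OF A f z0, of v] by blast
  have lin: "frechet_derivative f (at (z0 + circ r t *s v)) (c *s h) / circ r t
      = c * (frechet_derivative f (at (z0 + circ r t *s v)) h / circ r t)" for c h t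
    using holo_onD(2)[OF f mem[of "circ r t"]] r by (simp add: circ_norm)
  show "\<exists>f'. ((\<lambda>z. frechet_derivative f (at z) v) has_derivative f') (at z0) \<and> (\<forall>c v. f' (c *s v) = c * f' v)"
    using D by (intro exI[of _ "\<lambda>h. integral (cbox 0 1) (\<lambda>t. frechet_derivative f (at (z0 + circ r t *s v)) h / circ r t)"])
      (simp only: lin integral_mult_right simp_thms)
qed

text \<open>Differentiating the Cauchy integral for direction \<open>v\<close> along
  \<open>w\<close> gives the Cauchy integral in direction \<open>v\<close> of the holomorphic
  function \<open>frechet_derivative f (at z) w\<close>.\<close>

lemma holo_on_derivative_sym:
  assumes A: "open A" and f: "holo_on A f" and z: "z \<in> A"
  shows "frechet_derivative (\<lambda>z. frechet_derivative f (at z) v) (at z) w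
       = frechet_derivative (\<lambda>z. frechet_derivative f (at z) w) (at z) v"
proof -
  obtain r where r: "0 < r" and D: "((\<lambda>z. frechet_derivative f (at z) v) has_derivative
    (\<lambda>h. integral (cbox 0 1) (\<lambda>t. frechet_derivative f (at (z + circ r t *s v)) h / circ r t))) (at z)"
    and mem: "\<And>\<zeta>. cmod \<zeta> \<le> r \<Longrightarrow> z + \<zeta> *s v \<in> A"
    using holo_on_second_derivative[OF A f z, of v] by blast
  have "frechet_derivative (\<lambda>z. frechet_derivative f (at z) v) (at z) w
      = integral (cbox 0 1) (\<lambda>t. frechet_derivative f (at (z + circ r t *s v)) w / circ r t)"
    unfolding frechet_derivative_at[OF D, symmetric] ..
  also have "\<dots> = frechet_derivative (\<lambda>z. frechet_derivative f (at z) w) (at z) v"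
    using Cauchy_directional[OF holo_on_derivative[OF A f] r mem, of w] by simp
  finally show ?thesis .
qed

text \<open>The form is \<open>\<i>/2\<close> times a sum of terms \<open>\<partial>k \<and> cnj (\<partial>k)\<close>.\<close>

lemma closed_sum_of_squares:
  fixes k :: "'i \<Rightarrow> complex ^ 'm::finite \<Rightarrow> complex"
  assumes A: "open A" and I: "finite I" and k: "\<And>i. i \<in> I \<Longrightarrow> holo_on A (k i)"
    and w: "\<And>z v w. z \<in> A \<Longrightarrow> \<omega> z v w = - Im (\<Sum>i\<in>I. frechet_derivative (k i) (at z) v *
      cnj (frechet_derivative (k i) (at z) w))"
  shows "closed_2form_on A \<omega>"
proof -
  let ?d = "\<lambda>i z v. frechet_derivative (k i) (at z) v"
  let ?dd = "\<lambda>i z v w. frechet_derivative (\<lambda>z. ?d i z v) (at z) w"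
  have D: "((\<lambda>z. \<omega> z v w) has_derivative
      (\<lambda>h. - Im (\<Sum>i\<in>I. ?d i z v * cnj (?dd i z w h) + ?dd i z v h * cnj (?d i z w)))) (at z)"
    if z: "z \<in> A" for z v w
  proof -
    have dv: "((\<lambda>z. ?d i z v) has_derivative ?dd i z v) (at z)" if "i \<in> I" for i v
      by (rule holo_onD(1)[OF holo_on_derivative[OF A k[OF that]] z])
    have "((\<lambda>z. - Im (\<Sum>i\<in>I. ?d i z v * cnj (?d i z w))) has_derivative
      (\<lambda>h. - Im (\<Sum>i\<in>I. ?d i z v * cnj (?dd i z w h) + ?dd i z v h * cnj (?d i z w)))) (at z)"
      by (intro has_derivative_minus bounded_linear.has_derivative[OF bounded_linear_Im] has_derivative_sum
          has_derivative_mult bounded_linear.has_derivative[OF bounded_linear_cnj] dv)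
    then show ?thesis
      by (rule has_derivative_transform_within_open[OF _ A z]) (simp add: w)
  qed
  show ?thesis
    unfolding closed_2form_on_def
  proof (intro conjI ballI allI)
    fix z v w assume "z \<in> A"
    then show "(\<lambda>z. \<omega> z v w) differentiable (at z)" using D by (auto simp: differentiable_def)
  next
    fix z a b c assume z: "z \<in> A"
    define d where "d i v = ?d i z v" for i v
    define dd where "dd i v w = ?dd i z v w" for i v w
    have sym: "dd i v w = dd i w v" if "i \<in> I" for i v w
      unfolding dd_def by (rule holo_on_derivative_sym[OF A k[OF that] z])
    have fd: "frechet_derivative (\<lambda>z. \<omega> z v w) (at z) h
        = - Im (\<Sum>i\<in>I. d i v * cnj (dd i w h) + dd i v h * cnj (d i w))" for v w h
      unfolding d_def dd_def frechet_derivative_at[OF D[OF z, of v w], symmetric] ..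
    have "frechet_derivative (\<lambda>z. \<omega> z b c) (at z) a - frechet_derivative (\<lambda>z. \<omega> z a c) (at z) b
          + frechet_derivative (\<lambda>z. \<omega> z a b) (at z) c
        = - Im (\<Sum>i\<in>I. (d i b * cnj (dd i c a) + dd i b a * cnj (d i c))
            - (d i a * cnj (dd i c b) + dd i a b * cnj (d i c))
            + (d i a * cnj (dd i b c) + dd i a c * cnj (d i b)))"
      unfolding fd sum_subtractf sum.distrib by simp
    also have "\<dots> = - Im (\<Sum>i\<in>I. d i b * cnj (dd i a c) + dd i a c * cnj (d i b))"
      by (intro arg_cong[of _ _ "\<lambda>x. - Im x"] sum.cong) (simp_all add: sym[of _ c a] sym[of _ c b] sym[of _ b a])
    \<comment> \<open>Each summand has the form \<open>x + cnj x\<close> and is real.\<close>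
    also have "\<dots> = 0"
      unfolding Im_sum by (simp add: mult.commute)
    finally show "frechet_derivative (\<lambda>z. \<omega> z b c) (at z) a - frechet_derivative (\<lambda>z. \<omega> z a c) (at z) b
          + frechet_derivative (\<lambda>z. \<omega> z a b) (at z) c = 0" .
  qed
qed

section \<open>Differentials of maps into the classifying space\<close>

lemma matrix_has_derivative:
  fixes f :: "'a::real_normed_vector \<Rightarrow> 'n::finite cmat"
  assumes "\<And>i j. ((\<lambda>x. f x $ i $ j) has_derivative (\<lambda>h. f' h $ i $ j)) (at x)"
  shows "(f has_derivative f') (at x)"
  unfolding has_derivative_componentwise_within[of f]
proof
  fix b :: "'n cmat" assume "b \<in> Basis"
  then obtain i j c where "b = axis i (axis j c)" unfolding Basis_vec_def by auto
  then show "((\<lambda>x. f x \<bullet> b) has_derivative (\<lambda>x. f' x \<bullet> b)) (at x)"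
    using has_derivative_inner_left[OF assms[of i j], of c] by (simp add: inner_axis)
qed

lemma mholo_on_derivative:
  fixes f :: "complex ^ 'm::finite \<Rightarrow> 'n::finite cmat"
  assumes "mholo_on A f" "z \<in> A"
  obtains f' where "(f has_derivative f') (at z)" "\<And>c v. f' (c *s v) = cscale c (f' v)"
proof -
  let ?f' = "\<lambda>h. \<chi> i j. frechet_derivative (\<lambda>z. f z $ i $ j) (at z) h"
  have h: "holo_on A (\<lambda>z. f z $ i $ j)" for i j using assms by (auto simp: mholo_on_def)
  have "(f has_derivative ?f') (at z)"
    by (rule matrix_has_derivative) (use holo_onD(1)[OF h assms(2)] in simp)
  moreover have "?f' (c *s v) = cscale c (?f' v)" for c v
    by (simp add: vec_eq_iff holo_onD(2)[OF h assms(2)])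
  ultimately show thesis by (rule that)
qed

context polarized
begin

text \<open>Elements of the metric group preserve every weight step, so they normalize the unipotent
  group.\<close>

lemma metric_group_conj_unip:
  assumes g: "g \<in> metric_group W Q" and n: "n \<in> unip"
  shows "g ** n ** matrix_inv g \<in> unip"
proof -
  have inv: "invertible g" using g by (simp add: metric_group_def)
  have im: "(*v) g ` WC W k = WC W k" "(*v) (matrix_inv g) ` WC W k = WC W k" for k
    using g metric_group_inv[OF g] by (auto simp: metric_group_def)
  have "g ** (n - mat 1) ** matrix_inv g = g ** n ** matrix_inv g - mat 1"
    by (simp add: mm.diff_left mm.diff_right matrix_inverse[OF inv])
  moreover have "g ** (n - mat 1) ** matrix_inv g \<in> Wlow W 1"
    unfolding Wlow_def
  proof (intro CollectI allI ballI)
    fix k v assume "v \<in> WC W k"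
    then have "matrix_inv g *v v \<in> WC W k" using im by blast
    then have "(n - mat 1) *v (matrix_inv g *v v) \<in> WC W (k - int 1)"
      using n by (auto simp: unip_def Wlow_def)
    then have "g *v ((n - mat 1) *v (matrix_inv g *v v)) \<in> WC W (k - int 1)" using im by blast
    then show "(g ** (n - mat 1) ** matrix_inv g) *v v \<in> WC W (k - int 1)"
      by (simp add: matrix_vector_mul_assoc matrix_mul_assoc)
  qed
  ultimately show ?thesis by (simp add: unip_def)
qed

end

context tate_frame
begin

lemma chart_rep_unip:
  "chart_rep W Q \<Phi> z Z u \<Longrightarrow> \<Phi> z = F \<Longrightarrow> y \<in> Z \<Longrightarrow> u y \<in> Wlow W 1 \<and> mexp (u y) \<in> unip"
  by (auto simp: chart_rep_def qF_eq mexp_unip)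

lemma chart_rep_mexp_derivative:
  assumes c: "chart_rep W Q \<Phi> z Z u" and F: "\<Phi> z = F" and L: "(u has_derivative L) (at z)"
  shows "((\<lambda>y. mexp (u y)) has_derivative L) (at z)"
proof -
  have Z: "open Z" "z \<in> Z" "u z = 0" using c by (auto simp: chart_rep_def)
  have "((\<lambda>y. texp N (u y)) has_derivative L) (at z)"
    using texp_has_derivative[OF L, of N] by (simp add: Z Dtexp_0)
  then show ?thesis
    by (rule has_derivative_transform_within_open[OF _ Z(1,2)])
      (use chart_rep_unip[OF c F] in \<open>simp add: mexp_eq_texp\<close>)
qed

text \<open>Two chart representations centred at the same point define the same filtrations nearby;
  by freeness their exponentials agree there, and the exponential has the identity as derivative at
  0. Hence the differential does not depend on the representation.\<close>

lemma D_differential_mexp: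
  assumes c: "chart_rep W Q \<Phi> z Z u" and F: "\<Phi> z = F"
  shows "((\<lambda>y. mexp (u y)) has_derivative D_differential W Q \<Phi> z) (at z)"
    and "D_differential W Q \<Phi> z (a *s v) = cscale a (D_differential W Q \<Phi> z v)"
proof -
  have Z: "open Z" "z \<in> Z" using c by (auto simp: chart_rep_def)
  obtain L where L: "(u has_derivative L) (at z)" "\<And>c v. L (c *s v) = cscale c (L v)"
    using mholo_on_derivative[of Z u z] c Z by (auto simp: chart_rep_def)
  note DL = chart_rep_mexp_derivative[OF c F L(1)]
  have "D_differential W Q \<Phi> z = L"
    unfolding D_differential_def
  proof (rule the_equality)
    show "\<exists>Z u. chart_rep W Q \<Phi> z Z u \<and> (u has_derivative L) (at z)" using c L by blast
    fix L' assume "\<exists>Z u. chart_rep W Q \<Phi> z Z u \<and> (u has_derivative L') (at z)"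
    then obtain Z' u' where c': "chart_rep W Q \<Phi> z Z' u'" and L': "(u' has_derivative L') (at z)" by blast
    have Z': "open Z'" "z \<in> Z'" using c' by (auto simp: chart_rep_def)
    have "((\<lambda>y. mexp (u y)) has_derivative L') (at z)"
    proof (rule has_derivative_transform_within_open[OF chart_rep_mexp_derivative[OF c' F L']])
      show "open (Z \<inter> Z')" "z \<in> Z \<inter> Z'" using Z Z' by auto
      fix y assume y: "y \<in> Z \<inter> Z'"
      then have "act (mexp (u' y)) F = act (mexp (u y)) F" using c c' F by (auto simp: chart_rep_def)
      then show "mexp (u' y) = mexp (u y)"
        using chart_rep_unip[OF c F] chart_rep_unip[OF c' F] y by (intro unip_act_eq) auto
    qed
    then show "L' = L" using DL has_derivative_unique by blast
  qed
  then show "((\<lambda>y. mexp (u y)) has_derivative D_differential W Q \<Phi> z) (at z)"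
    "D_differential W Q \<Phi> z (a *s v) = cscale a (D_differential W Q \<Phi> z v)"
    using DL L(2) by auto
qed

lemma frame_unip: "n \<in> unip \<Longrightarrow> tate_frame W N Q (act n F) l (n ** B)"
  using adapted_frame_act[OF frame unipotent_preserves(1)] by unfold_locales

lemma frame_metric_group: "g \<in> metric_group W Q \<Longrightarrow> tate_frame W N Q (act g F) l (g ** B)"
  using adapted_frame_act[OF frame] by unfold_locales

text \<open>Since the unipotent radical acts freely, \<open>g\<close> is determined by \<open>\<Phi>\<close>; it is its development
  in the unipotent group.\<close>

lemma development_derivative:
  assumes Z: "open Z" "z \<in> Z" and g: "\<And>y. y \<in> Z \<Longrightarrow> g y \<in> unip \<and> \<Phi> y = act (g y) F"
    and c: "chart_rep W Q \<Phi> z Z' u"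
  shows "(g has_derivative (\<lambda>v. D_differential W Q \<Phi> z v ** g z)) (at z)"
proof -
  have gz: "g z \<in> unip" "\<Phi> z = act (g z) F" using g Z by auto
  interpret z: tate_frame W N Q "act (g z) F" l "g z ** B" by (rule frame_unip[OF gz(1)])
  have Z': "open Z'" "z \<in> Z'" using c by (auto simp: chart_rep_def)
  \<comment> \<open>The chart \<open>u\<close> is centred at \<open>\<Phi> z\<close>, so near
    \<open>z\<close> freeness gives \<open>g y = mexp (u y) ** g z\<close>.\<close>
  have "((\<lambda>y. mexp (u y) ** g z) has_derivative (\<lambda>v. D_differential W Q \<Phi> z v ** g z)) (at z)"
    using mm.FDERIV[OF z.D_differential_mexp(1)[OF c gz(2)] has_derivative_const[of "g z"]] by simp
  then show ?thesis
  proof (rule has_derivative_transform_within_open)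
    show "open (Z \<inter> Z')" "z \<in> Z \<inter> Z'" using Z Z' by auto
    fix y assume y: "y \<in> Z \<inter> Z'"
    then have "act (mexp (u y) ** g z) F = act (g y) F"
      using c g[of y] gz by (auto simp: chart_rep_def act_mult)
    then show "mexp (u y) ** g z = g y"
      using z.chart_rep_unip[OF c gz(2)] g gz y by (intro unip_act_eq unip_mult) auto
  qed
qed

text \<open>In the transported frame \<open>g ** B\<close> the conjugated endomorphism has the same
  matrix as the original one in \<open>B\<close>.\<close>

lemma hat_conj:
  assumes g: "g \<in> metric_group W Q"
  shows "hodge_metric_End W Q (act g F) (g ** X ** matrix_inv g) (g ** Y ** matrix_inv g)
    = hodge_metric_End W Q F X Y"
proof -
  interpret g: tate_frame W N Q "act g F" l "g ** B" by (rule frame_metric_group[OF g])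
  have inv: "invertible g" using g by (simp add: metric_group_def)
  note matrix_inv_frame[OF inv]
  then have "g.hat (g ** X ** matrix_inv g) = C ** (matrix_inv g ** g) ** X ** (matrix_inv g ** g) ** B" for X
    unfolding g.hat_def by (simp only: matrix_mul_assoc)
  then have "g.hat (g ** X ** matrix_inv g) = hat X" for X
    by (simp add: matrix_inverse[OF inv] hat_def)
  then show ?thesis by (simp add: g.hodge_metric_End_eq hodge_metric_End_eq)
qed

text \<open>Serves two purposes: with \<open>\<tau>\<close> a transition map it gives compatibility
  of charts, and with \<open>\<tau>\<close> the identity near the point it gives independence of the
  local lift.\<close>

lemma metric_transform:
  fixes \<Phi> \<Psi> :: "complex ^ 'm::finite \<Rightarrow> 'n hfilt"
  assumes g: "g \<in> metric_group W Q" and V: "open V" "w \<in> V"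
    and \<Psi>: "\<And>y. y \<in> V \<Longrightarrow> \<Psi> y = act g (\<Phi> (\<tau> y))"
    and \<tau>: "(\<tau> has_derivative J) (at w)"
    and c: "chart_rep W Q \<Phi> (\<tau> w) Z u" and c': "chart_rep W Q \<Psi> w Z' u'" and F: "\<Phi> (\<tau> w) = F"
  shows "hodge_metric_End W Q (\<Psi> w) (D_differential W Q \<Psi> w v) (D_differential W Q \<Psi> w v')
    = hodge_metric_End W Q (\<Phi> (\<tau> w)) (D_differential W Q \<Phi> (\<tau> w) (J v)) (D_differential W Q \<Phi> (\<tau> w) (J v'))"
proof -
  have \<Psi>w: "\<Psi> w = act g F" using \<Psi>[OF V(2)] F by simp
  interpret g: tate_frame W N Q "act g F" l "g ** B" by (rule frame_metric_group[OF g])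
  have inv: "invertible g" using g by (simp add: metric_group_def)
  have Z: "open Z" "\<tau> w \<in> Z" "u (\<tau> w) = 0" using c by (auto simp: chart_rep_def)
  have "isCont \<tau> w" by (rule has_derivative_continuous[OF \<tau>])
  from iffD1[OF continuous_at_open this, THEN spec, of Z] Z(1,2)
  obtain V' where V': "open V'" "w \<in> V'" "\<And>y. y \<in> V' \<Longrightarrow> \<tau> y \<in> Z"
    by auto
  \<comment> \<open>\<open>g\<close> need not be unipotent, but conjugation by it turns the
    development of \<open>\<Phi>\<close> at \<open>F\<close> into the one of \<open>\<Psi>\<close>
    at \<open>act g F\<close>.\<close>
  let ?n = "\<lambda>y. g ** mexp (u (\<tau> y)) ** matrix_inv g"
  have dn: "(?n has_derivative (\<lambda>v. D_differential W Q \<Psi> w v ** ?n w)) (at w)"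
  proof (rule g.development_derivative[OF _ _ _ c'])
    show "open (V \<inter> V')" "w \<in> V \<inter> V'" using V V' by auto
    fix y assume y: "y \<in> V \<inter> V'"
    then have yZ: "\<tau> y \<in> Z" using V' by auto
    have "\<Psi> y = act g (act (mexp (u (\<tau> y))) F)"
      using \<Psi>[of y] y yZ c F by (simp add: chart_rep_def)
    also have "\<dots> = act (?n y) (act g F)"
      by (simp add: act_mult[symmetric] matrix_mul_assoc[symmetric] matrix_inverse[OF inv])
    finally show "?n y \<in> unip \<and> \<Psi> y = act (?n y) (act g F)"
      using metric_group_conj_unip[OF g] chart_rep_unip[OF c F yZ] by auto
  qed
  have "((\<lambda>y. mexp (u (\<tau> y))) has_derivative (\<lambda>v. D_differential W Q \<Phi> (\<tau> w) (J v))) (at w)"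
    using has_derivative_compose[OF \<tau> D_differential_mexp(1)[OF c F]] .
  from bounded_linear.has_derivative[OF mm.bounded_linear_left
      bounded_linear.has_derivative[OF mm.bounded_linear_right this]]
  have dn': "(?n has_derivative (\<lambda>v. g ** D_differential W Q \<Phi> (\<tau> w) (J v) ** matrix_inv g)) (at w)" .
  have "?n w = mat 1" by (simp add: Z mexp_zero matrix_inverse[OF inv])
  then have "(?n has_derivative (\<lambda>v. D_differential W Q \<Psi> w v)) (at w)" using dn by simp
  from has_derivative_unique[OF this dn']
  have "(\<lambda>v. D_differential W Q \<Psi> w v) = (\<lambda>v. g ** D_differential W Q \<Phi> (\<tau> w) (J v) ** matrix_inv g)" .
  then have "D_differential W Q \<Psi> w v = g ** D_differential W Q \<Phi> (\<tau> w) (J v) ** matrix_inv g" for v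
    by (rule fun_cong)
  then show ?thesis by (simp add: \<Psi>w F hat_conj[OF g])
qed

text \<open>Horizontality makes the Maurer-Cartan form of the development equal to the differential of
  its component of degree \<open>-1\<close>, so the pulled back metric is a sum of squares of exact
  holomorphic forms.\<close>

lemma horizontal_metric_closed:
  fixes \<Phi> :: "complex ^ 'm::finite \<Rightarrow> 'n hfilt"
  assumes c: "chart_rep W Q \<Phi> z0 Z u" and F: "\<Phi> z0 = F"
    and reps: "\<And>z. z \<in> Z \<Longrightarrow> \<exists>Z' u'. chart_rep W Q \<Phi> z Z' u'"
    and hor: "\<And>z v. z \<in> Z \<Longrightarrow> D_differential W Q \<Phi> z v \<in> horizontal_space W Q (\<Phi> z)"
    and \<omega>: "\<And>z v w. z \<in> Z \<Longrightarrow> \<omega> z v w =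
      - Im (hodge_metric_End W Q (\<Phi> z) (D_differential W Q \<Phi> z v) (D_differential W Q \<Phi> z w))"
  shows "closed_2form_on Z \<omega>"
proof -
  let ?G = "\<lambda>y. mexp (u y)" and ?D = "D_differential W Q \<Phi>"
  let ?I = "{(i, j). l i = l j - 1}" and ?k = "\<lambda>(i, j) y. hat (?G y) $ i $ j"
  have Z: "open Z" "z0 \<in> Z" using c by (auto simp: chart_rep_def)
  have G: "?G y \<in> unip \<and> \<Phi> y = act (?G y) F" if "y \<in> Z" for y
    using chart_rep_unip[OF c F that] c F that by (auto simp: chart_rep_def)
  have dG: "(?G has_derivative (\<lambda>v. ?D z v ** ?G z)) (at z)" if z: "z \<in> Z" for z
  proof -
    obtain Z' u' where "chart_rep W Q \<Phi> z Z' u'" using reps[OF z] by blast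
    from development_derivative[OF Z(1) z _ this, of ?G] show ?thesis using G by blast
  qed
  have dk: "(?k (i, j) has_derivative (\<lambda>v. hat (?D z v ** ?G z) $ i $ j)) (at z)" if "z \<in> Z" for z i j
    using bounded_linear.has_derivative[OF bounded_linear_vec_nth
        bounded_linear.has_derivative[OF bounded_linear_vec_nth
          bounded_linear.has_derivative[OF hat_bounded_linear dG[OF that]]]] by simp
  have lin: "?D z (a *s v) = cscale a (?D z v)" if z: "z \<in> Z" for z a v
  proof -
    interpret z: tate_frame W N Q "act (?G z) F" l "?G z ** B" by (rule frame_unip) (use G[OF z] in simp)
    show ?thesis using reps[OF z] z.D_differential_mexp(2) G[OF z] by blast
  qed
  have holo: "holo_on Z (?k e)" for e
  proof (cases e)
    case (Pair i j)
    have "hat (?D z (a *s v) ** ?G z) $ i $ j = a * hat (?D z v ** ?G z) $ i $ j" if "z \<in> Z" for z a v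
      by (simp add: lin[OF that] cscale_mult(1)[symmetric] hat_simps)
    then show ?thesis unfolding holo_on_def Pair using dk by blast
  qed
  show ?thesis
  proof (rule closed_sum_of_squares[OF Z(1), of ?I ?k])
    show "finite ?I" by simp
    show "holo_on Z (?k e)" for e by (rule holo)
    fix z v w assume z: "z \<in> Z"
    interpret z: tate_frame W N Q "act (?G z) F" l "?G z ** B" by (rule frame_unip) (use G[OF z] in simp)
    have inv: "invertible (?G z)" using G[OF z] unip_inv by blast
    \<comment> \<open>\<open>z.hat\<close> uses the frame \<open>?G z ** B\<close>, so this is the
      left Maurer-Cartan form of the development, written in the fixed frame
      \<open>B\<close>.\<close>
    define \<theta> where "\<theta> v = z.hat (?D z v)" for v
    have \<theta>0: "\<theta> v $ i $ j = 0" if "l i \<noteq> l j - 1" for v i j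
      unfolding \<theta>_def using z.horizontal_hat[OF _ that] hor[OF z] G[OF z] by simp
    have G1: "hat (?G z) $ i $ j = (if i = j then 1 else 0)" if "l j \<le> l i" for i j
    proof -
      have "hat (?G z - mat 1) $ i $ j = 0" using G[OF z] that hat_low unfolding unip_def by blast
      moreover have "hat (mat 1) = mat 1" by (simp add: hat_def BC)
      ultimately show ?thesis by (simp add: hat_simps mat_def)
    qed
    have fact: "hat (?D z v ** ?G z) = hat (?G z) ** \<theta> v" for v
    proof -
      note matrix_inv_frame[OF inv]
      then have "hat (?G z) ** \<theta> v = C ** (?G z ** ((B ** C) ** matrix_inv (?G z))) ** ?D z v ** ?G z ** B"
        unfolding \<theta>_def z.hat_def hat_def by (simp only: matrix_mul_assoc)
      then show ?thesis by (simp add: BC matrix_inverse[OF inv] hat_def matrix_mul_assoc)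
    qed
    \<comment> \<open>In row \<open>i\<close> and column \<open>j\<close> of
      \<open>hat (?G z) ** \<theta> v\<close>, horizontality leaves only indices \<open>m\<close>
      with \<open>l m = l i\<close>, and there the unipotent factor has the entries of the identity
      matrix.\<close>
    have dk\<theta>: "frechet_derivative (?k (i, j)) (at z) v = \<theta> v $ i $ j" if ij: "l i = l j - 1" for i j v
    proof -
      have "frechet_derivative (?k (i, j)) (at z) v = (hat (?G z) ** \<theta> v) $ i $ j"
        unfolding frechet_derivative_at[OF dk[OF z], symmetric] fact ..
      also have "\<dots> = (\<Sum>m\<in>UNIV. hat (?G z) $ i $ m * \<theta> v $ m $ j)"
        by (simp add: matrix_matrix_mult_def)
      also have "\<dots> = (\<Sum>m\<in>UNIV. if m = i then \<theta> v $ i $ j else 0)"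
      proof (rule sum.cong[OF refl])
        fix m
        show "hat (?G z) $ i $ m * \<theta> v $ m $ j = (if m = i then \<theta> v $ i $ j else 0)"
          using \<theta>0[of m j v] G1[of m i] ij by (cases "l m = l j - 1") auto
      qed
      also have "\<dots> = \<theta> v $ i $ j" by simp
      finally show ?thesis .
    qed
    have "frob (\<theta> v) (\<theta> w) = (\<Sum>e\<in>UNIV. \<theta> v $ fst e $ snd e * cnj (\<theta> w $ fst e $ snd e))"
      unfolding frob_def sum.cartesian_product by (simp add: case_prod_unfold)
    also have "\<dots> = (\<Sum>e\<in>?I. \<theta> v $ fst e $ snd e * cnj (\<theta> w $ fst e $ snd e))"
      by (rule sum.mono_neutral_right) (auto simp: \<theta>0)
    also have "\<dots> = (\<Sum>e\<in>?I. frechet_derivative (?k e) (at z) v * cnj (frechet_derivative (?k e) (at z) w))"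
      by (rule sum.cong[OF refl]) (use dk\<theta> in auto)
    finally show "\<omega> z v w = - Im (\<Sum>e\<in>?I. frechet_derivative (?k e) (at z) v * cnj (frechet_derivative (?k e) (at z) w))"
      using \<omega>[OF z] G[OF z] by (simp add: z.hodge_metric_End_eq \<theta>_def)
  qed
qed

end

section \<open>Pullback along period maps\<close>

lemma vholo_on_derivative:
  fixes f :: "complex ^ 'm::finite \<Rightarrow> complex ^ 'k::finite"
  assumes "vholo_on A f" "z \<in> A"
  shows "(f has_derivative frechet_derivative f (at z)) (at z)"
proof -
  let ?f' = "\<lambda>h. \<chi> i. frechet_derivative (\<lambda>z. f z $ i) (at z) h"
  have h: "holo_on A (\<lambda>z. f z $ i)" for i using assms by (auto simp: vholo_on_def)
  have "(f has_derivative ?f') (at z)"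
    unfolding has_derivative_componentwise_within[of f]
  proof
    fix b :: "complex ^ 'k" assume "b \<in> Basis"
    then obtain i c where "b = axis i c" unfolding Basis_vec_def by auto
    then show "((\<lambda>x. f x \<bullet> b) has_derivative (\<lambda>x. ?f' x \<bullet> b)) (at z)"
      using has_derivative_inner_left[OF holo_onD(1)[OF h assms(2)], of i c] by (simp add: inner_axis)
  qed
  then show ?thesis using frechet_derivative_at by metis
qed

lemma chart_properties:
  assumes M: "complex_manifold \<A>" and c: "c \<in> \<A>"
  shows "open (fst c)" "open (snd c ` fst c)"
    and "continuous_on (fst c) (snd c)" "continuous_on (snd c ` fst c) (chart_inv c)"
    and "s \<in> fst c \<Longrightarrow> chart_inv c (snd c s) = s"
    and "open U \<Longrightarrow> open (snd c ` (U \<inter> fst c))"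
proof -
  have h: "homeomorphism (fst c) (snd c ` fst c) (snd c) (chart_inv c)"
    and o: "open (fst c)" "open (snd c ` fst c)"
    using M c by (auto simp: complex_manifold_def)
  show "open (fst c)" "open (snd c ` fst c)" by (rule o)+
  show "continuous_on (fst c) (snd c)" "continuous_on (snd c ` fst c) (chart_inv c)"
    using h by (auto simp: homeomorphism_def)
  show inv: "chart_inv c (snd c s) = s" if "s \<in> fst c" for s
    using h that by (auto simp: homeomorphism_def)
  assume U: "open U"
  have "snd c ` (U \<inter> fst c) = snd c ` fst c \<inter> chart_inv c -` U"
    using inv by auto
  then show "open (snd c ` (U \<inter> fst c))"
    using continuous_open_preimage[OF _ o(2) U, of "chart_inv c"] h by (auto simp: homeomorphism_def)
qed

text \<open>A coordinate ball, which is convex and therefore path connected.\<close>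

lemma manifold_neighbourhood:
  fixes s :: "'s::{t2_space, second_countable_topology}"
  assumes M: "complex_manifold (\<A> :: ('s, 'm::finite) chart set)" and U: "open U" "s \<in> U"
  obtains V where "open V" "s \<in> V" "V \<subseteq> U" "path_connected V"
proof -
  obtain c where c: "c \<in> \<A>" "s \<in> fst c" using M unfolding complex_manifold_def by blast
  note C = chart_properties[OF M c(1)]
  have "open (snd c ` (U \<inter> fst c))" "snd c s \<in> snd c ` (U \<inter> fst c)"
    using C(6)[OF U(1)] U c by auto
  then obtain e where e: "0 < e" "ball (snd c s) e \<subseteq> snd c ` (U \<inter> fst c)"
    using open_contains_ball by blast
  define V where "V = fst c \<inter> snd c -` ball (snd c s) e"
  have V: "V = chart_inv c ` ball (snd c s) e"
    using e C(5) unfolding V_def by force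
  have "open V" unfolding V_def by (rule continuous_open_preimage[OF C(3,1) open_ball])
  moreover have "path_connected V"
    unfolding V using e continuous_on_subset[OF C(4)]
    by (intro path_connected_continuous_image convex_imp_path_connected convex_ball) blast
  moreover have "V \<subseteq> U" unfolding V using e C(5) by fastforce
  moreover have "s \<in> V" using e c by (simp add: V_def)
  ultimately show thesis by (intro that)
qed

lemma ex_weight_filt:
  assumes wf: "weight_filtration W"
  obtains N where "weight_filt W N"
proof -
  obtain k m where km: "W k = {0}" "W m = UNIV" and mono: "\<And>k l. k \<le> l \<Longrightarrow> W k \<subseteq> W l"
    and sub: "\<And>k. subspace (W k)"
    using wf unfolding weight_filtration_def by metis
  \<comment> \<open>An endomorphism lowering weights by \<open>m - k\<close> maps
    \<open>W m = UNIV\<close> into \<open>W k = {0}\<close>; the lower bound 2 is the one demanded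
    by the locale.\<close>
  define N where "N = max 2 (nat (m - k))"
  have "m - int N \<le> k" unfolding N_def by linarith
  then have low: "W (m - int N) = {0}"
    using mono[of "m - int N" k] subspace_0[OF sub] km by auto
  have "X = 0" if X: "X \<in> Wlow W N" for X
  proof (rule matrix_ext_vec)
    fix v
    have "X *v v \<in> WC W (m - int N)" using X km unfolding Wlow_def WC_def by blast
    then have "vRe (X *v v) = 0" "vIm (X *v v) = 0" by (auto simp: WC_def low)
    then show "X *v v = 0 *v v" by (simp add: vRe_def vIm_def vec_eq_iff complex_eq_iff)
  qed
  moreover have "0 \<in> Wlow W N"
    using subspace_0[OF sub] by (auto simp: Wlow_def WC_def vRe_def vIm_def zero_vec_def[symmetric])
  ultimately have "weight_filt W N"
    using wf by unfold_locales (auto simp: N_def)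
  then show thesis by (rule that)
qed

context polarized
begin

text \<open>Over a path connected neighbourhood both lifts can be compared with the same transport
  to \<open>s\<close>; each differs from it by parallel transport along a fixed path, which is a
  real group element.\<close>

lemma local_lifts_differ:
  fixes s :: "'s::{t2_space, second_countable_topology}"
  assumes M: "complex_manifold (\<A> :: ('s, 'm::finite) chart set)" and T: "local_system W Q T"
    and f: "local_lift T \<F> b U f" and f': "local_lift T \<F> b U' f'" and s: "s \<in> U" "s \<in> U'"
  obtains V g where "open V" "s \<in> V" "V \<subseteq> U \<inter> U'" "g \<in> metric_group W Q"
    "\<And>x. x \<in> V \<Longrightarrow> f x = act g (f' x)"
proof -
  have TG: "T p \<in> metric_group W Q" if "path p" for p
    using T GR_metric_group that unfolding local_system_def by blast
  have TT: "T (p +++ q) = T q ** T p" if "path p" "path q" "pathfinish p = pathstart q" for p q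
    using T that unfolding local_system_def by blast
  have U: "open U" "open U'" using f f' by (auto simp: local_lift_def)
  obtain V where V: "open V" "s \<in> V" "V \<subseteq> U \<inter> U'" "path_connected V"
    using manifold_neighbourhood[OF M, of "U \<inter> U'" s] U s by blast
  \<comment> \<open>Any path in \<open>V\<close> from \<open>x\<close> to \<open>s\<close> will do,
    without continuity in \<open>x\<close>: the same choice serves both lifts and drops out of the
    comparison.\<close>
  define r where "r x = (SOME r. path r \<and> path_image r \<subseteq> V \<and> pathstart r = x \<and> pathfinish r = s)" for x
  have r: "path (r x)" "path_image (r x) \<subseteq> V" "pathstart (r x) = x" "pathfinish (r x) = s" if "x \<in> V" for x
  proof -
    have "\<exists>r. path r \<and> path_image r \<subseteq> V \<and> pathstart r = x \<and> pathfinish r = s"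
      using V(2,4) that unfolding path_connected_def by blast
    from someI_ex[OF this]
    show "path (r x)" "path_image (r x) \<subseteq> V" "pathstart (r x) = x" "pathfinish (r x) = s"
      unfolding r_def by blast+
  qed
  have *: "\<exists>g\<in>metric_group W Q. \<forall>x\<in>V. f x = act g (act (T (r x)) (\<F> x))"
    if f: "local_lift T \<F> b U f" and s: "s \<in> U" and VU: "V \<subseteq> U" for U f
  proof -
    obtain c where c: "path c" "pathstart c \<in> U"
      and fc: "\<And>x p. x \<in> U \<Longrightarrow> path p \<Longrightarrow> path_image p \<subseteq> U \<Longrightarrow> pathstart p = x \<Longrightarrow> pathfinish p = pathstart c \<Longrightarrow>
        f x = act (T (p +++ c)) (\<F> x)"
      using f unfolding local_lift_def by blast
    have "path_connected U" using f by (simp add: local_lift_def)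
    then obtain q where q: "path q" "path_image q \<subseteq> U" "pathstart q = s" "pathfinish q = pathstart c"
      using s c(2) unfolding path_connected_def by blast
    \<comment> \<open>The path from \<open>x\<close> to \<open>s\<close> is prolonged by the fixed
      \<open>q\<close> inside \<open>U\<close> before \<open>c\<close>, so the transport after
      \<open>s\<close> no longer depends on \<open>x\<close>.\<close>
    have "f x = act (T c ** T q) (act (T (r x)) (\<F> x))" if x: "x \<in> V" for x
    proof -
      have p: "path (r x +++ q)" "path_image (r x +++ q) \<subseteq> U"
        using r[OF x] q VU subset_path_image_join[of "r x" U q] by auto
      then have "f x = act (T ((r x +++ q) +++ c)) (\<F> x)"
        using x VU r(3)[OF x] q by (intro fc) auto
      also have "T ((r x +++ q) +++ c) = T c ** (T q ** T (r x))"
        using TT[OF p(1) c(1)] TT[OF r(1)[OF x] q(1)] r(4)[OF x] q by simp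
      finally show ?thesis by (simp add: act_mult)
    qed
    moreover have "T c ** T q \<in> metric_group W Q" by (intro metric_group_mult TG c q)
    ultimately show ?thesis by blast
  qed
  obtain g g' where g: "g \<in> metric_group W Q" "\<And>x. x \<in> V \<Longrightarrow> f x = act g (act (T (r x)) (\<F> x))"
    and g': "g' \<in> metric_group W Q" "\<And>x. x \<in> V \<Longrightarrow> f' x = act g' (act (T (r x)) (\<F> x))"
    using *[OF f s(1)] *[OF f' s(2)] V(3) by blast
  have "invertible g'" using g' by (simp add: metric_group_def)
  then have "act (g ** matrix_inv g') (act g' X) = act g X" for X
    by (simp add: act_mult[symmetric] matrix_mul_assoc[symmetric] matrix_inverse)
  then have "f x = act (g ** matrix_inv g') (f' x)" if "x \<in> V" for x
    using g(2) g'(2) that by simp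
  then show thesis
    using that[OF V(1-3) metric_group_mult[OF g(1) metric_group_inv[OF g'(1)]]] by blast
qed

text \<open>The values computed from local lifts glue because lifts differ locally by an isometry;
  each Kaehler condition is then checked with a single lift near a point. The vanishing of Hodge
  numbers enters only through \<open>frames\<close>.\<close>

lemma pullback_kaehler:
  fixes \<A> :: "('s::{t2_space, second_countable_topology}, 'm::finite) chart set"
  assumes M: "complex_manifold \<A>" and P: "period_map W Q h \<A> T \<F> b \<Gamma> \<phi>"
    and frames: "\<And>F. F \<in> classifying_space W Q h \<Longrightarrow> \<exists>l B. adapted_frame W Q F l B"
  shows "\<exists>g. is_pullback_metric W Q \<A> T \<F> b g \<and> kaehler_pseudo_metric \<A> g"
proof -
  define val where "val f c s v w = (let L = D_differential W Q (f \<circ> chart_inv c) (snd c s)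
         in hodge_metric_End W Q (f s) (L v) (L w))"
    for f :: "'s \<Rightarrow> 'n hfilt" and c :: "('s, 'm) chart" and s v w
  let ?lift = "local_lift T \<F> b"
  have T: "local_system W Q T" and cover: "\<exists>U f. s \<in> U \<and> ?lift U f"
    and hD: "?lift U f \<Longrightarrow> c \<in> \<A> \<Longrightarrow> holo_to_D W Q h (snd c ` (U \<inter> fst c)) (f \<circ> chart_inv c)"
    and hor: "?lift U f \<Longrightarrow> c \<in> \<A> \<Longrightarrow> horizontal_on W Q (snd c ` (U \<inter> fst c)) (f \<circ> chart_inv c)" for s U f c
    using P unfolding period_map_def gp_vmhs_def by blast+
  note C = chart_properties[OF M]
  have rep: "\<exists>Z u. Z \<subseteq> snd c ` (U \<inter> fst c) \<and> chart_rep W Q (f \<circ> chart_inv c) z Z u"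
    if "?lift U f" "c \<in> \<A>" "z \<in> snd c ` (U \<inter> fst c)" for U f c z
    using hD[OF that(1,2)] that(3) unfolding holo_to_D_def by blast
  have frame: "\<exists>l B. tate_frame W N Q (f s) l B" if "?lift U f" and c: "c \<in> \<A>" and s: "s \<in> U" "s \<in> fst c" for U f c s
  proof -
    have "(f \<circ> chart_inv c) (snd c s) \<in> classifying_space W Q h"
      using hD[OF that(1) c] s unfolding holo_to_D_def by blast
    then have "f s \<in> classifying_space W Q h" by (simp add: C(5)[OF c s(2)])
    then obtain l B where "adapted_frame W Q (f s) l B" using frames by blast
    then have "tate_frame W N Q (f s) l B" by unfold_locales
    then show ?thesis by blast
  qed
  have trans: "val f c s v w = val f' c' s (J v) (J w)"
    if f: "?lift U f" and f': "?lift U' f'" and c: "c \<in> \<A>" "c' \<in> \<A>" and s: "s \<in> U" "s \<in> U'" "s \<in> fst c" "s \<in> fst c'"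
      and J: "((snd c' \<circ> chart_inv c) has_derivative J) (at (snd c s))"
    for U f U' f' c c' s J v w
  proof -
    obtain V g where V: "open V" "s \<in> V" "V \<subseteq> U \<inter> U'" and g: "g \<in> metric_group W Q"
      and fg: "\<And>x. x \<in> V \<Longrightarrow> f x = act g (f' x)"
      by (rule local_lifts_differ[OF M T f f' s(1,2)]) blast
    obtain l B where fr: "tate_frame W N Q (f' s) l B" using frame[OF f' c(2) s(2,4)] by blast
    let ?V = "snd c ` ((V \<inter> fst c') \<inter> fst c)"
    have inv: "chart_inv c (snd c s) = s" "chart_inv c' (snd c' s) = s" using C(5) c s by auto
    obtain Z u Z' u' where cr: "chart_rep W Q (f' \<circ> chart_inv c') (snd c' s) Z u"
      "chart_rep W Q (f \<circ> chart_inv c) (snd c s) Z' u'"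
      using rep[OF f' c(2), of "snd c' s"] rep[OF f c(1), of "snd c s"] s by blast
    have "hodge_metric_End W Q ((f \<circ> chart_inv c) (snd c s))
          (D_differential W Q (f \<circ> chart_inv c) (snd c s) v) (D_differential W Q (f \<circ> chart_inv c) (snd c s) w)
        = hodge_metric_End W Q ((f' \<circ> chart_inv c') ((snd c' \<circ> chart_inv c) (snd c s)))
          (D_differential W Q (f' \<circ> chart_inv c') ((snd c' \<circ> chart_inv c) (snd c s)) (J v))
          (D_differential W Q (f' \<circ> chart_inv c') ((snd c' \<circ> chart_inv c) (snd c s)) (J w))"
    proof (rule tate_frame.metric_transform[OF fr g _ _ _ J])
      show "open ?V" by (intro C(6)[OF c(1)] open_Int V(1) C(1)[OF c(2)])
      show "snd c s \<in> ?V" using V(2) s by blast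
      show "(f \<circ> chart_inv c) y = act g ((f' \<circ> chart_inv c') ((snd c' \<circ> chart_inv c) y))" if "y \<in> ?V" for y
        using that fg C(5)[OF c(1)] C(5)[OF c(2)] by auto
      show "chart_rep W Q (f' \<circ> chart_inv c') ((snd c' \<circ> chart_inv c) (snd c s)) Z u"
        using cr(1) by (simp add: inv)
      show "chart_rep W Q (f \<circ> chart_inv c) (snd c s) Z' u'" by (rule cr(2))
      show "(f' \<circ> chart_inv c') ((snd c' \<circ> chart_inv c) (snd c s)) = f' s" by (simp add: inv)
    qed
    then show ?thesis by (simp add: val_def Let_def inv)
  qed
  \<comment> \<open>The case of \<open>trans\<close> with equal charts, where the transition map is
    the identity near the point.\<close>
  have same: "val f c s v w = val f' c s v w"
    if "?lift U f" "?lift U' f'" "c \<in> \<A>" "s \<in> U" "s \<in> U'" "s \<in> fst c" for U f U' f' c s v w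
  proof -
    have "((snd c \<circ> chart_inv c) has_derivative (\<lambda>h. h)) (at (snd c s))"
      by (rule has_derivative_transform_within_open[OF has_derivative_ident C(2)[OF that(3)]])
        (use C(5)[OF that(3)] that(6) in auto)
    then show ?thesis by (rule trans[OF that(1,2,3,3,4,5,6,6)])
  qed
  \<comment> \<open>Some lift exists around \<open>s\<close>, and by \<open>same\<close> all of them
    give one value, so the choice is harmless.\<close>
  define g where "g c s v w = (SOME r. \<exists>U f. ?lift U f \<and> s \<in> U \<and> r = val f c s v w)"
    for c :: "('s, 'm) chart" and s v w
  have g: "g c s v w = val f c s v w" if "?lift U f" "c \<in> \<A>" "s \<in> U" "s \<in> fst c" for U f c s v w
    unfolding g_def
  proof (rule some_equality)
    show "\<exists>U' f'. ?lift U' f' \<and> s \<in> U' \<and> val f c s v w = val f' c s v w" using that by blast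
  next
    fix r assume "\<exists>U' f'. ?lift U' f' \<and> s \<in> U' \<and> r = val f' c s v w"
    then show "r = val f c s v w" using same that by blast
  qed
  have "is_pullback_metric W Q \<A> T \<F> b g"
    unfolding is_pullback_metric_def using g by (auto simp: val_def)
  moreover have "pseudo_metric \<A> g"
    unfolding pseudo_metric_def
  proof (intro conjI ballI allI)
    fix c s u v w a
    assume c: "c \<in> \<A>" and s: "s \<in> fst c"
    obtain U f where f: "?lift U f" "s \<in> U" using cover by blast
    obtain l B where "tate_frame W N Q (f s) l B" using frame[OF f(1) c f(2) s] by blast
    then interpret fr: tate_frame W N Q "f s" l B .
    let ?\<Phi> = "f \<circ> chart_inv c" and ?z = "snd c s"
    have z: "?\<Phi> ?z = f s" using C(5)[OF c s] by simp
    obtain Z u' where cr: "chart_rep W Q ?\<Phi> ?z Z u'" using rep[OF f(1) c, of ?z] f(2) s by blast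
    note D = fr.D_differential_mexp[OF cr z]
    have add: "D_differential W Q ?\<Phi> ?z (x + y) = D_differential W Q ?\<Phi> ?z x + D_differential W Q ?\<Phi> ?z y" for x y
      using linear_add[OF has_derivative_linear[OF D(1)]] .
    have gv: "g c s x y = frob (fr.hat (D_differential W Q ?\<Phi> ?z x)) (fr.hat (D_differential W Q ?\<Phi> ?z y))" for x y
      unfolding g[OF f(1) c f(2) s] val_def Let_def by (rule fr.hodge_metric_End_eq)
    show "g c s (u + v) w = g c s u w + g c s v w"
      by (simp add: gv add fr.hat_simps frob.add_left)
    show "g c s (a *s u) w = a * g c s u w"
      unfolding gv D(2) fr.hat_simps frob_cscale ..
    show "g c s w u = cnj (g c s u w)" by (simp add: gv frob_cnj)
    show "0 \<le> Re (g c s u u)" by (simp add: gv frob_pos)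
  next
    fix c c' s v w
    assume c: "c \<in> \<A>" "c' \<in> \<A>" and s: "s \<in> fst c \<inter> fst c'"
    obtain U f where f: "?lift U f" "s \<in> U" using cover by blast
    let ?\<tau> = "snd c' \<circ> chart_inv c"
    have "vholo_on (snd c ` (fst c \<inter> fst c')) ?\<tau>" using M c by (auto simp: complex_manifold_def)
    then have "(?\<tau> has_derivative frechet_derivative ?\<tau> (at (snd c s))) (at (snd c s))"
      using s by (intro vholo_on_derivative) auto
    from trans[OF f(1) f(1) c f(2) f(2) _ _ this]
    have "val f c s v w = val f c' s (frechet_derivative ?\<tau> (at (snd c s)) v) (frechet_derivative ?\<tau> (at (snd c s)) w)"
      using s by blast
    then show "let J = frechet_derivative ?\<tau> (at (snd c s)) in g c' s (J v) (J w) = g c s v w"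
      unfolding Let_def using g[OF f(1) c(1) f(2)] g[OF f(1) c(2) f(2)] s by auto
  qed
  moreover have "closed_2form_on (snd c ` fst c) (\<lambda>z v w. - Im (g c (chart_inv c z) v w))" if c: "c \<in> \<A>" for c
  proof -
    \<comment> \<open>The conditions in \<open>closed_2form_on\<close> are imposed at single points,
      so it is enough to find around each point a set on which they hold; the domain of a chart
      representation is such a set.\<close>
    have "\<exists>Z. z0 \<in> Z \<and> closed_2form_on Z (\<lambda>z v w. - Im (g c (chart_inv c z) v w))" if z0: "z0 \<in> snd c ` fst c" for z0
    proof -
      obtain s where s: "s \<in> fst c" "z0 = snd c s" using z0 by blast
      obtain U f where f: "?lift U f" "s \<in> U" using cover by blast
      let ?\<Phi> = "f \<circ> chart_inv c"
      obtain Z u where Z: "Z \<subseteq> snd c ` (U \<inter> fst c)" and cr: "chart_rep W Q ?\<Phi> z0 Z u"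
        using rep[OF f(1) c, of z0] f(2) s by blast
      obtain l B where fr: "tate_frame W N Q (f s) l B" using frame[OF f(1) c f(2) s(1)] by blast
      have z: "?\<Phi> z0 = f s" using C(5)[OF c s(1)] s by simp
      have "closed_2form_on Z (\<lambda>z v w. - Im (g c (chart_inv c z) v w))"
      proof (rule tate_frame.horizontal_metric_closed[OF fr cr z])
        fix z assume "z \<in> Z"
        then have zU: "z \<in> snd c ` (U \<inter> fst c)" using Z by blast
        then obtain x where x: "x \<in> U" "x \<in> fst c" "z = snd c x" by blast
        show "\<exists>Z' u'. chart_rep W Q ?\<Phi> z Z' u'" using rep[OF f(1) c zU] by blast
        show "D_differential W Q ?\<Phi> z v \<in> horizontal_space W Q (?\<Phi> z)" for v
          using hor[OF f(1) c] zU unfolding horizontal_on_def by blast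
        show "- Im (g c (chart_inv c z) v w) =
            - Im (hodge_metric_End W Q (?\<Phi> z) (D_differential W Q ?\<Phi> z v) (D_differential W Q ?\<Phi> z w))" for v w
          using g[OF f(1) c x(1,2)] C(5)[OF c x(2)] by (simp add: val_def Let_def x(3))
      qed
      moreover have "z0 \<in> Z" using cr by (simp add: chart_rep_def)
      ultimately show ?thesis by blast
    qed
    then show ?thesis unfolding closed_2form_on_def by blast
  qed
  ultimately show ?thesis unfolding kaehler_pseudo_metric_def by blast
qed

end

theorem mainTheorem2:
  fixes W :: "int \<Rightarrow> (real ^ 'n) set"
    and Q :: "int \<Rightarrow> real ^ 'n \<Rightarrow> real ^ 'n \<Rightarrow> real"
    and h :: "int \<Rightarrow> int \<Rightarrow> nat"
  assumes "weight_filtration W" and "graded_forms W Q"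
    and "\<And>p q. p \<noteq> q \<Longrightarrow> h p q = 0"
  shows "(\<forall>F\<in>classifying_space W Q h. \<forall>a\<in>qF W Q F. \<forall>b\<in>qF W Q F. \<forall>s\<in>qF W Q F.
            hodge_curvature W Q F a b s = 0) \<and>
         (\<forall>(\<A> :: ('s::{t2_space, second_countable_topology}, 'm::finite) chart set) T \<F> b \<Gamma> \<phi>.
            complex_manifold \<A> \<and> connected (UNIV :: 's set) \<and> period_map W Q h \<A> T \<F> b \<Gamma> \<phi> \<longrightarrow>
            (\<exists>g. is_pullback_metric W Q \<A> T \<F> b g \<and> kaehler_pseudo_metric \<A> g))"
proof -
  obtain N where "weight_filt W N" by (rule ex_weight_filt[OF assms(1)])
  then interpret weight_filt W N .
  interpret polarized W N Q by unfold_locales (rule assms(2))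
  have frames: "\<exists>l B. adapted_frame W Q F l B" if "F \<in> classifying_space W Q h" for F
  proof -
    interpret tate_type W N Q h F by unfold_locales (use assms(3) that in auto)
    show ?thesis by (rule ex_adapted_frame)
  qed
  have "hodge_curvature W Q F a b s = 0"
    if F: "F \<in> classifying_space W Q h" and abs: "a \<in> qF W Q F" "b \<in> qF W Q F" "s \<in> qF W Q F" for F a b s
  proof -
    obtain l B where "adapted_frame W Q F l B" using frames[OF F] by blast
    then interpret tate_frame W N Q F l B by unfold_locales
    show ?thesis using curvature_zero abs by (simp add: qF_eq)
  qed
  then show ?thesis using pullback_kaehler frames by blast
qed

end
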